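(* Let $p\ge3$, $n\ge1$, $d_1\ge\cdots\ge d_p>0$, $D=\mathrm{diag}(d_1,\dots,d_p)$, $j\in\mathbb{R}$, and suppose $(X',Z')'\in\mathbb{R}^p\times\mathbb{R}^n$ has density $\prod_i d_i^{-1/2}\,\sigma^{-p-n} f(\{(x-\theta)'D^{-1}(x-\theta)+z'z\}/\sigma^2)$. For $\alpha>0$, $\gamma>0$ and $C=\mathrm{diag}(c_1,\dots,c_p)$, let $$\hat\theta_{\mathrm{SB}}=\left(I-\frac{\alpha}{\gamma(\alpha+1)+W}C^{-1}\right)X,\qquad W=X'C^{-1}D^{-1}X/Z'Z .$$ Then $\hat\theta_{\mathrm{SB}}$ is minimax under $L_j(\delta,\theta,\sigma^2)=(\delta-\theta)'D^{-j}(\delta-\theta)/\sigma^2$ and condition number decreasing (and, under normality and $\gamma\ge1$, generalized Bayes) if either of the following holds. (i) $\sum_{i=1}^p(d_i/d_1)^{1-j}-2>0$; $\eta_{**}\in(\max\{0,1-j\},\eta_* )$ where $\eta_*$ is the unique root of $\sum_{i=1}^p(d_i/d_1)^\eta=2$ if $d_1>d_2$, and $\eta_{**}>\max(1-j,0)$ is arbitrary if $d_1=d_2$; $c_i=(d_1/d_i)^{j-1+\eta_{**}}$ for all $i$; $\alpha\le u_+$ and $\gamma\ge\alpha/\{(\alpha+1)v_+\}$, where $$u_+=\frac{2}{n+2}\left(\sum_{i=1}^p(d_i/d_1)^{\eta_{**}}-2\right),\qquad v_+=\min_{i>k}\left(\frac{c_ic_k(d_1d_k-d_id_p)}{c_id_1d_k-c_kd_id_p}\right).$$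 (ii) $\sum_{i=1}^p(d_i/d_1)^{1-j}-2\le0$; $\nu_{**}\in[0,\nu_* )$ where $\nu_*\in(0,1-j)$ is the unique solution of $\sum_{i=1}^{p-1}(d_i/d_1)^\nu=2$ if $p\ge4$, and $\nu_{**}=0$ if $p=3$; $c_i=(d_i/d_{p-1})^{1-j-\nu_{**}}$ for $i\le p-1$ and $c_p>c_1$; $\alpha\le u_-$ and $\gamma\ge\alpha/\{(\alpha+1)v_-\}$, where $$u_-=\frac{2}{n+2}\left(\sum_{i=1}^{p-1}\left(\frac{d_i}{d_1}\right)^{\nu_{**}}-2+\frac{c_1}{c_p}\left(\frac{d_p}{d_1}\right)^{1-j}\right),$$ $$v_-=\min\left(\frac{c_1c_{p-1}(d_{p-1}-d_p)}{c_1d_{p-1}-c_{p-1}d_p},\ \frac{c_{p-1}c_p(d_1d_{p-1}-d_p^2)}{c_pd_1d_{p-1}-c_{p-1}d_p^2}\right).$$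
   Context: Here $f:[0,\infty)\to[0,\infty)$ is a fixed function such that the displayed expression is a probability density and $X$ has finite second moments; $\theta\in\mathbb{R}^p$, $\sigma>0$ are unknown. The risk is $R_j(\delta,\theta,\sigma^2)=E[L_j(\delta(X,Z),\theta,\sigma^2)]$; $X$ is minimax with constant risk, so $\delta$ is minimax if and only if $R_j(\delta,\theta,\sigma^2)\le R_j(X,\theta,\sigma^2)$ for all $\theta$, $\sigma>0$. An estimator $(I-\frac{\phi(W)}{W}C^{-1})X$ is condition number decreasing if, for every $w>0$, with $t=\phi(w)/w$, $\frac{\max_i d_i(1-t/c_i)}{\min_i d_i(1-t/c_i)}\le\frac{d_1}{d_p}$. For $\hat\theta_{\mathrm{SB}}$, $\phi(w)/w=\alpha/\{\gamma(\alpha+1)+w\}$. (These are the condition numbers of the matrices $G$ and $A'A$ in the representations $G^{-1}A'y$ and $(A'A)^{-1}A'y$ of the corresponding estimators of the regression coefficients in $y=A\beta+\varepsilon$.) "Generalized Bayes under normality" means: when $(X',Z')'$ is normal with mean $(\theta',0')'$ and covariance $\sigma^2\mathrm{diag}(d_1,\dots,d_p,1,\dots,1)$, the estimator equals $E(\eta\theta\mid X,S)/E(\eta\mid X,S)$ ($S=Z'Z$, $\eta=\sigma^{-2}$), the generalized Bayes estimator under $L_j$, for a prior of the following form: $\theta\mid\lambda,\eta\sim N_p(0,\eta^{-1}D(\lambda^{-1}C-I))$, $\lambda$ with density proportional to $\lambda^a(1-\gamma\lambda)^b$ on $[0,1/\gamma]$, $\eta$ with density proportional to $\eta^e$ on $(0,\infty)$,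 where $a>-p/2-1$, $b>-1$, $e>-p/2-n/2-2$, $b=n/2-a+e-1$ and $\alpha=(p/2+a+1)/(n/2+e-a)$. *)

theory Defs
  imports "HOL-Probability.Probability"
begin

text \<open>
  Vectors of \<open>\<real>\<^sup>p\<close> and \<open>\<real>\<^sup>n\<close> are functions on \<open>{1..p}\<close> and \<open>{1..n}\<close>; diagonal matrices such as \<open>D\<close> and
  \<open>C\<close> are given by their diagonals \<open>d\<close>, \<open>c\<close>.  Functions used as parameters (\<open>\<theta>\<close>, \<open>d\<close>, \<open>c\<close>) may
  take any value outside the index set.
\<close>

section \<open>The model, risk and minimaxity\<close>

definition obs_space :: "nat \<Rightarrow> nat \<Rightarrow> ((nat \<Rightarrow> real) \<times> (nat \<Rightarrow> real)) measure" where
  "obs_space p n = (\<Pi>\<^sub>M i\<in>{1..p}. lborel) \<Otimes>\<^sub>M (\<Pi>\<^sub>M i\<in>{1..n}. lborel)"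

definition obs_density ::
  "nat \<Rightarrow> nat \<Rightarrow> (nat \<Rightarrow> real) \<Rightarrow> (real \<Rightarrow> real) \<Rightarrow> (nat \<Rightarrow> real) \<Rightarrow> real
    \<Rightarrow> (nat \<Rightarrow> real) \<times> (nat \<Rightarrow> real) \<Rightarrow> real" where
  "obs_density p n d f \<theta> \<sigma> = (\<lambda>(x, z).
     (\<Prod>i=1..p. 1 / sqrt (d i)) * (1 / \<sigma> ^ (p + n)) *
     f (((\<Sum>i=1..p. (x i - \<theta> i)\<^sup>2 / d i) + (\<Sum>i=1..n. (z i)\<^sup>2)) / \<sigma>\<^sup>2))"

definition obs_dist ::
  "nat \<Rightarrow> nat \<Rightarrow> (nat \<Rightarrow> real) \<Rightarrow> (real \<Rightarrow> real) \<Rightarrow> (nat \<Rightarrow> real) \<Rightarrow> real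
    \<Rightarrow> ((nat \<Rightarrow> real) \<times> (nat \<Rightarrow> real)) measure" where
  "obs_dist p n d f \<theta> \<sigma> = density (obs_space p n) (\<lambda>v. ennreal (obs_density p n d f \<theta> \<sigma> v))"

text \<open>The assumption on \<open>f : [0,\<infinity>) \<rightarrow> [0,\<infinity>)\<close>; the values of \<open>f\<close> on negative reals play no role.\<close>

definition admissible_f :: "nat \<Rightarrow> nat \<Rightarrow> (nat \<Rightarrow> real) \<Rightarrow> (real \<Rightarrow> real) \<Rightarrow> bool" where
  "admissible_f p n d f \<longleftrightarrow>
     (\<forall>t\<ge>0. f t \<ge> 0) \<and>
     (\<forall>\<theta> \<sigma>. \<sigma> > 0 \<longrightarrow>
        obs_density p n d f \<theta> \<sigma> \<in> borel_measurable (obs_space p n) \<and>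
        prob_space (obs_dist p n d f \<theta> \<sigma>) \<and>
        (\<forall>i\<in>{1..p}. integrable (obs_dist p n d f \<theta> \<sigma>) (\<lambda>(x, z). (x i)\<^sup>2)))"

definition estimators ::
  "nat \<Rightarrow> nat \<Rightarrow> ((nat \<Rightarrow> real) \<times> (nat \<Rightarrow> real) \<Rightarrow> nat \<Rightarrow> real) set" where
  "estimators p n = obs_space p n \<rightarrow>\<^sub>M (\<Pi>\<^sub>M i\<in>{1..p}. borel)"

definition loss ::
  "nat \<Rightarrow> (nat \<Rightarrow> real) \<Rightarrow> real \<Rightarrow> (nat \<Rightarrow> real) \<Rightarrow> (nat \<Rightarrow> real) \<Rightarrow> real \<Rightarrow> real" where
  "loss p d j a \<theta> \<sigma> = (\<Sum>i=1..p. d i powr (-j) * (a i - \<theta> i)\<^sup>2) / \<sigma>\<^sup>2"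

definition risk ::
  "nat \<Rightarrow> nat \<Rightarrow> (nat \<Rightarrow> real) \<Rightarrow> (real \<Rightarrow> real) \<Rightarrow> real
    \<Rightarrow> ((nat \<Rightarrow> real) \<times> (nat \<Rightarrow> real) \<Rightarrow> nat \<Rightarrow> real) \<Rightarrow> (nat \<Rightarrow> real) \<Rightarrow> real \<Rightarrow> ennreal" where
  "risk p n d f j \<delta> \<theta> \<sigma> = (\<integral>\<^sup>+ v. ennreal (loss p d j (\<delta> v) \<theta> \<sigma>) \<partial>obs_dist p n d f \<theta> \<sigma>)"

definition max_risk ::
  "nat \<Rightarrow> nat \<Rightarrow> (nat \<Rightarrow> real) \<Rightarrow> (real \<Rightarrow> real) \<Rightarrow> real
    \<Rightarrow> ((nat \<Rightarrow> real) \<times> (nat \<Rightarrow> real) \<Rightarrow> nat \<Rightarrow> real) \<Rightarrow> ennreal" where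
  "max_risk p n d f j \<delta> = (SUP (\<theta>, \<sigma>)\<in>UNIV \<times> {0<..}. risk p n d f j \<delta> \<theta> \<sigma>)"

definition minimax ::
  "nat \<Rightarrow> nat \<Rightarrow> (nat \<Rightarrow> real) \<Rightarrow> (real \<Rightarrow> real) \<Rightarrow> real
    \<Rightarrow> ((nat \<Rightarrow> real) \<times> (nat \<Rightarrow> real) \<Rightarrow> nat \<Rightarrow> real) \<Rightarrow> bool" where
  "minimax p n d f j \<delta> \<longleftrightarrow>
     \<delta> \<in> estimators p n \<and>
     (\<forall>\<delta>'\<in>estimators p n. max_risk p n d f j \<delta> \<le> max_risk p n d f j \<delta>')"

section \<open>Shrinkage estimators and condition numbers\<close>

text \<open>
  The function \<open>h\<close> below stands for \<open>w \<mapsto> \<phi>(w) / w\<close>.  On the null set \<open>z = 0\<close>, \<open>W\<close> takes the value 0.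
\<close>

definition W_stat ::
  "nat \<Rightarrow> nat \<Rightarrow> (nat \<Rightarrow> real) \<Rightarrow> (nat \<Rightarrow> real) \<Rightarrow> (nat \<Rightarrow> real) \<times> (nat \<Rightarrow> real) \<Rightarrow> real" where
  "W_stat p n d c = (\<lambda>(x, z). (\<Sum>i=1..p. (x i)\<^sup>2 / (c i * d i)) / (\<Sum>i=1..n. (z i)\<^sup>2))"

definition shrinkage_est ::
  "nat \<Rightarrow> nat \<Rightarrow> (nat \<Rightarrow> real) \<Rightarrow> (nat \<Rightarrow> real) \<Rightarrow> (real \<Rightarrow> real)
    \<Rightarrow> (nat \<Rightarrow> real) \<times> (nat \<Rightarrow> real) \<Rightarrow> nat \<Rightarrow> real" where
  "shrinkage_est p n d c h v = (\<lambda>i\<in>{1..p}. (1 - h (W_stat p n d c v) / c i) * fst v i)"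

definition cond_number_decreasing ::
  "nat \<Rightarrow> (nat \<Rightarrow> real) \<Rightarrow> (nat \<Rightarrow> real) \<Rightarrow> (real \<Rightarrow> real) \<Rightarrow> bool" where
  "cond_number_decreasing p d c h \<longleftrightarrow>
     (\<forall>w>0. (MAX i\<in>{1..p}. d i * (1 - h w / c i)) / (MIN i\<in>{1..p}. d i * (1 - h w / c i))
            \<le> d 1 / d p)"

definition h_SB :: "real \<Rightarrow> real \<Rightarrow> real \<Rightarrow> real" where
  "h_SB \<alpha> \<gamma> w = \<alpha> / (\<gamma> * (\<alpha> + 1) + w)"

definition theta_SB ::
  "nat \<Rightarrow> nat \<Rightarrow> (nat \<Rightarrow> real) \<Rightarrow> (nat \<Rightarrow> real) \<Rightarrow> real \<Rightarrow> real
    \<Rightarrow> (nat \<Rightarrow> real) \<times> (nat \<Rightarrow> real) \<Rightarrow> nat \<Rightarrow> real" where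
  "theta_SB p n d c \<alpha> \<gamma> = shrinkage_est p n d c (h_SB \<alpha> \<gamma>)"

section \<open>Generalized Bayes estimators under normality\<close>

text \<open>The density of \<open>\<eta>\<^sup>-\<^sup>1 \<chi>\<^sup>2\<^sub>n\<close>, the distribution of \<open>S = Z'Z\<close> for \<open>Z\<close> normal with covariance \<open>\<eta>\<^sup>-\<^sup>1 I\<close>.\<close>

definition scaled_chi2_density :: "nat \<Rightarrow> real \<Rightarrow> real \<Rightarrow> real" where
  "scaled_chi2_density n \<eta> s =
     (if s > 0 then (\<eta> / 2) powr (real n / 2) * s powr (real n / 2 - 1) * exp (- \<eta> * s / 2) / Gamma (real n / 2)
      else 0)"

definition normal_likelihood ::
  "nat \<Rightarrow> nat \<Rightarrow> (nat \<Rightarrow> real) \<Rightarrow> (nat \<Rightarrow> real) \<Rightarrow> real \<Rightarrow> (nat \<Rightarrow> real) \<Rightarrow> real \<Rightarrow> real" where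
  "normal_likelihood p n d x s \<theta> \<eta> =
     (\<Prod>i=1..p. normal_density (\<theta> i) (sqrt (d i / \<eta>)) (x i)) * scaled_chi2_density n \<eta> s"

text \<open>
  The hierarchical prior density of \<open>(\<theta>, \<lambda>, \<eta>)\<close>, with \<open>l\<close> for \<open>\<lambda>\<close>.  It is in general improper, so the constants
  of proportionality of the densities of \<open>\<lambda>\<close> and \<open>\<eta>\<close> are taken to be 1; they cancel in posterior
  expectations.
\<close>

definition prior_density ::
  "nat \<Rightarrow> (nat \<Rightarrow> real) \<Rightarrow> (nat \<Rightarrow> real) \<Rightarrow> real \<Rightarrow> real \<Rightarrow> real \<Rightarrow> real
    \<Rightarrow> (nat \<Rightarrow> real) \<Rightarrow> real \<Rightarrow> real \<Rightarrow> real" where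
  "prior_density p d c \<gamma> a b e \<theta> l \<eta> =
     (\<Prod>i=1..p. normal_density 0 (sqrt (d i * (c i / l - 1) / \<eta>)) (\<theta> i)) *
     (indicator {0..1 / \<gamma>} l * l powr a * (1 - \<gamma> * l) powr b) *
     (indicator {0<..} \<eta> * \<eta> powr e)"

definition param_space :: "nat \<Rightarrow> ((nat \<Rightarrow> real) \<times> real \<times> real) measure" where
  "param_space p = (\<Pi>\<^sub>M i\<in>{1..p}. lborel) \<Otimes>\<^sub>M (lborel \<Otimes>\<^sub>M lborel)"

definition posterior_kernel ::
  "nat \<Rightarrow> nat \<Rightarrow> (nat \<Rightarrow> real) \<Rightarrow> (nat \<Rightarrow> real) \<Rightarrow> real \<Rightarrow> real \<Rightarrow> real \<Rightarrow> real
    \<Rightarrow> (nat \<Rightarrow> real) \<Rightarrow> real \<Rightarrow> (nat \<Rightarrow> real) \<times> real \<times> real \<Rightarrow> real" where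
  "posterior_kernel p n d c \<gamma> a b e x s = (\<lambda>(\<theta>, l, \<eta>).
     normal_likelihood p n d x s \<theta> \<eta> * prior_density p d c \<gamma> a b e \<theta> l \<eta>)"

definition posterior_exp ::
  "nat \<Rightarrow> nat \<Rightarrow> (nat \<Rightarrow> real) \<Rightarrow> (nat \<Rightarrow> real) \<Rightarrow> real \<Rightarrow> real \<Rightarrow> real \<Rightarrow> real
    \<Rightarrow> ((nat \<Rightarrow> real) \<times> real \<times> real \<Rightarrow> real) \<Rightarrow> (nat \<Rightarrow> real) \<Rightarrow> real \<Rightarrow> real" where
  "posterior_exp p n d c \<gamma> a b e g x s =
     (\<integral>q. g q * posterior_kernel p n d c \<gamma> a b e x s q \<partial>param_space p) /
     (\<integral>q. posterior_kernel p n d c \<gamma> a b e x s q \<partial>param_space p)"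

text \<open>The posterior is proper at \<open>(x, s)\<close> and \<open>\<eta>\<close> and all \<open>\<eta> \<theta>\<^sub>i\<close> have finite posterior expectations.\<close>

definition posterior_ok ::
  "nat \<Rightarrow> nat \<Rightarrow> (nat \<Rightarrow> real) \<Rightarrow> (nat \<Rightarrow> real) \<Rightarrow> real \<Rightarrow> real \<Rightarrow> real \<Rightarrow> real
    \<Rightarrow> (nat \<Rightarrow> real) \<Rightarrow> real \<Rightarrow> bool" where
  "posterior_ok p n d c \<gamma> a b e x s \<longleftrightarrow>
     (let k = posterior_kernel p n d c \<gamma> a b e x s; M = param_space p in
       integrable M k \<and> (\<integral>q. k q \<partial>M) > 0 \<and>
       integrable M (\<lambda>(\<theta>, l, \<eta>). \<eta> * k (\<theta>, l, \<eta>)) \<and>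
       (\<forall>i\<in>{1..p}. integrable M (\<lambda>(\<theta>, l, \<eta>). \<eta> * \<theta> i * k (\<theta>, l, \<eta>))))"

text \<open>
  The estimator \<open>\<delta>\<close> is compared with \<open>E(\<eta>\<theta> | X, S) / E(\<eta> | X, S)\<close> off the null set \<open>z = 0\<close>.
  The condition on \<open>c i / l - 1\<close> says that the prior covariance matrix of \<open>\<theta>\<close> is positive definite.
\<close>

definition generalized_Bayes ::
  "nat \<Rightarrow> nat \<Rightarrow> (nat \<Rightarrow> real) \<Rightarrow> (nat \<Rightarrow> real) \<Rightarrow> real \<Rightarrow> real
    \<Rightarrow> ((nat \<Rightarrow> real) \<times> (nat \<Rightarrow> real) \<Rightarrow> nat \<Rightarrow> real) \<Rightarrow> bool" where
  "generalized_Bayes p n d c \<alpha> \<gamma> \<delta> \<longleftrightarrow>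
     (\<exists>a b e :: real.
        a > - real p / 2 - 1 \<and> b > -1 \<and> e > - real p / 2 - real n / 2 - 2 \<and>
        b = real n / 2 - a + e - 1 \<and>
        \<alpha> = (real p / 2 + a + 1) / (real n / 2 + e - a) \<and>
        (\<forall>l\<in>{0<..<1 / \<gamma>}. \<forall>i\<in>{1..p}. c i / l - 1 > 0) \<and>
        (\<forall>x z. (x, z) \<in> space (obs_space p n) \<longrightarrow> (\<Sum>i=1..n. (z i)\<^sup>2) > 0 \<longrightarrow>
           (let s = (\<Sum>i=1..n. (z i)\<^sup>2); E = posterior_exp p n d c \<gamma> a b e in
             posterior_ok p n d c \<gamma> a b e x s \<and>
             (\<forall>i\<in>{1..p}. \<delta> (x, z) i =
                E (\<lambda>(\<theta>, l, \<eta>). \<eta> * \<theta> i) x s / E (\<lambda>(\<theta>, l, \<eta>). \<eta>) x s))))"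

section \<open>The two sets of conditions\<close>

definition eta_star :: "nat \<Rightarrow> (nat \<Rightarrow> real) \<Rightarrow> real" where
  "eta_star p d = (THE \<eta>. (\<Sum>i=1..p. (d i / d 1) powr \<eta>) = 2)"

definition u_plus :: "nat \<Rightarrow> nat \<Rightarrow> (nat \<Rightarrow> real) \<Rightarrow> real \<Rightarrow> real" where
  "u_plus p n d \<eta> = 2 / (real n + 2) * ((\<Sum>i=1..p. (d i / d 1) powr \<eta>) - 2)"

definition v_plus :: "nat \<Rightarrow> (nat \<Rightarrow> real) \<Rightarrow> (nat \<Rightarrow> real) \<Rightarrow> real" where
  "v_plus p d c = (MIN (i, k)\<in>{(i, k). 1 \<le> k \<and> k < i \<and> i \<le> p}.
     c i * c k * (d 1 * d k - d i * d p) / (c i * d 1 * d k - c k * d i * d p))"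

text \<open>
  Under the first four conditions below, \<open>v_plus p d c > 0\<close> unless \<open>d 1 = d p\<close>.  If \<open>d 1 = d p\<close>,
  every quotient in \<open>v_plus\<close> is \<open>0 / 0 = 0\<close> and the last condition imposes nothing on \<open>\<gamma>\<close>.
\<close>

definition condition_i ::
  "nat \<Rightarrow> nat \<Rightarrow> (nat \<Rightarrow> real) \<Rightarrow> real \<Rightarrow> (nat \<Rightarrow> real) \<Rightarrow> real \<Rightarrow> real \<Rightarrow> real \<Rightarrow> bool" where
  "condition_i p n d j c \<alpha> \<gamma> \<eta> \<longleftrightarrow>
     (\<Sum>i=1..p. (d i / d 1) powr (1 - j)) - 2 > 0 \<and>
     \<eta> > max 0 (1 - j) \<and>
     (d 1 > d 2 \<longrightarrow> \<eta> < eta_star p d) \<and>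
     (\<forall>i\<in>{1..p}. c i = (d 1 / d i) powr (j - 1 + \<eta>)) \<and>
     \<alpha> \<le> u_plus p n d \<eta> \<and>
     \<gamma> \<ge> \<alpha> / ((\<alpha> + 1) * v_plus p d c)"

definition nu_star :: "nat \<Rightarrow> (nat \<Rightarrow> real) \<Rightarrow> real \<Rightarrow> real" where
  "nu_star p d j = (THE \<nu>. 0 < \<nu> \<and> \<nu> < 1 - j \<and> (\<Sum>i=1..p-1. (d i / d 1) powr \<nu>) = 2)"

definition u_minus ::
  "nat \<Rightarrow> nat \<Rightarrow> (nat \<Rightarrow> real) \<Rightarrow> real \<Rightarrow> (nat \<Rightarrow> real) \<Rightarrow> real \<Rightarrow> real" where
  "u_minus p n d j c \<nu> = 2 / (real n + 2) *
     ((\<Sum>i=1..p-1. (d i / d 1) powr \<nu>) - 2 + c 1 / c p * (d p / d 1) powr (1 - j))"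

definition v_minus :: "nat \<Rightarrow> (nat \<Rightarrow> real) \<Rightarrow> (nat \<Rightarrow> real) \<Rightarrow> real" where
  "v_minus p d c = min
     (c 1 * c (p-1) * (d (p-1) - d p) / (c 1 * d (p-1) - c (p-1) * d p))
     (c (p-1) * c p * (d 1 * d (p-1) - (d p)\<^sup>2) / (c p * d 1 * d (p-1) - c (p-1) * (d p)\<^sup>2))"

text \<open>
  If \<open>d (p-1) = d p\<close>, then \<open>v_minus p d c = 0\<close> and no \<open>\<gamma>\<close> satisfies the bound
  \<open>\<gamma> \<ge> \<alpha> / ((\<alpha> + 1) v\<^sub>-)\<close>; since division by 0 yields 0, this is made explicit by \<open>v_minus p d c > 0\<close>.
\<close>

definition condition_ii ::
  "nat \<Rightarrow> nat \<Rightarrow> (nat \<Rightarrow> real) \<Rightarrow> real \<Rightarrow> (nat \<Rightarrow> real) \<Rightarrow> real \<Rightarrow> real \<Rightarrow> real \<Rightarrow> bool" where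
  "condition_ii p n d j c \<alpha> \<gamma> \<nu> \<longleftrightarrow>
     (\<Sum>i=1..p. (d i / d 1) powr (1 - j)) - 2 \<le> 0 \<and>
     (if p \<ge> 4 then 0 \<le> \<nu> \<and> \<nu> < nu_star p d j else \<nu> = 0) \<and>
     (\<forall>i\<in>{1..p-1}. c i = (d i / d (p-1)) powr (1 - j - \<nu>)) \<and>
     c p > c 1 \<and>
     \<alpha> \<le> u_minus p n d j c \<nu> \<and>
     v_minus p d c > 0 \<and>
     \<gamma> \<ge> \<alpha> / ((\<alpha> + 1) * v_minus p d c)"

end

theory Submission
  imports Defs
begin

text \<open>
  Integrating the radial density \<open>f\<close> against its tail \<open>F(t) = \<integral>\<^sub>t\<^sup>\<infinity> f / 2\<close>, a Fubini argument on each line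
  gives \<open>E\<^sub>f[(x\<^sub>i - \<theta>\<^sub>i) g] = d\<^sub>i \<sigma>\<^sup>2 E\<^sub>F[\<partial>\<^sub>i g]\<close>, and likewise for \<open>z\<^sub>k\<close>, without any smoothness of \<open>f\<close>.
  Applied to \<open>x\<^sub>i h(W)\<close> and to \<open>z\<^sub>k Q h(W)\<^sup>2 / S\<close>, where \<open>S = Z'Z\<close> and \<open>Q = X'D\<^sup>-\<^sup>jC\<^sup>-\<^sup>2X\<close>, it turns the risk difference
  between the shrinkage estimator and \<open>X\<close> into one integral against \<open>F\<close> whose integrand is nonpositive
  as soon as \<open>\<alpha> \<le> 2 / (n + 2) (\<Sum> a\<^sub>i / max a\<^sub>i - 2)\<close> with \<open>a\<^sub>i = d\<^sub>i\<^sup>1\<^sup>-\<^sup>j / c\<^sub>i\<close>.  Both \<open>u\<^sub>+\<close> and \<open>u\<^sub>-\<close> are this bound.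

  That \<open>X\<close> itself is minimax follows from uniform priors on growing boxes.

  The condition number decreases if, for all pairs of indices, certain inequalities affine in \<open>h(w)\<close>
  hold; the bounds \<open>v\<^sub>+\<close> and \<open>v\<^sub>-\<close> come from the critical pairs.

  For the generalized Bayes property the choice \<open>b = 0\<close> is available.  The posterior of \<open>(\<lambda>, \<eta>)\<close> is then
  proportional to \<open>\<lambda>\<^sup>\<alpha>\<^sup>-\<^sup>1 \<eta>\<^sup>\<alpha> exp(- \<eta> (\<lambda>N + s) / 2)\<close>, \<open>N = X'C\<^sup>-\<^sup>1D\<^sup>-\<^sup>1X\<close>, and the substitution
  \<open>u = \<lambda> / (\<lambda>N + s)\<close> makes all integrals elementary.
\<close>

section \<open>Integration by parts against a radial density\<close>

text \<open>The obstacle is that the two parts of the risk difference first stand under different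
  measures: integration by parts in x moves the cross term from f to F, while the quadratic term
  \<open>Q h(W)^2\<close> stays under f, and f and F are not comparable in general. Writing the
  quadratic term as the sum of z_k times \<open>z_k Q h(W)^2 / S\<close> and integrating by parts in
  z moves it to F as well, and only then can the two be compared pointwise. With
  \<open>K = \<gamma> (\<alpha> + 1)\<close> and \<open>Y = K S + N\<close> the quotient
  \<open>Q h(W)^2 / S\<close> equals \<open>Q \<alpha>^2 S / Y^2\<close>, which has no pole at S = 0
  as long as N > 0. In the bound on \<alpha>, the subtracted 2 comes from differentiating h in x,
  the n from the n coordinates of z, and the 2 in n + 2 from differentiating \<open>S / Y^2\<close>.
  F has finite mass because this mass is a second moment of X up to a constant. For the Bayes part,
  b = 0 forces n/2 + e - a = 1, so the relation for \<alpha> can be solved for a and e.\<close>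

definition half_tail :: "(real \<Rightarrow> real) \<Rightarrow> real \<Rightarrow> ennreal" where
  "half_tail f t = (\<integral>\<^sup>+u. (if t < u then ennreal (f u / 2) else 0) \<partial>lborel)"

lemma measurable_half_tail [measurable]:
  assumes [measurable]: "f \<in> borel_measurable borel"
  shows "half_tail f \<in> borel_measurable borel"
  unfolding half_tail_def by measurable

text \<open>Exhaustion by compact intervals and monotone convergence extend the substitution
  \<open>u = r + v^2 / D\<close> to a half-line; with nonnegative integrals no integrability
  question arises.\<close>

lemma nn_integral_tail_substitution:
  fixes h :: "real \<Rightarrow> ennreal"
  assumes [measurable]: "h \<in> borel_measurable borel" and D: "D > 0" and a: "a \<ge> 0"
  shows "(\<integral>\<^sup>+u. (if r + a\<^sup>2 / D < u then h u else 0) \<partial>lborel) =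
    (\<integral>\<^sup>+v. (if a < v then h (r + v\<^sup>2 / D) * ennreal (2 * v / D) else 0) \<partial>lborel)"
proof -
  let ?g = "\<lambda>v. r + v\<^sup>2 / D"
  \<comment> \<open>The intervals start with length 1 because the substitution rule on a compact
    interval needs distinct endpoints.\<close>
  let ?L = "\<lambda>n::nat. \<lambda>u. h u * indicator {?g a..?g (a + (1 + real n))} u"
  let ?R = "\<lambda>n::nat. \<lambda>v. h (?g v) * ennreal (2 * v / D) * indicator {a..a + (1 + real n)} v"
  have eq: "(\<integral>\<^sup>+u. ?L n u \<partial>lborel) = (\<integral>\<^sup>+v. ?R n v \<partial>lborel)" for n
    by (rule nn_integral_substitution_aux)
       (use a D in \<open>auto intro!: derivative_eq_intros continuous_intros\<close>)
  have mono: "?g (a + (1 + real m)) \<le> ?g (a + (1 + real n))" if "m \<le> n" for m n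
    using that a D by (intro add_left_mono divide_right_mono power_mono) auto
  have ge: "?g (a + (1 + real n)) \<ge> ?g a + real n / D" for n
  proof -
    have "a\<^sup>2 + real n \<le> (a + (1 + real n))\<^sup>2" using a by (simp add: power2_eq_square algebra_simps)
    then have "(a\<^sup>2 + real n) / D \<le> (a + (1 + real n))\<^sup>2 / D" using D by (intro divide_right_mono) auto
    then show ?thesis by (simp add: add_divide_distrib)
  qed
  have "(\<integral>\<^sup>+u. (SUP n. ?L n u) \<partial>lborel) = (SUP n. (\<integral>\<^sup>+u. ?L n u \<partial>lborel))"
    by (intro nn_integral_monotone_convergence_SUP)
       (use mono in \<open>auto simp: incseq_def le_fun_def split: split_indicator intro: order_trans\<close>)
  moreover have "(\<integral>\<^sup>+v. (SUP n. ?R n v) \<partial>lborel) = (SUP n. (\<integral>\<^sup>+v. ?R n v \<partial>lborel))"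
    by (intro nn_integral_monotone_convergence_SUP)
       (auto simp: incseq_def le_fun_def split: split_indicator)
  moreover have "(SUP n. ?L n u) = h u * indicator {?g a..} u" for u
  proof (rule antisym)
    show "(SUP n. ?L n u) \<le> h u * indicator {?g a..} u"
      by (intro SUP_least) (auto split: split_indicator)
    obtain n :: nat where "(u - ?g a) * D \<le> real n" using real_arch_simple by blast
    then have "u - ?g a \<le> real n / D" using D by (simp add: pos_le_divide_eq)
    then have "u \<le> ?g (a + (1 + real n))" using ge[of n] by linarith
    then have "h u * indicator {?g a..} u \<le> ?L n u" by (auto split: split_indicator)
    then show "h u * indicator {?g a..} u \<le> (SUP n. ?L n u)"
      by (rule order_trans) (rule SUP_upper, simp)
  qed
  moreover have "(SUP n. ?R n v) = h (?g v) * ennreal (2 * v / D) * indicator {a..} v" for v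
  proof (rule antisym)
    show "(SUP n. ?R n v) \<le> h (?g v) * ennreal (2 * v / D) * indicator {a..} v"
      by (intro SUP_least) (auto split: split_indicator)
    obtain n :: nat where "v - a \<le> real n" using real_arch_simple by blast
    then have "h (?g v) * ennreal (2 * v / D) * indicator {a..} v \<le> ?R n v"
      by (auto split: split_indicator)
    then show "h (?g v) * ennreal (2 * v / D) * indicator {a..} v \<le> (SUP n. ?R n v)"
      by (rule order_trans) (rule SUP_upper, simp)
  qed
  ultimately have "(\<integral>\<^sup>+u. h u * indicator {?g a..} u \<partial>lborel) =
      (\<integral>\<^sup>+v. h (?g v) * ennreal (2 * v / D) * indicator {a..} v \<partial>lborel)"
    using eq by simp
  moreover have "(\<integral>\<^sup>+u. (if ?g a < u then h u else 0) \<partial>lborel) = (\<integral>\<^sup>+u. h u * indicator {?g a..} u \<partial>lborel)"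
    by (intro nn_integral_cong_AE eventually_mono[OF AE_lborel_singleton[of "?g a"]])
       (auto split: split_indicator)
  moreover have "(\<integral>\<^sup>+v. (if a < v then h (?g v) * ennreal (2 * v / D) else 0) \<partial>lborel) =
      (\<integral>\<^sup>+v. h (?g v) * ennreal (2 * v / D) * indicator {a..} v \<partial>lborel)"
    by (intro nn_integral_cong_AE eventually_mono[OF AE_lborel_singleton[of a]])
       (auto split: split_indicator)
  ultimately show ?thesis by simp
qed

text \<open>The substitution \<open>u = r + v^2 / D\<close> turns the tail into an integral over all
  v exceeding the distance of y from t. In this form an integral against F becomes a double integral
  over |y - t| < v, whose order can be exchanged.\<close>

lemma half_tail_square:
  assumes [measurable]: "f \<in> borel_measurable borel" and D: "D > 0" and f: "\<And>t. f t \<ge> 0"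
  shows "ennreal D * half_tail f (r + (y - t)\<^sup>2 / D) =
    (\<integral>\<^sup>+v. (if \<bar>y - t\<bar> < v then ennreal (v * f (r + v\<^sup>2 / D)) else 0) \<partial>lborel)"
proof -
  have "ennreal D * half_tail f (r + (y - t)\<^sup>2 / D) = ennreal D *
     (\<integral>\<^sup>+v. (if \<bar>y - t\<bar> < v then ennreal (f (r + v\<^sup>2 / D) / 2) * ennreal (2 * v / D) else 0) \<partial>lborel)"
    unfolding half_tail_def
    using nn_integral_tail_substitution[of "\<lambda>u. ennreal (f u / 2)" D "\<bar>y - t\<bar>" r] D by simp
  also have "\<dots> = (\<integral>\<^sup>+v. ennreal D *
     (if \<bar>y - t\<bar> < v then ennreal (f (r + v\<^sup>2 / D) / 2) * ennreal (2 * v / D) else 0) \<partial>lborel)"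
    by (rule nn_integral_cmult[symmetric]) measurable
  also have "\<dots> = (\<integral>\<^sup>+v. (if \<bar>y - t\<bar> < v then ennreal (v * f (r + v\<^sup>2 / D)) else 0) \<partial>lborel)"
  proof (intro nn_integral_cong)
    fix v
    have "ennreal D * (ennreal (f (r + v\<^sup>2 / D) / 2) * ennreal (2 * v / D)) =
        ennreal (D * (f (r + v\<^sup>2 / D) / 2 * (2 * v / D)))" if "0 \<le> v"
      using D f[of "r + v\<^sup>2 / D"] that by (simp only: ennreal_mult divide_nonneg_nonneg mult_nonneg_nonneg less_imp_le zero_le_numeral)
    moreover have "D * (f (r + v\<^sup>2 / D) / 2 * (2 * v / D)) = v * f (r + v\<^sup>2 / D)"
      using D by simp
    ultimately show "ennreal D * (if \<bar>y - t\<bar> < v then ennreal (f (r + v\<^sup>2 / D) / 2) * ennreal (2 * v / D) else 0) =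
        (if \<bar>y - t\<bar> < v then ennreal (v * f (r + v\<^sup>2 / D)) else 0)"
      by (cases "0 \<le> v") auto
  qed
  finally show ?thesis .
qed

text \<open>This is the case g(y) = y - t of the integration by parts, done separately in
  nonnegative integrals because it is the source of the finiteness of F that the general case
  assumes. The interval |y - t| < v has length 2 v, and the 2 is absorbed since
  \<open>v^2 f(r + v^2 / D)\<close> is even in v.\<close>

lemma nn_integral_half_tail_square:
  assumes [measurable]: "f \<in> borel_measurable borel" and D: "D > 0" and f: "\<And>t. f t \<ge> 0"
  shows "ennreal D * (\<integral>\<^sup>+y. half_tail f (r + (y - t)\<^sup>2 / D) \<partial>lborel) =
    (\<integral>\<^sup>+y. ennreal ((y - t)\<^sup>2 * f (r + (y - t)\<^sup>2 / D)) \<partial>lborel)"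
proof -
  let ?W = "\<lambda>y v. if \<bar>y - t\<bar> < v then ennreal (v * f (r + v\<^sup>2 / D)) else 0"
  let ?p = "\<lambda>v. ennreal (v\<^sup>2 * f (r + v\<^sup>2 / D))"
  let ?I = "\<integral>\<^sup>+v. indicator {0<..} v * ?p v \<partial>lborel"
  have "ennreal D * (\<integral>\<^sup>+y. half_tail f (r + (y - t)\<^sup>2 / D) \<partial>lborel) =
      (\<integral>\<^sup>+y. (\<integral>\<^sup>+v. ?W y v \<partial>lborel) \<partial>lborel)"
    by (subst nn_integral_cmult[symmetric]) (simp_all add: half_tail_square[OF _ D f])
  also have "\<dots> = (\<integral>\<^sup>+v. (\<integral>\<^sup>+y. ?W y v \<partial>lborel) \<partial>lborel)"
    by (rule lborel_pair.Fubini') measurable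
  also have "\<dots> = (\<integral>\<^sup>+v. (\<integral>\<^sup>+y. ennreal (v * f (r + v\<^sup>2 / D)) * indicator {y. \<bar>y - t\<bar> < v} y \<partial>lborel) \<partial>lborel)"
    by (intro nn_integral_cong) (auto split: split_indicator)
  also have "\<dots> = (\<integral>\<^sup>+v. ennreal (v * f (r + v\<^sup>2 / D)) * (\<integral>\<^sup>+y. indicator {y. \<bar>y - t\<bar> < v} y \<partial>lborel) \<partial>lborel)"
    by (intro nn_integral_cong nn_integral_cmult) measurable
  also have "\<dots> = (\<integral>\<^sup>+v. 2 * (indicator {0<..} v * ?p v) \<partial>lborel)"
  proof (intro nn_integral_cong)
    fix v
    have "{y. \<bar>y - t\<bar> < v} = {t - v<..<t + v}" by auto
    then have "(\<integral>\<^sup>+y. indicator {y. \<bar>y - t\<bar> < v} y \<partial>lborel) = ennreal (2 * v)"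
      by (cases "v \<ge> 0") (simp_all add: ennreal_neg)
    then show "ennreal (v * f (r + v\<^sup>2 / D)) * (\<integral>\<^sup>+y. indicator {y. \<bar>y - t\<bar> < v} y \<partial>lborel) =
        2 * (indicator {0<..} v * ?p v)"
      using f[of "r + v\<^sup>2 / D"]
      by (cases "v > 0") (simp_all add: ennreal_neg ennreal_mult power2_eq_square mult_ac)
  qed
  also have "\<dots> = ?I + ?I"
    by (subst nn_integral_add[symmetric]) (auto simp: mult_2)
  also have "?I + ?I =
      ?I + (\<integral>\<^sup>+v. indicator {..<0} v * ?p v \<partial>lborel)"
    by (subst (2) nn_integral_real_affine[of _ "-1" 0])
       (auto intro!: arg_cong2[of _ _ _ _ "(+)"] nn_integral_cong split: split_indicator)
  also have "\<dots> = (\<integral>\<^sup>+v. indicator {0<..} v * ?p v + indicator {..<0} v * ?p v \<partial>lborel)"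
    by (rule nn_integral_add[symmetric]) measurable
  also have "\<dots> = (\<integral>\<^sup>+v. ?p v \<partial>lborel)"
    by (intro nn_integral_cong) (auto split: split_indicator)
  also have "\<dots> = (\<integral>\<^sup>+y. ennreal ((y - t)\<^sup>2 * f (r + (y - t)\<^sup>2 / D)) \<partial>lborel)"
    by (subst (2) nn_integral_real_affine[of _ 1 t]) auto
  finally show ?thesis .
qed

text \<open>The derivative is only known to be bounded and measurable, so the fundamental theorem is
  applied for the gauge integral, and boundedness transfers the value to the Lebesgue
  integral.\<close>

lemma integral_deriv_interval:
  fixes g g' :: "real \<Rightarrow> real"
  assumes [measurable]: "g' \<in> borel_measurable borel"
    and deriv: "\<And>y. (g has_real_derivative g' y) (at y)" and bd: "\<And>y. \<bar>g' y\<bar> \<le> B" and v: "0 \<le> v"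
  shows "(\<integral>y. g' y * indicator {y. \<bar>y - t\<bar> < v} y \<partial>lborel) = g (t + v) - g (t - v)"
proof -
  have int: "set_integrable lborel {t - v..t + v} g'"
    unfolding set_integrable_def
    by (rule integrableI_bounded_set_indicator[where B=B]) (use bd in \<open>auto simp: emeasure_lborel_Icc_eq\<close>)
  have "(g' has_integral g (t + v) - g (t - v)) {t - v..t + v}"
    by (rule fundamental_theorem_of_calculus)
       (use v deriv in \<open>auto simp flip: has_real_derivative_iff_has_vector_derivative intro: DERIV_subset\<close>)
  then have "(LINT y:{t - v..t + v}|lborel. g' y) = g (t + v) - g (t - v)"
    using set_borel_integral_eq_integral(2)[OF int] by (simp add: integral_unique)
  moreover have "(\<integral>y. g' y * indicator {y. \<bar>y - t\<bar> < v} y \<partial>lborel) = (LINT y:{t - v..t + v}|lborel. g' y)"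
    unfolding set_lebesgue_integral_def
    by (intro integral_cong_AE)
       (auto intro!: eventually_mono[OF eventually_conj[OF AE_lborel_singleton[of "t - v"] AE_lborel_singleton[of "t + v"]]]
         split: split_indicator)
  ultimately show ?thesis by simp
qed

text \<open>Both sides are iterated integrals of \<open>g'(y) v f(r + v^2 / D)\<close> over |y - t|
  < v. Integrating v first produces D F, integrating y first produces g(t + v) - g(t - v). Neither a
  derivative of f nor a boundary term at infinity occurs.\<close>

lemma stein_line:
  fixes f g g' :: "real \<Rightarrow> real"
  assumes [measurable]: "f \<in> borel_measurable borel" "g' \<in> borel_measurable borel"
    and D: "D > 0" and f: "\<And>u. f u \<ge> 0"
    and deriv: "\<And>y. (g has_real_derivative g' y) (at y)" and bd: "\<And>y. \<bar>g' y\<bar> \<le> B"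
    and intF: "(\<integral>\<^sup>+y. half_tail f (r + (y - t)\<^sup>2 / D) \<partial>lborel) < \<infinity>"
    and intG: "integrable lborel (\<lambda>y. (y - t) * g y * f (r + (y - t)\<^sup>2 / D))"
  shows "(\<integral>y. (y - t) * g y * f (r + (y - t)\<^sup>2 / D) \<partial>lborel) =
    D * (\<integral>y. g' y * enn2real (half_tail f (r + (y - t)\<^sup>2 / D)) \<partial>lborel)"
proof -
  have [measurable]: "g \<in> borel_measurable borel"
    by (intro borel_measurable_continuous_onI DERIV_continuous_on) (use deriv in blast)
  let ?F = "\<lambda>y. half_tail f (r + (y - t)\<^sup>2 / D)"
  let ?w = "\<lambda>v. v * f (r + v\<^sup>2 / D)"
  let ?H = "\<lambda>y v. (if \<bar>y - t\<bar> < v then g' y * ?w v else 0)"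
  have B0: "0 \<le> B" using bd[of 0] by linarith
  \<comment> \<open>Absolute integrability of the double integral: the bound B on the derivative
    reduces it to the assumed finite integral of F.\<close>
  have "(\<integral>\<^sup>+(y, v). ennreal (norm (?H y v)) \<partial>(lborel \<Otimes>\<^sub>M lborel)) =
      (\<integral>\<^sup>+y. (\<integral>\<^sup>+v. ennreal (norm (?H y v)) \<partial>lborel) \<partial>lborel)"
    by (subst lborel.nn_integral_fst[symmetric]) auto
  also have "\<dots> = (\<integral>\<^sup>+y. ennreal \<bar>g' y\<bar> * (\<integral>\<^sup>+v. (if \<bar>y - t\<bar> < v then ennreal (?w v) else 0) \<partial>lborel) \<partial>lborel)"
    by (intro nn_integral_cong, subst nn_integral_cmult[symmetric])
       (auto intro!: nn_integral_cong simp: abs_mult f simp flip: ennreal_mult)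
  also have "\<dots> = (\<integral>\<^sup>+y. ennreal \<bar>g' y\<bar> * (ennreal D * ?F y) \<partial>lborel)"
    by (simp add: half_tail_square[OF _ D f])
  also have "\<dots> \<le> (\<integral>\<^sup>+y. ennreal (B * D) * ?F y \<partial>lborel)"
    using B0 D by (intro nn_integral_mono) (simp add: ennreal_mult mult.assoc mult_right_mono ennreal_leI bd)
  also have "\<dots> = ennreal (B * D) * (\<integral>\<^sup>+y. ?F y \<partial>lborel)"
    by (rule nn_integral_cmult) measurable
  also have "\<dots> < \<infinity>" using intF by (simp add: ennreal_mult_less_top)
  finally have intH: "integrable (lborel \<Otimes>\<^sub>M lborel) (\<lambda>(y, v). ?H y v)"
    by (intro integrableI_bounded) (auto simp: case_prod_unfold)
  have "D * (\<integral>y. g' y * enn2real (?F y) \<partial>lborel) =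
      (\<integral>y. g' y * enn2real (ennreal D * ?F y) \<partial>lborel)"
    using D by (simp add: enn2real_mult mult_ac flip: integral_mult_right_zero)
  also have "\<dots> = (\<integral>y. (\<integral>v. ?H y v \<partial>lborel) \<partial>lborel)"
  proof (intro Bochner_Integration.integral_cong refl)
    fix y
    have "(\<integral>v. ?H y v \<partial>lborel) = (\<integral>v. g' y * (if \<bar>y - t\<bar> < v then ?w v else 0) \<partial>lborel)"
      by (intro Bochner_Integration.integral_cong) auto
    also have "\<dots> = g' y * (\<integral>v. (if \<bar>y - t\<bar> < v then ?w v else 0) \<partial>lborel)"
      by (rule integral_mult_right_zero)
    also have "(\<integral>v. (if \<bar>y - t\<bar> < v then ?w v else 0) \<partial>lborel) =
        enn2real (\<integral>\<^sup>+v. ennreal (if \<bar>y - t\<bar> < v then ?w v else 0) \<partial>lborel)"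
      by (rule integral_eq_nn_integral) (auto simp: f)
    also have "(\<integral>\<^sup>+v. ennreal (if \<bar>y - t\<bar> < v then ?w v else 0) \<partial>lborel) =
        ennreal D * ?F y"
      by (subst half_tail_square[OF _ D f]) (auto intro!: nn_integral_cong)
    finally show "g' y * enn2real (ennreal D * ?F y) = (\<integral>v. ?H y v \<partial>lborel)"
      by simp
  qed
  also have "\<dots> = (\<integral>v. (\<integral>y. ?H y v \<partial>lborel) \<partial>lborel)"
    by (rule lborel_pair.Fubini_integral[symmetric]) (use intH in \<open>simp add: case_prod_unfold\<close>)
  also have "\<dots> = (\<integral>v. indicator {0<..} v * ?w v * (g (t + v) - g (t - v)) \<partial>lborel)"
  proof (intro Bochner_Integration.integral_cong refl)
    fix v
    show "(\<integral>y. ?H y v \<partial>lborel) = indicator {0<..} v * ?w v * (g (t + v) - g (t - v))"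
    proof (cases "v > 0")
      case True
      have "(\<integral>y. ?H y v \<partial>lborel) = (\<integral>y. ?w v * (g' y * indicator {y. \<bar>y - t\<bar> < v} y) \<partial>lborel)"
        by (intro Bochner_Integration.integral_cong) (auto split: split_indicator)
      also have "\<dots> = ?w v * (g (t + v) - g (t - v))"
        using True by (simp only: integral_mult_right_zero) (simp add: integral_deriv_interval[OF _ deriv bd])
      finally show ?thesis using True by simp
    next
      case False
      then have "(\<lambda>y. ?H y v) = (\<lambda>y. 0)" by (auto simp: fun_eq_iff)
      then show ?thesis using False by simp
    qed
  qed
  \<comment> \<open>Unfolding at t: the integral over v > 0 of the difference is an integral over
    the whole line, split into its two halves. The assumed integrability permits the
    splitting.\<close>
  also have "\<dots> = (\<integral>y. (y - t) * g y * f (r + (y - t)\<^sup>2 / D) \<partial>lborel)"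
  proof -
    let ?p = "\<lambda>v. ?w v * g (t + v)"
    have p: "integrable lborel ?p"
      using lborel_integrable_real_affine[OF intG, of 1 t] by (simp add: mult_ac)
    have ind: "integrable lborel (\<lambda>v. indicator A v * h v)"
      if "integrable lborel h" "A \<in> sets borel" for A :: "real set" and h :: "real \<Rightarrow> real"
      using integrable_mult_indicator[of A lborel h] that by simp
    have q: "integrable lborel (\<lambda>v. ?p (- v))"
      using lborel_integrable_real_affine[OF p, of "-1" 0] by simp
    have "(\<integral>y. (y - t) * g y * f (r + (y - t)\<^sup>2 / D) \<partial>lborel) = (\<integral>v. ?p v \<partial>lborel)"
      by (subst lborel_integral_real_affine[of 1 _ t]) (auto simp: mult_ac)
    also have "\<dots> = (\<integral>v. indicator {0<..} v * ?p v + indicator {..<0} v * ?p v \<partial>lborel)"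
      by (intro integral_cong_AE)
         (auto intro!: eventually_mono[OF AE_lborel_singleton[of 0]] split: split_indicator)
    also have "\<dots> = (\<integral>v. indicator {0<..} v * ?p v \<partial>lborel) + (\<integral>v. indicator {..<0} v * ?p v \<partial>lborel)"
      by (intro Bochner_Integration.integral_add ind p) auto
    also have "(\<integral>v. indicator {..<0} v * ?p v \<partial>lborel) = (\<integral>v. indicator {0<..} v * ?p (-v) \<partial>lborel)"
      by (subst lborel_integral_real_affine[of "-1" _ 0])
         (auto intro!: Bochner_Integration.integral_cong split: split_indicator)
    also have "(\<integral>v. indicator {0<..} v * ?p v \<partial>lborel) + (\<integral>v. indicator {0<..} v * ?p (-v) \<partial>lborel) =
        (\<integral>v. indicator {0<..} v * ?p v + indicator {0<..} v * ?p (-v) \<partial>lborel)"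
      by (intro Bochner_Integration.integral_add[symmetric] ind p q) auto
    also have "\<dots> = (\<integral>v. indicator {0<..} v * ?w v * (g (t + v) - g (t - v)) \<partial>lborel)"
      by (intro Bochner_Integration.integral_cong) (auto simp: algebra_simps)
    finally show ?thesis by simp
  qed
  finally show ?thesis by simp
qed

section \<open>The identity along one coordinate of a product space\<close>

abbreviation lborel_PiM :: "'a set \<Rightarrow> ('a \<Rightarrow> real) measure" where
  "lborel_PiM I \<equiv> \<Pi>\<^sub>M i\<in>I. lborel"

interpretation lebesgue_product: product_sigma_finite "\<lambda>_. lborel :: real measure" ..

lemma measurable_insert_coord:
  "i \<notin> J \<Longrightarrow> (\<lambda>w. (fst w)(i := snd w)) \<in> lborel_PiM J \<Otimes>\<^sub>M lborel \<rightarrow>\<^sub>M lborel_PiM (insert i J)"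
  by (rule measurable_fun_upd[of _ J]) auto

lemma measurable_nn_integral_coord:
  assumes "i \<notin> J" "k \<in> borel_measurable (lborel_PiM (insert i J))"
  shows "(\<lambda>x. \<integral>\<^sup>+y. k (x(i := y)) \<partial>lborel) \<in> borel_measurable (lborel_PiM J)"
  using measurable_compose[OF measurable_insert_coord[OF assms(1)] assms(2)]
  by (intro lborel.borel_measurable_nn_integral) (auto simp: case_prod_unfold)

text \<open>Tonelli reduces the claim to lines in direction i. Its role is to express the total mass
  of F by a second moment.\<close>

lemma nn_integral_half_tail_coord:
  fixes f :: "real \<Rightarrow> real" and M :: "'b measure" and q :: "('a \<Rightarrow> real) \<times> 'b \<Rightarrow> real"
  assumes I: "finite I" "i \<in> I" and M: "sigma_finite_measure M"
    and [measurable]: "f \<in> borel_measurable borel" "q \<in> borel_measurable (lborel_PiM I \<Otimes>\<^sub>M M)"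
    and D: "D > 0" and f: "\<And>u. f u \<ge> 0"
    and q: "\<And>x z y. q (x(i := y), z) = r x z + (y - t)\<^sup>2 / D"
  shows "ennreal D * (\<integral>\<^sup>+v. half_tail f (q v) \<partial>(lborel_PiM I \<Otimes>\<^sub>M M)) =
    (\<integral>\<^sup>+v. ennreal ((fst v i - t)\<^sup>2 * f (q v)) \<partial>(lborel_PiM I \<Otimes>\<^sub>M M))"
proof -
  let ?P = "lborel_PiM :: 'a set \<Rightarrow> _"
  define J where "J = I - {i}"
  then have J: "I = insert i J" "i \<notin> J" "finite J" using I by auto
  interpret P: sigma_finite_measure "?P I" by (rule lebesgue_product.sigma_finite) fact
  interpret M: sigma_finite_measure M by fact
  interpret pair_sigma_finite "?P I" M ..
  note I(2) [simp, measurable (raw)]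
  have line: "ennreal D * (\<integral>\<^sup>+x. half_tail f (q (x, z)) \<partial>?P I) =
      (\<integral>\<^sup>+x. ennreal ((x i - t)\<^sup>2 * f (q (x, z))) \<partial>?P I)" if [measurable]: "z \<in> space M" for z
  proof -
    have [measurable]: "(\<lambda>x. half_tail f (q (x, z))) \<in> borel_measurable (?P (insert i J))"
      "(\<lambda>x. ennreal ((x i - t)\<^sup>2 * f (q (x, z)))) \<in> borel_measurable (?P (insert i J))"
      unfolding J(1)[symmetric] by measurable
    have "(\<integral>\<^sup>+x. ennreal ((x i - t)\<^sup>2 * f (q (x, z))) \<partial>?P I) =
        (\<integral>\<^sup>+x. (\<integral>\<^sup>+y. ennreal ((y - t)\<^sup>2 * f (r x z + (y - t)\<^sup>2 / D)) \<partial>lborel) \<partial>?P J)"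
      unfolding J(1) by (subst lebesgue_product.product_nn_integral_insert[OF J(3,2)]) (auto simp: q)
    also have "\<dots> = (\<integral>\<^sup>+x. ennreal D * (\<integral>\<^sup>+y. half_tail f (q (x(i := y), z)) \<partial>lborel) \<partial>?P J)"
      by (simp add: nn_integral_half_tail_square[OF _ D f] q)
    also have "\<dots> = ennreal D * (\<integral>\<^sup>+x. (\<integral>\<^sup>+y. half_tail f (q (x(i := y), z)) \<partial>lborel) \<partial>?P J)"
      by (intro nn_integral_cmult measurable_nn_integral_coord J(2)) measurable
    also have "(\<integral>\<^sup>+x. (\<integral>\<^sup>+y. half_tail f (q (x(i := y), z)) \<partial>lborel) \<partial>?P J) = (\<integral>\<^sup>+x. half_tail f (q (x, z)) \<partial>?P I)"
      unfolding J(1) by (rule lebesgue_product.product_nn_integral_insert[OF J(3,2), symmetric]) measurable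
    finally show ?thesis by simp
  qed
  have "ennreal D * (\<integral>\<^sup>+v. half_tail f (q v) \<partial>(?P I \<Otimes>\<^sub>M M)) =
      ennreal D * (\<integral>\<^sup>+z. (\<integral>\<^sup>+x. half_tail f (q (x, z)) \<partial>?P I) \<partial>M)"
    by (subst nn_integral_snd[symmetric]) auto
  also have "\<dots> = (\<integral>\<^sup>+z. ennreal D * (\<integral>\<^sup>+x. half_tail f (q (x, z)) \<partial>?P I) \<partial>M)"
    by (rule nn_integral_cmult[symmetric]) measurable
  also have "\<dots> = (\<integral>\<^sup>+z. (\<integral>\<^sup>+x. ennreal ((x i - t)\<^sup>2 * f (q (x, z))) \<partial>?P I) \<partial>M)"
    by (intro nn_integral_cong line)
  also have "\<dots> = (\<integral>\<^sup>+v. ennreal ((fst v i - t)\<^sup>2 * f (q v)) \<partial>(?P I \<Otimes>\<^sub>M M))"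
    by (subst nn_integral_snd[symmetric]) auto
  finally show ?thesis .
qed

text \<open>The identity on a line asks for finiteness and integrability on that very line. Joint
  integrability provides them for almost every z and then for almost every choice of the remaining
  coordinates, which is enough under the integral. The second factor M is arbitrary, so that the
  same argument serves for x with z as a parameter and, after a swap, for z with x as a
  parameter.\<close>

lemma stein_coord:
  fixes f :: "real \<Rightarrow> real" and M :: "'b measure" and q g g' :: "('a \<Rightarrow> real) \<times> 'b \<Rightarrow> real"
  assumes I: "finite I" "i \<in> I" and M: "sigma_finite_measure M"
    and [measurable]: "f \<in> borel_measurable borel" "q \<in> borel_measurable (lborel_PiM I \<Otimes>\<^sub>M M)"
      "g \<in> borel_measurable (lborel_PiM I \<Otimes>\<^sub>M M)" "g' \<in> borel_measurable (lborel_PiM I \<Otimes>\<^sub>M M)"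
    and D: "D > 0" and f: "\<And>u. f u \<ge> 0"
    and q: "\<And>x z y. q (x(i := y), z) = r x z + (y - t)\<^sup>2 / D"
    and deriv: "\<And>x z y. ((\<lambda>y. g (x(i := y), z)) has_real_derivative g' (x(i := y), z)) (at y)"
    and bd: "\<And>v. \<bar>g' v\<bar> \<le> B"
    and intF: "(\<integral>\<^sup>+v. half_tail f (q v) \<partial>(lborel_PiM I \<Otimes>\<^sub>M M)) < \<infinity>"
    and intG: "integrable (lborel_PiM I \<Otimes>\<^sub>M M) (\<lambda>v. (fst v i - t) * g v * f (q v))"
  shows "integrable (lborel_PiM I \<Otimes>\<^sub>M M) (\<lambda>v. g' v * enn2real (half_tail f (q v)))"
    and "(\<integral>v. (fst v i - t) * g v * f (q v) \<partial>(lborel_PiM I \<Otimes>\<^sub>M M)) =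
      D * (\<integral>v. g' v * enn2real (half_tail f (q v)) \<partial>(lborel_PiM I \<Otimes>\<^sub>M M))"
proof -
  let ?P = "lborel_PiM :: 'a set \<Rightarrow> _"
  define J where "J = I - {i}"
  then have J: "I = insert i J" "i \<notin> J" "finite J" using I by auto
  interpret P: sigma_finite_measure "?P I" by (rule lebesgue_product.sigma_finite) fact
  interpret M: sigma_finite_measure M by fact
  interpret pair_sigma_finite "?P I" M ..
  note I(2) [simp, measurable (raw)]
  let ?G = "\<lambda>v. (fst v i - t) * g v * f (q v)" and ?H = "\<lambda>v. g' v * enn2real (half_tail f (q v))"
  have "(\<integral>\<^sup>+v. ennreal (norm (?H v)) \<partial>(?P I \<Otimes>\<^sub>M M)) \<le> (\<integral>\<^sup>+v. ennreal B * half_tail f (q v) \<partial>(?P I \<Otimes>\<^sub>M M))"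
  proof (rule nn_integral_mono)
    fix v
    have "ennreal (norm (?H v)) = ennreal \<bar>g' v\<bar> * ennreal (enn2real (half_tail f (q v)))"
      by (simp add: abs_mult ennreal_mult)
    also have "\<dots> \<le> ennreal B * half_tail f (q v)"
      by (intro mult_mono ennreal_leI bd) (auto simp: ennreal_enn2real_if)
    finally show "ennreal (norm (?H v)) \<le> ennreal B * half_tail f (q v)" .
  qed
  also have "\<dots> < \<infinity>"
    using intF by (simp add: nn_integral_cmult ennreal_mult_less_top)
  finally show intH: "integrable (?P I \<Otimes>\<^sub>M M) ?H"
    by (intro integrableI_bounded) auto
  have line: "(\<integral>y. ?G (x(i := y), z) \<partial>lborel) = D * (\<integral>y. ?H (x(i := y), z) \<partial>lborel)"
    if x: "x \<in> space (?P J)" and z: "z \<in> space M" and G: "integrable lborel (\<lambda>y. ?G (x(i := y), z))"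
      and F: "(\<integral>\<^sup>+y. half_tail f (q (x(i := y), z)) \<partial>lborel) < \<infinity>" for x z
  proof -
    have "(\<lambda>y. (x(i := y), z)) \<in> lborel \<rightarrow>\<^sub>M ?P I \<Otimes>\<^sub>M M"
      using measurable_component_update[OF x J(2)] z by (auto simp: J(1))
    then have "(\<lambda>y. g' (x(i := y), z)) \<in> borel_measurable borel"
      using measurable_compose[of _ lborel _ g' borel] by simp
    from stein_line[OF _ this D f deriv bd F[unfolded q] G[unfolded q fst_conv fun_upd_same]]
    show ?thesis by (simp add: q)
  qed
  have "AE z in M. (\<integral>x. ?G (x, z) \<partial>?P I) = D * (\<integral>x. ?H (x, z) \<partial>?P I)"
  proof -
    have "AE z in M. integrable (?P I) (\<lambda>x. ?G (x, z))" "AE z in M. integrable (?P I) (\<lambda>x. ?H (x, z))"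
      using AE_integrable_snd[of "\<lambda>x z. ?G (x, z)"] AE_integrable_snd[of "\<lambda>x z. ?H (x, z)"] intG intH
      by (auto simp: case_prod_unfold)
    moreover have "AE z in M. (\<integral>\<^sup>+x. half_tail f (q (x, z)) \<partial>?P I) \<noteq> \<infinity>"
      using intF nn_integral_snd[of "\<lambda>v. half_tail f (q v)"]
      by (intro nn_integral_PInf_AE) auto
    ultimately show ?thesis using AE_space
    proof eventually_elim
      case (elim z)
      note z [measurable] = elim(4)
      have meas: "(\<lambda>x. \<integral>y. k (x(i := y)) \<partial>lborel) \<in> borel_measurable (?P J)"
        if [measurable]: "k \<in> borel_measurable (?P (insert i J))" for k :: "('a \<Rightarrow> real) \<Rightarrow> real"
        using measurable_compose[OF measurable_insert_coord[OF J(2)] that]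
        by (intro lborel.borel_measurable_lebesgue_integral) (auto simp: case_prod_unfold)
      have fin: "AE x in ?P J. (\<integral>\<^sup>+y. k (x(i := y)) \<partial>lborel) < \<infinity>"
        if [measurable]: "k \<in> borel_measurable (?P (insert i J))" and "(\<integral>\<^sup>+x. k x \<partial>?P (insert i J)) < \<infinity>" for k
      proof -
        note [measurable] = measurable_nn_integral_coord[OF J(2) that(1)]
        have "AE x in ?P J. (\<integral>\<^sup>+y. k (x(i := y)) \<partial>lborel) \<noteq> \<infinity>"
          using that(2) lebesgue_product.product_nn_integral_insert[OF J(3,2) that(1)]
          by (intro nn_integral_PInf_AE) auto
        then show ?thesis by (simp add: less_top)
      qed
      have "AE x in ?P J. (\<integral>\<^sup>+y. half_tail f (q (x(i := y), z)) \<partial>lborel) < \<infinity>"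
        by (rule fin) (use elim(3) in \<open>auto simp flip: J(1) simp: less_top\<close>)
      moreover have "AE x in ?P J. (\<integral>\<^sup>+y. ennreal (norm (?G (x(i := y), z))) \<partial>lborel) < \<infinity>"
        by (rule fin) (use elim(1) in \<open>auto simp flip: J(1) simp: integrable_iff_bounded\<close>)
      ultimately have "AE x in ?P J. (\<integral>y. ?G (x(i := y), z) \<partial>lborel) = D * (\<integral>y. ?H (x(i := y), z) \<partial>lborel)"
        using AE_space
      proof eventually_elim
        case (elim x)
        have "(\<lambda>y. (x(i := y), z)) \<in> lborel \<rightarrow>\<^sub>M ?P I \<Otimes>\<^sub>M M"
          using measurable_component_update[OF elim(3) J(2)] z by (auto simp: J(1))
        then have "(\<lambda>y. ?G (x(i := y), z)) \<in> borel_measurable lborel"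
          using measurable_compose[of _ lborel _ ?G borel] by simp
        then have "integrable lborel (\<lambda>y. ?G (x(i := y), z))"
          using elim(2) by (auto simp: integrable_iff_bounded)
        then show ?case by (rule line[OF elim(3) z _ elim(1)])
      qed
      then have "(\<integral>x. (\<integral>y. ?G (x(i := y), z) \<partial>lborel) \<partial>?P J) = (\<integral>x. D * (\<integral>y. ?H (x(i := y), z) \<partial>lborel) \<partial>?P J)"
        by (intro integral_cong_AE borel_measurable_times measurable_const meas) (use elim(1,2) in \<open>auto simp flip: J(1)\<close>)
      then show ?case
        using lebesgue_product.product_integral_insert[OF J(3,2), of "\<lambda>x. ?G (x, z)"]
          lebesgue_product.product_integral_insert[OF J(3,2), of "\<lambda>x. ?H (x, z)"] elim(1,2)
        by (simp add: J(1)[symmetric])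
    qed
  qed
  then have "(\<integral>z. (\<integral>x. ?G (x, z) \<partial>?P I) \<partial>M) = (\<integral>z. D * (\<integral>x. ?H (x, z) \<partial>?P I) \<partial>M)"
    by (intro integral_cong_AE) measurable
  then show "(\<integral>v. ?G v \<partial>(?P I \<Otimes>\<^sub>M M)) = D * (\<integral>v. ?H v \<partial>(?P I \<Otimes>\<^sub>M M))"
    using integral_snd[of "\<lambda>x z. ?G (x, z)"] integral_snd[of "\<lambda>x z. ?H (x, z)"] intG intH
    by (simp add: case_prod_unfold)
qed

lemma stein_coord_snd:
  fixes f :: "real \<Rightarrow> real" and M :: "'b measure" and q g g' :: "'b \<times> ('a \<Rightarrow> real) \<Rightarrow> real"
  assumes I: "finite I" "i \<in> I" and M: "sigma_finite_measure M"
    and [measurable]: "f \<in> borel_measurable borel" "q \<in> borel_measurable (M \<Otimes>\<^sub>M lborel_PiM I)"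
      "g \<in> borel_measurable (M \<Otimes>\<^sub>M lborel_PiM I)" "g' \<in> borel_measurable (M \<Otimes>\<^sub>M lborel_PiM I)"
    and D: "D > 0" and f: "\<And>u. f u \<ge> 0"
    and q: "\<And>x z y. q (x, z(i := y)) = r x z + (y - t)\<^sup>2 / D"
    and deriv: "\<And>x z y. ((\<lambda>y. g (x, z(i := y))) has_real_derivative g' (x, z(i := y))) (at y)"
    and bd: "\<And>v. \<bar>g' v\<bar> \<le> B"
    and intF: "(\<integral>\<^sup>+v. half_tail f (q v) \<partial>(M \<Otimes>\<^sub>M lborel_PiM I)) < \<infinity>"
    and intG: "integrable (M \<Otimes>\<^sub>M lborel_PiM I) (\<lambda>v. (snd v i - t) * g v * f (q v))"
  shows "integrable (M \<Otimes>\<^sub>M lborel_PiM I) (\<lambda>v. g' v * enn2real (half_tail f (q v)))"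
    and "(\<integral>v. (snd v i - t) * g v * f (q v) \<partial>(M \<Otimes>\<^sub>M lborel_PiM I)) =
      D * (\<integral>v. g' v * enn2real (half_tail f (q v)) \<partial>(M \<Otimes>\<^sub>M lborel_PiM I))"
proof -
  let ?P = "lborel_PiM I :: ('a \<Rightarrow> real) measure"
  note I(2) [simp, measurable (raw)]
  interpret P: sigma_finite_measure ?P by (rule lebesgue_product.sigma_finite) fact
  interpret M: sigma_finite_measure M by fact
  interpret pair_sigma_finite M ?P ..
  let ?s = "\<lambda>v. (snd v, fst v)"
  have s: "M \<Otimes>\<^sub>M ?P = distr (?P \<Otimes>\<^sub>M M) (M \<Otimes>\<^sub>M ?P) ?s"
    using distr_pair_swap by (simp add: case_prod_unfold)
  have sm: "?s \<in> ?P \<Otimes>\<^sub>M M \<rightarrow>\<^sub>M M \<Otimes>\<^sub>M ?P" by measurable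
  let ?G = "\<lambda>v. (snd v i - t) * g v * f (q v)" and ?H = "\<lambda>v. g' v * enn2real (half_tail f (q v))"
  have G: "?G \<in> borel_measurable (M \<Otimes>\<^sub>M ?P)" and H: "?H \<in> borel_measurable (M \<Otimes>\<^sub>M ?P)"
    and F: "(\<lambda>v. half_tail f (q v)) \<in> borel_measurable (M \<Otimes>\<^sub>M ?P)" by measurable
  have *: "integrable (?P \<Otimes>\<^sub>M M) (\<lambda>v. ?H (?s v))"
    "(\<integral>v. ?G (?s v) \<partial>(?P \<Otimes>\<^sub>M M)) = D * (\<integral>v. ?H (?s v) \<partial>(?P \<Otimes>\<^sub>M M))"
  proof -
    have 1: "(\<integral>\<^sup>+v. half_tail f (q (?s v)) \<partial>(?P \<Otimes>\<^sub>M M)) < \<infinity>"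
      using intF nn_integral_distr[OF sm, of "\<lambda>v. half_tail f (q v)"] F by (simp flip: s)
    have 2: "integrable (?P \<Otimes>\<^sub>M M) (\<lambda>v. ?G (?s v))"
      using intG integrable_distr_eq[OF sm G] by (simp flip: s)
    have 3: "(\<lambda>v. q (?s v)) \<in> borel_measurable (?P \<Otimes>\<^sub>M M)" "(\<lambda>v. g (?s v)) \<in> borel_measurable (?P \<Otimes>\<^sub>M M)"
      "(\<lambda>v. g' (?s v)) \<in> borel_measurable (?P \<Otimes>\<^sub>M M)" by measurable
    show "integrable (?P \<Otimes>\<^sub>M M) (\<lambda>v. ?H (?s v))"
      "(\<integral>v. ?G (?s v) \<partial>(?P \<Otimes>\<^sub>M M)) = D * (\<integral>v. ?H (?s v) \<partial>(?P \<Otimes>\<^sub>M M))"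
      using stein_coord[OF I M assms(4) 3 D f _ _ bd 1, of "\<lambda>z x. r x z" t] 2 q deriv by simp_all
  qed
  show "integrable (M \<Otimes>\<^sub>M ?P) ?H"
    using *(1) integrable_distr_eq[OF sm H] by (simp flip: s)
  show "(\<integral>v. ?G v \<partial>(M \<Otimes>\<^sub>M ?P)) = D * (\<integral>v. ?H v \<partial>(M \<Otimes>\<^sub>M ?P))"
    using *(2) integral_distr[OF sm G] integral_distr[OF sm H] by (simp flip: s)
qed

section \<open>The elliptical model\<close>

text \<open>\<open>Z'Z\<close>, the numerator of W and the form Q all have this shape, so update
  rules, bounds and measurability are proved once for arbitrary weights.\<close>

definition wsum :: "nat \<Rightarrow> (nat \<Rightarrow> real) \<Rightarrow> (nat \<Rightarrow> real) \<Rightarrow> real" where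
  "wsum m w x = (\<Sum>i=1..m. w i * (x i)\<^sup>2)"

lemma sum_fun_upd:
  assumes "finite A" "k \<in> A"
  shows "(\<Sum>i\<in>A. g i ((x(k := y)) i)) = g k y + (\<Sum>i\<in>A - {k}. g i (x i))"
  using assms by (simp add: sum.remove[of A k])

lemma wsum_upd:
  assumes "k \<in> {1..m}"
  shows "wsum m w (x(k := y)) = wsum m w (x(k := 0)) + w k * y\<^sup>2"
  unfolding wsum_def sum_fun_upd[OF finite_atLeastAtMost assms, of "\<lambda>i t. w i * t\<^sup>2"] by simp

lemma wsum_nonneg: "(\<And>i. i \<in> {1..m} \<Longrightarrow> w i \<ge> 0) \<Longrightarrow> wsum m w x \<ge> 0"
  unfolding wsum_def by (intro sum_nonneg) auto

lemma wsum_mono: "(\<And>i. i \<in> {1..m} \<Longrightarrow> v i \<le> w i) \<Longrightarrow> wsum m v x \<le> wsum m w x"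
  unfolding wsum_def by (intro sum_mono mult_right_mono) auto

lemma wsum_member_le:
  assumes "\<And>i. i \<in> {1..m} \<Longrightarrow> w i \<ge> 0" "k \<in> {1..m}"
  shows "w k * (x k)\<^sup>2 \<le> wsum m w x"
  unfolding wsum_def by (rule member_le_sum) (use assms in auto)

lemma wsum_le:
  assumes "\<And>i. i \<in> {1..m} \<Longrightarrow> w i \<ge> 0"
  shows "wsum m w x \<le> (\<Sum>i=1..m. w i) * (\<Sum>i=1..m. (x i)\<^sup>2)"
proof -
  have "wsum m w x \<le> (\<Sum>i=1..m. w i * (\<Sum>k=1..m. (x k)\<^sup>2))"
    unfolding wsum_def
    by (intro sum_mono mult_left_mono member_le_sum[of _ _ "\<lambda>k. (x k)\<^sup>2"]) (use assms in auto)
  then show ?thesis by (simp add: sum_distrib_right)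
qed

lemma measurable_wsum [measurable]:
  "wsum m w \<in> borel_measurable (lborel_PiM {1..m})"
  unfolding wsum_def
  by (intro borel_measurable_sum borel_measurable_times borel_measurable_const borel_measurable_power)
     (use measurable_component_singleton[of _ "{1..m}" "\<lambda>_. lborel :: real measure"] in simp)

definition sq_radius ::
  "nat \<Rightarrow> nat \<Rightarrow> (nat \<Rightarrow> real) \<Rightarrow> (nat \<Rightarrow> real) \<Rightarrow> real \<Rightarrow> (nat \<Rightarrow> real) \<times> (nat \<Rightarrow> real) \<Rightarrow> real" where
  "sq_radius p n d \<theta> \<sigma> v = ((\<Sum>i=1..p. (fst v i - \<theta> i)\<^sup>2 / d i) + (\<Sum>i=1..n. (snd v i)\<^sup>2)) / \<sigma>\<^sup>2"

locale elliptical_model =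
  fixes p n :: nat and d :: "nat \<Rightarrow> real" and f :: "real \<Rightarrow> real"
  assumes p: "p \<ge> 1" and n: "n \<ge> 1"
    and d_pos: "\<And>i. i \<in> {1..p} \<Longrightarrow> d i > 0"
    and f: "admissible_f p n d f"
begin

abbreviation "X_space \<equiv> lborel_PiM {1..p}"
abbreviation "Z_space \<equiv> lborel_PiM {1..n}"

sublocale X: sigma_finite_measure X_space by (rule lebesgue_product.sigma_finite) simp
sublocale Z: sigma_finite_measure Z_space by (rule lebesgue_product.sigma_finite) simp
sublocale XZ: pair_sigma_finite X_space Z_space ..

lemma measurable_fst_coord [measurable]:
  "i \<in> {1..p} \<Longrightarrow> (\<lambda>v. fst v i) \<in> borel_measurable (obs_space p n)"
  unfolding obs_space_def
  using measurable_compose[OF measurable_fst measurable_component_singleton[of i "{1..p}" "\<lambda>_. lborel :: real measure"]]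
  by simp

lemma measurable_snd_coord [measurable]:
  "i \<in> {1..n} \<Longrightarrow> (\<lambda>v. snd v i) \<in> borel_measurable (obs_space p n)"
  unfolding obs_space_def
  using measurable_compose[OF measurable_snd measurable_component_singleton[of i "{1..n}" "\<lambda>_. lborel :: real measure"]]
  by simp

lemma measurable_wsum_fst [measurable]: "(\<lambda>v. wsum p w (fst v)) \<in> borel_measurable (obs_space p n)"
  unfolding obs_space_def by measurable

lemma measurable_wsum_snd [measurable]: "(\<lambda>v. wsum n w (snd v)) \<in> borel_measurable (obs_space p n)"
  unfolding obs_space_def by measurable

lemma measurable_sq_radius [measurable]: "sq_radius p n d \<theta> \<sigma> \<in> borel_measurable (obs_space p n)"
  unfolding sq_radius_def
  by (intro borel_measurable_divide borel_measurable_add borel_measurable_sum borel_measurable_power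
      borel_measurable_diff borel_measurable_const) (auto intro: measurable_fst_coord measurable_snd_coord)

lemma sq_radius_nonneg: "sq_radius p n d \<theta> \<sigma> v \<ge> 0"
  unfolding sq_radius_def using d_pos
  by (intro divide_nonneg_nonneg add_nonneg_nonneg sum_nonneg) (auto intro: less_imp_le)

text \<open>The model constrains f only on [0, \<infinity>). Cutting it off gives a function that is
  nonnegative and, as shown below, Borel on the whole line, as the tail identities require.\<close>

definition f0 :: "real \<Rightarrow> real" where "f0 t = (if t \<ge> 0 then f t else 0)"

lemma f0_nonneg: "f0 t \<ge> 0"
  using f by (simp add: f0_def admissible_f_def)

definition norm_const :: "real \<Rightarrow> real" where
  "norm_const \<sigma> = (\<Prod>i=1..p. 1 / sqrt (d i)) * (1 / \<sigma> ^ (p + n))"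

lemma norm_const_pos: "\<sigma> > 0 \<Longrightarrow> norm_const \<sigma> > 0"
  unfolding norm_const_def using d_pos by (intro mult_pos_pos prod_pos) auto

lemma obs_density_eq: "obs_density p n d f \<theta> \<sigma> v = norm_const \<sigma> * f0 (sq_radius p n d \<theta> \<sigma> v)"
  using sq_radius_nonneg[of \<theta> \<sigma> v]
  by (simp add: obs_density_def norm_const_def f0_def sq_radius_def case_prod_unfold)

text \<open>\<open>admissible_f\<close> provides measurability of the density on the observation
  space only. Along the measurable curve with first x-coordinate \<open>sqrt (d 1 * t)\<close> and
  all other coordinates 0, the squared radius is t, so composing the density with this curve
  recovers f itself.\<close>

lemma measurable_f0 [measurable]: "f0 \<in> borel_measurable borel"
proof -
  define x where "x = (\<lambda>t. \<lambda>i\<in>{1..p}. if i = 1 then sqrt (d 1 * t) else 0)"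
  define z :: "nat \<Rightarrow> real" where "z = (\<lambda>i\<in>{1..n}. 0)"
  have "(\<lambda>t. (x t, z)) \<in> borel \<rightarrow>\<^sub>M obs_space p n"
    unfolding obs_space_def x_def z_def by (intro measurable_Pair measurable_restrict) auto
  moreover have "obs_density p n d f (\<lambda>_. 0) 1 \<in> borel_measurable (obs_space p n)"
    using f by (simp add: admissible_f_def)
  ultimately have [measurable]: "(\<lambda>t. obs_density p n d f (\<lambda>_. 0) 1 (x t, z)) \<in> borel_measurable borel"
    by (rule measurable_compose)
  have "f0 t = (if t \<ge> 0 then obs_density p n d f (\<lambda>_. 0) 1 (x t, z) / norm_const 1 else 0)" for t
  proof (cases "t \<ge> 0")
    case True
    have "(\<Sum>i=1..p. (x t i - 0)\<^sup>2 / d i) = (\<Sum>i=1..p. if i = 1 then t else 0)"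
      using d_pos[of 1] p True by (intro sum.cong) (auto simp: x_def mult_nonneg_nonneg less_imp_le)
    also have "\<dots> = t" using p by (subst sum.delta) auto
    finally have "sq_radius p n d (\<lambda>_. 0) 1 (x t, z) = t"
      by (simp add: sq_radius_def z_def)
    then show ?thesis
      using norm_const_pos[of 1] True by (simp add: obs_density_eq)
  qed (simp add: f0_def)
  then have "f0 = (\<lambda>t. if t \<ge> 0 then obs_density p n d f (\<lambda>_. 0) 1 (x t, z) / norm_const 1 else 0)" by blast
  then show ?thesis by simp
qed

context
  fixes \<theta> :: "nat \<Rightarrow> real" and \<sigma> :: real
  assumes \<sigma>: "\<sigma> > 0"
begin

lemma integrable_obs_dist_iff:
  assumes "g \<in> borel_measurable (obs_space p n)"
  shows "integrable (obs_dist p n d f \<theta> \<sigma>) g \<longleftrightarrow> integrable (obs_space p n) (\<lambda>v. g v * f0 (sq_radius p n d \<theta> \<sigma> v))"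
proof -
  have "integrable (obs_dist p n d f \<theta> \<sigma>) g \<longleftrightarrow> integrable (obs_space p n) (\<lambda>v. norm_const \<sigma> * (g v * f0 (sq_radius p n d \<theta> \<sigma> v)))"
    unfolding obs_dist_def obs_density_eq using norm_const_pos[OF \<sigma>] assms
    by (subst integrable_density) (auto simp: f0_nonneg mult_ac)
  then show ?thesis using norm_const_pos[OF \<sigma>] by simp
qed

lemma integrable_const: "integrable (obs_space p n) (\<lambda>v. f0 (sq_radius p n d \<theta> \<sigma> v))"
proof -
  interpret prob_space "obs_dist p n d f \<theta> \<sigma>"
    using f \<sigma> by (simp add: admissible_f_def)
  show ?thesis using integrable_obs_dist_iff[of "\<lambda>_. 1"] by simp
qed

lemma integrable_square:
  assumes "i \<in> {1..p}"
  shows "integrable (obs_space p n) (\<lambda>v. (fst v i)\<^sup>2 * f0 (sq_radius p n d \<theta> \<sigma> v))"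
proof -
  have "integrable (obs_dist p n d f \<theta> \<sigma>) (\<lambda>(x, z). (x i)\<^sup>2)"
    using f \<sigma> assms by (simp add: admissible_f_def)
  then show ?thesis
    using assms by (subst (asm) integrable_obs_dist_iff) (auto simp: case_prod_unfold)
qed

text \<open>Shrinkage multiplies the coordinates by bounded factors, so the integrands below grow at
  most quadratically in x and are dominated by the second moments of X.\<close>

lemma integrable_quadratic_bound:
  assumes [measurable]: "g \<in> borel_measurable (obs_space p n)" and g: "\<And>v. \<bar>g v\<bar> \<le> a + b * (\<Sum>i=1..p. (fst v i)\<^sup>2)"
  shows "integrable (obs_space p n) (\<lambda>v. g v * f0 (sq_radius p n d \<theta> \<sigma> v))"
proof (rule Bochner_Integration.integrable_bound)
  show "integrable (obs_space p n) (\<lambda>v. a * f0 (sq_radius p n d \<theta> \<sigma> v) + b * (\<Sum>i=1..p. (fst v i)\<^sup>2 * f0 (sq_radius p n d \<theta> \<sigma> v)))"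
    by (intro Bochner_Integration.integrable_add integrable_mult_right integrable_const
        Bochner_Integration.integrable_sum integrable_square)
  show "AE v in obs_space p n. norm (g v * f0 (sq_radius p n d \<theta> \<sigma> v)) \<le> norm (a * f0 (sq_radius p n d \<theta> \<sigma> v) + b * (\<Sum>i=1..p. (fst v i)\<^sup>2 * f0 (sq_radius p n d \<theta> \<sigma> v)))"
  proof (intro AE_I2)
    fix v
    have "norm (g v * f0 (sq_radius p n d \<theta> \<sigma> v)) = \<bar>g v\<bar> * f0 (sq_radius p n d \<theta> \<sigma> v)" by (simp add: abs_mult f0_nonneg)
    also have "\<dots> \<le> (a + b * (\<Sum>i=1..p. (fst v i)\<^sup>2)) * f0 (sq_radius p n d \<theta> \<sigma> v)"
      by (intro mult_right_mono g f0_nonneg)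
    also have "\<dots> = a * f0 (sq_radius p n d \<theta> \<sigma> v) + b * (\<Sum>i=1..p. (fst v i)\<^sup>2 * f0 (sq_radius p n d \<theta> \<sigma> v))"
      by (simp add: distrib_right sum_distrib_right mult.assoc)
    finally show "norm (g v * f0 (sq_radius p n d \<theta> \<sigma> v)) \<le> norm (a * f0 (sq_radius p n d \<theta> \<sigma> v) + b * (\<Sum>i=1..p. (fst v i)\<^sup>2 * f0 (sq_radius p n d \<theta> \<sigma> v)))"
      by simp
  qed
qed measurable

lemma integrable_centered_square:
  assumes i: "i \<in> {1..p}"
  shows "integrable (obs_space p n) (\<lambda>v. (fst v i - \<theta> i)\<^sup>2 * f0 (sq_radius p n d \<theta> \<sigma> v))"
proof (rule integrable_quadratic_bound)
  fix v :: "(nat \<Rightarrow> real) \<times> (nat \<Rightarrow> real)"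
  have "(fst v i - \<theta> i)\<^sup>2 + (fst v i + \<theta> i)\<^sup>2 = 2 * (\<theta> i)\<^sup>2 + 2 * (fst v i)\<^sup>2"
    by (simp add: power2_eq_square algebra_simps)
  moreover have "(fst v i)\<^sup>2 \<le> (\<Sum>i=1..p. (fst v i)\<^sup>2)" using i by (intro member_le_sum) auto
  ultimately show "\<bar>(fst v i - \<theta> i)\<^sup>2\<bar> \<le> 2 * (\<theta> i)\<^sup>2 + 2 * (\<Sum>i=1..p. (fst v i)\<^sup>2)"
    using zero_le_power2[of "fst v i + \<theta> i"] unfolding abs_power2 by linarith
qed (use i in measurable)

lemma sq_radius_upd_fst:
  assumes "i \<in> {1..p}"
  shows "sq_radius p n d \<theta> \<sigma> (x(i := y), z) = sq_radius p n d \<theta> \<sigma> (x(i := \<theta> i), z) + (y - \<theta> i)\<^sup>2 / (d i * \<sigma>\<^sup>2)"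
  unfolding sq_radius_def fst_conv snd_conv
    sum_fun_upd[OF finite_atLeastAtMost assms, of "\<lambda>i t. (t - \<theta> i)\<^sup>2 / d i"]
  by (simp add: add_divide_distrib)

lemma sq_radius_upd_snd:
  assumes "i \<in> {1..n}"
  shows "sq_radius p n d \<theta> \<sigma> (x, z(i := y)) = sq_radius p n d \<theta> \<sigma> (x, z(i := 0)) + (y - 0)\<^sup>2 / \<sigma>\<^sup>2"
  unfolding sq_radius_def fst_conv snd_conv
    sum_fun_upd[OF finite_atLeastAtMost assms, of "\<lambda>i t. t\<^sup>2"]
  by (simp add: add_divide_distrib)

lemma measurable_sq_radius_pair: "sq_radius p n d \<theta> \<sigma> \<in> borel_measurable (X_space \<Otimes>\<^sub>M Z_space)"
  using measurable_sq_radius[unfolded obs_space_def] .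

text \<open>Any coordinate of X serves: the mass of F times \<open>d i * \<sigma>^2\<close> is the
  unnormalized second moment of \<open>x i - \<theta> i\<close>.\<close>

lemma half_tail_finite: "(\<integral>\<^sup>+v. half_tail f0 (sq_radius p n d \<theta> \<sigma> v) \<partial>obs_space p n) < \<infinity>"
proof -
  have 1: "1 \<in> {1..p}" using p by simp
  have D: "d 1 * \<sigma>\<^sup>2 > 0" using d_pos[OF 1] \<sigma> by simp
  have "ennreal (d 1 * \<sigma>\<^sup>2) * (\<integral>\<^sup>+v. half_tail f0 (sq_radius p n d \<theta> \<sigma> v) \<partial>obs_space p n) =
      (\<integral>\<^sup>+v. ennreal ((fst v 1 - \<theta> 1)\<^sup>2 * f0 (sq_radius p n d \<theta> \<sigma> v)) \<partial>obs_space p n)"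
    unfolding obs_space_def
    by (rule nn_integral_half_tail_coord[OF _ 1 Z.sigma_finite_measure_axioms measurable_f0 measurable_sq_radius_pair D f0_nonneg
          sq_radius_upd_fst[OF 1]]) simp
  also have "\<dots> < \<infinity>"
    using integrable_centered_square[OF 1] by (auto simp: integrable_iff_bounded f0_nonneg)
  finally show ?thesis using D by (auto simp: ennreal_mult_less_top)
qed

end

end

section \<open>Risk domination\<close>

text \<open>Since division by 0 gives 0, the formula remains valid at \<open>s = 0\<close>, where
  the function is linear in y. This matters because the coordinate identity asks for a derivative on
  every line, including those over the null set z = 0.\<close>

lemma has_real_derivative_shrink:
  fixes K \<alpha> a w s y :: real
  assumes "K > 0" "a \<ge> 0" "w \<ge> 0" "s \<ge> 0"
  shows "((\<lambda>y. y * (\<alpha> / (K + (a + w * y\<^sup>2) / s))) has_real_derivative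
    \<alpha> / (K + (a + w * y\<^sup>2) / s) - 2 * \<alpha> * (w * y\<^sup>2 / s) / (K + (a + w * y\<^sup>2) / s)\<^sup>2) (at y)"
proof -
  let ?Y = "K + (a + w * y\<^sup>2) / s"
  have "(a + w * y\<^sup>2) / s \<ge> 0" using assms by simp
  then have Y: "?Y \<noteq> 0" using assms by linarith
  have "((\<lambda>y. K + (a + w * y\<^sup>2) / s) has_real_derivative 2 * w * y / s) (at y)"
    unfolding divide_inverse by (auto intro!: derivative_eq_intros)
  from DERIV_mult[OF DERIV_ident DERIV_divide[OF DERIV_const this Y]]
  show ?thesis
    by (rule DERIV_cong) (use Y in \<open>simp add: power2_eq_square\<close>)
qed

text \<open>With \<open>b + y^2 = S\<close> and m = N the function is
  \<open>z_k Q h(W)^2 / S\<close> up to the factor \<open>Q \<alpha>^2\<close>, written without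
  dividing by S. The assumption m > 0 keeps the denominator nonzero at S = 0.\<close>

lemma has_real_derivative_residual:
  fixes K b m y :: real
  assumes "K > 0" "b \<ge> 0" "m > 0"
  shows "((\<lambda>y. y * ((b + y\<^sup>2) / (K * (b + y\<^sup>2) + m)\<^sup>2)) has_real_derivative
    (b + y\<^sup>2) / (K * (b + y\<^sup>2) + m)\<^sup>2 +
      2 * y\<^sup>2 * (m - K * (b + y\<^sup>2)) / (K * (b + y\<^sup>2) + m) ^ 3) (at y)"
proof -
  let ?Y = "K * (b + y\<^sup>2) + m"
  have "K * (b + y\<^sup>2) \<ge> 0" using assms by simp
  then have Y: "?Y \<noteq> 0" using assms by linarith
  have 1: "((\<lambda>y. (K * (b + y\<^sup>2) + m)\<^sup>2) has_real_derivative 2 * ?Y * (2 * K * y)) (at y)"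
    by (auto intro!: derivative_eq_intros)
  have 2: "((\<lambda>y. b + y\<^sup>2) has_real_derivative 2 * y) (at y)"
    by (auto intro!: derivative_eq_intros)
  have eq: "(2 * y * ?Y\<^sup>2 - (b + y\<^sup>2) * (2 * ?Y * (2 * K * y))) / (?Y\<^sup>2 * ?Y\<^sup>2) =
      2 * y * (m - K * (b + y\<^sup>2)) / ?Y ^ 3"
  proof -
    have "2 * y * Y\<^sup>2 - s * (2 * Y * (2 * K * y)) = Y * (2 * y * (m - K * s))" if "Y = K * s + m" for Y s
      unfolding that by (simp add: algebra_simps power2_eq_square)
    then have "2 * y * ?Y\<^sup>2 - (b + y\<^sup>2) * (2 * ?Y * (2 * K * y)) = ?Y * (2 * y * (m - K * (b + y\<^sup>2)))"
      by blast
    then show ?thesis using Y by (simp add: power2_eq_square power3_eq_cube mult_ac)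
  qed
  have "?Y\<^sup>2 \<noteq> 0" using Y by simp
  from DERIV_mult[OF DERIV_ident DERIV_divide[OF 2 1 this]]
  show ?thesis
    unfolding eq by (rule DERIV_cong) (simp add: power2_eq_square algebra_simps)
qed

text \<open>After the factor \<open>\<alpha> S / Y\<close> with \<open>Y = K S + N\<close> is taken
  out, \<open>- 2 s + 4 B + \<alpha> B (n + 2 D)\<close> remains, where B = Q / Y lies in [0, A] and
  D = (N - K S) / Y is at most 1. Replacing D by 1 and B by A leads to the assumption
  \<open>le\<close>. Here s stands for the sum of the weights a_i, whereas Z'Z is S.\<close>

lemma risk_integrand_nonpos:
  fixes K \<alpha> N S Q A s n :: real
  assumes K: "K > 0" and \<alpha>: "\<alpha> > 0" and S: "S > 0" and N: "N \<ge> 0" and Q: "0 \<le> Q" "Q \<le> A * N"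
    and A: "A \<ge> 0" and n: "n \<ge> 0" and le: "A * (4 + \<alpha> * (n + 2)) \<le> 2 * s"
  shows "- 2 * (s * (\<alpha> / (K + N / S)) - 2 * \<alpha> * (Q / S) / (K + N / S)\<^sup>2) +
    Q * \<alpha>\<^sup>2 * (n * S / (K * S + N)\<^sup>2 + 2 * S * (N - K * S) / (K * S + N) ^ 3) \<le> 0"
proof -
  define Y where "Y = K * S + N"
  have Y: "Y > 0" "N \<le> Y" using K S N by (auto simp: Y_def add_pos_nonneg)
  have KY: "K + N / S = Y / S" using S by (simp add: Y_def field_simps)
  define B where "B = Q / Y"
  have B: "0 \<le> B" "B \<le> A"
    using Q Y A mult_left_mono[of N Y A] by (auto simp: B_def divide_le_eq)
  define D where "D = (N - K * S) / Y"
  have D: "D \<le> 1" using K S Y by (simp add: D_def Y_def)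
  have "- 2 * (s * (\<alpha> / (K + N / S)) - 2 * \<alpha> * (Q / S) / (K + N / S)\<^sup>2) +
      Q * \<alpha>\<^sup>2 * (n * S / Y\<^sup>2 + 2 * S * (N - K * S) / Y ^ 3) =
      (\<alpha> * S / Y) * (- 2 * s + 4 * B + \<alpha> * B * (n + 2 * D))"
    unfolding KY B_def D_def using S Y by (simp add: power2_eq_square power3_eq_cube field_simps)
  also have "\<dots> \<le> 0"
  proof (rule mult_nonneg_nonpos)
    have "\<alpha> * B * (n + 2 * D) \<le> \<alpha> * B * (n + 2)" using \<alpha> B D by (intro mult_left_mono) auto
    then have "- 2 * s + 4 * B + \<alpha> * B * (n + 2 * D) \<le> - 2 * s + B * (4 + \<alpha> * (n + 2))"
      by (simp add: algebra_simps)
    also have "\<dots> \<le> - 2 * s + A * (4 + \<alpha> * (n + 2))"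
      using B \<alpha> n by (intro add_left_mono mult_right_mono) auto
    finally show "- 2 * s + 4 * B + \<alpha> * B * (n + 2 * D) \<le> 0" using le by linarith
  qed (use \<alpha> S Y in simp)
  finally show ?thesis by (simp add: Y_def)
qed

text \<open>The Fubini argument needs a bound uniform over the whole space. It exists because t / s
  never exceeds the denominator \<open>K + N / s\<close>, so both terms are multiples of ratios at
  most \<alpha> / K.\<close>

lemma shrink_deriv_bound:
  fixes K \<alpha> N s t :: real
  assumes "K > 0" "\<alpha> \<ge> 0" "0 \<le> t" "t \<le> N" "s \<ge> 0"
  shows "\<bar>\<alpha> / (K + N / s) - 2 * \<alpha> * (t / s) / (K + N / s)\<^sup>2\<bar> \<le> 3 * \<alpha> / K"
proof -
  let ?R = "K + N / s"
  have ts: "0 \<le> t / s" "t / s \<le> N / s" using assms by (auto intro: divide_right_mono)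
  then have R: "?R \<ge> K" "?R > 0" "t / s \<le> ?R" using assms by linarith+
  have 1: "0 \<le> \<alpha> / ?R" "\<alpha> / ?R \<le> \<alpha> / K" using R assms by (auto intro: divide_left_mono)
  have 2: "0 \<le> (t / s) / ?R" "(t / s) / ?R \<le> 1" using R ts by (auto simp only: divide_le_eq_1_pos divide_nonneg_pos)
  have eq: "2 * \<alpha> * (t / s) / ?R\<^sup>2 = 2 * ((\<alpha> / ?R) * ((t / s) / ?R))"
    by (simp add: power2_eq_square mult_ac)
  have 3: "0 \<le> (\<alpha> / ?R) * ((t / s) / ?R)" using 1(1) 2(1) by (rule mult_nonneg_nonneg)
  have 4: "(\<alpha> / ?R) * ((t / s) / ?R) \<le> (\<alpha> / K) * 1" using 1 2 assms by (intro mult_mono) auto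
  have "\<bar>a - 2 * b\<bar> \<le> 3 * m" if "0 \<le> a" "a \<le> m" "0 \<le> b" "b \<le> m * 1" for a b m :: real
    using that by (auto simp: abs_le_iff)
  from this[OF 1 3 4] show ?thesis unfolding eq by simp
qed

text \<open>Everything is measured against \<open>Y = K S + N\<close>: Q / Y is at most A, S / Y and
  t / Y are at most 1 / K, and |N - K S| / Y is at most 1, which gives 1 / K + 2 / K. Where Y = 0,
  division by 0 makes the expression 0.\<close>

lemma residual_deriv_bound:
  fixes K \<alpha> N S t Q A :: real
  assumes "K > 0" "A \<ge> 0" "0 \<le> Q" "Q \<le> A * N" "0 \<le> t" "t \<le> S" "0 \<le> N"
  shows "\<bar>Q * \<alpha>\<^sup>2 * (S / (K * S + N)\<^sup>2 + 2 * t * (N - K * S) / (K * S + N) ^ 3)\<bar> \<le> 3 * \<alpha>\<^sup>2 * A / K"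
proof -
  let ?Y = "K * S + N"
  have KS: "K * S \<ge> 0" using assms by simp
  show ?thesis
  proof (cases "?Y = 0")
    case True
    then show ?thesis using assms by simp
  next
    case False
    then have Y: "?Y > 0" "N \<le> ?Y" "K * S \<le> ?Y" using KS assms by linarith+
    have "Q \<le> A * ?Y" using assms Y mult_left_mono[of N ?Y A] by linarith
    then have q: "0 \<le> Q / ?Y" "Q / ?Y \<le> A" using Y assms by (auto simp: pos_divide_le_eq)
    have s: "0 \<le> S / ?Y" "S / ?Y \<le> 1 / K" using Y assms by (auto simp: pos_divide_le_eq pos_le_divide_eq mult.commute)
    have t: "0 \<le> t / ?Y" "t / ?Y \<le> S / ?Y" using Y assms by (auto intro: divide_right_mono)
    have "\<bar>N - K * S\<bar> \<le> ?Y" using KS assms by linarith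
    then have D: "\<bar>(N - K * S) / ?Y\<bar> \<le> 1" using Y by (simp add: abs_divide)
    have "\<bar>S / ?Y + 2 * ((t / ?Y) * ((N - K * S) / ?Y))\<bar> \<le> \<bar>S / ?Y\<bar> + 2 * (\<bar>t / ?Y\<bar> * \<bar>(N - K * S) / ?Y\<bar>)"
      by (rule order_trans[OF abs_triangle_ineq]) (simp add: abs_mult)
    also have "\<dots> \<le> 1 / K + 2 * (1 / K * 1)"
      using s t D assms by (intro add_mono mult_left_mono mult_mono) auto
    finally have "\<bar>S / ?Y + 2 * ((t / ?Y) * ((N - K * S) / ?Y))\<bar> \<le> 3 / K" by simp
    then have le: "\<alpha>\<^sup>2 * ((Q / ?Y) * \<bar>S / ?Y + 2 * ((t / ?Y) * ((N - K * S) / ?Y))\<bar>) \<le> \<alpha>\<^sup>2 * (A * (3 / K))"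
      using q assms by (intro mult_left_mono mult_mono) auto
    have "Q * \<alpha>\<^sup>2 * (S / y\<^sup>2 + 2 * t * e / y ^ 3) = \<alpha>\<^sup>2 * ((Q / y) * (S / y + 2 * ((t / y) * (e / y))))"
      if "y > 0" for y e
      using that by (simp add: power2_eq_square power3_eq_cube field_simps)
    note eq = this[OF Y(1), of "N - K * S"]
    have abs: "\<bar>\<alpha>\<^sup>2 * (x * e)\<bar> = \<alpha>\<^sup>2 * (x * \<bar>e\<bar>)" if "0 \<le> x" for x e
      using that by (simp add: abs_mult)
    have "\<alpha>\<^sup>2 * (A * (3 / K)) = 3 * \<alpha>\<^sup>2 * A / K" by simp
    with le show ?thesis unfolding eq abs[OF q(1)] by (rule order_trans[OF _ eq_refl])
  qed
qed

section \<open>Comparison of the risk of the shrinkage estimator with that of X\<close>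

context elliptical_model
begin

lemma AE_residual_pos: "AE v in obs_space p n. wsum n (\<lambda>_. 1) (snd v) > 0"
proof -
  let ?B = "Pi\<^sub>E {1..n} (\<lambda>i. if i = 1 then {0 :: real} else UNIV)"
  have "emeasure Z_space ?B = (\<Prod>i\<in>{1..n}. emeasure lborel (if i = 1 then {0 :: real} else UNIV))"
    by (rule lebesgue_product.emeasure_PiM) auto
  also have "\<dots> = 0"
    by (rule prod_zero) (use n in auto)
  finally have 0: "emeasure Z_space ?B = 0" .
  have B: "?B \<in> sets Z_space" by (rule sets_PiM_I_finite) auto
  have "AE v in obs_space p n. snd v 1 \<noteq> 0"
  proof (rule AE_I)
    show "{v \<in> space (obs_space p n). \<not> snd v 1 \<noteq> 0} \<subseteq> space X_space \<times> ?B"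
      by (auto simp: obs_space_def space_pair_measure space_PiM PiE_iff)
    show "space X_space \<times> ?B \<in> sets (obs_space p n)"
      unfolding obs_space_def using B by auto
    show "emeasure (obs_space p n) (space X_space \<times> ?B) = 0"
      unfolding obs_space_def by (subst Z.emeasure_pair_measure_Times[OF sets.top B]) (simp only: 0 mult_zero_right)
  qed
  then show ?thesis
  proof eventually_elim
    case (elim v)
    have "(snd v 1)\<^sup>2 \<le> wsum n (\<lambda>_. 1) (snd v)"
      using wsum_member_le[of n "\<lambda>_. 1" 1 "snd v"] n by simp
    then show ?case using elim by (smt (verit) zero_less_power2)
  qed
qed

end

text \<open>\<open>K\<close> is chosen so that h(w) = \<alpha> / (K + w). \<open>A\<close> bounds
  the weights a_i = d_i^(1-j) / c_i, and \<open>A_le\<close> is the bound \<alpha> \<le> 2 / (n + 2)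
  (sum of a_i / A - 2) multiplied out, so that no quotient by A occurs.\<close>

locale shrinkage_setting = elliptical_model +
  fixes \<theta> :: "nat \<Rightarrow> real" and \<sigma> :: real and c :: "nat \<Rightarrow> real" and j \<alpha> \<gamma> K A :: real
  assumes \<sigma>: "\<sigma> > 0" and c_pos: "\<And>i. i \<in> {1..p} \<Longrightarrow> c i > 0"
    and \<alpha>: "\<alpha> > 0" and \<gamma>: "\<gamma> > 0" and K_def: "K = \<gamma> * (\<alpha> + 1)"
    and A: "\<And>i. i \<in> {1..p} \<Longrightarrow> d i powr (1 - j) / c i \<le> A"
    and A_le: "A * (4 + \<alpha> * (real n + 2)) \<le> 2 * (\<Sum>i=1..p. d i powr (1 - j) / c i)"
begin

abbreviation (input) "q \<equiv> sq_radius p n d \<theta> \<sigma>"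
abbreviation (input) "w1 \<equiv> \<lambda>i. 1 / (c i * d i)"
abbreviation (input) "wQ \<equiv> \<lambda>i. d i powr (- j) / (c i)\<^sup>2"
abbreviation (input) "N v \<equiv> wsum p w1 (fst v)"
abbreviation (input) "Q v \<equiv> wsum p wQ (fst v)"
abbreviation (input) "S v \<equiv> wsum n (\<lambda>_. 1) (snd v)"
abbreviation (input) "Y v \<equiv> K * S v + N v"
abbreviation (input) "h v \<equiv> \<alpha> / (K + N v / S v)"
abbreviation (input) "F v \<equiv> enn2real (half_tail f0 (q v))"

lemma K: "K > 0" using \<alpha> \<gamma> by (simp add: K_def)

lemma w1: "i \<in> {1..p} \<Longrightarrow> w1 i > 0" using c_pos d_pos by simp

text \<open>The weights of Q are a_i times those of N, which is what yields Q \<le> A N.\<close>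

lemma wQ: "i \<in> {1..p} \<Longrightarrow> wQ i = d i powr (1 - j) / c i * w1 i"
  using c_pos[of i] d_pos[of i] by (simp add: power2_eq_square powr_diff powr_minus field_simps)

lemma N_nonneg: "N v \<ge> 0" by (rule wsum_nonneg) (use w1 less_imp_le in blast)
lemma Q_nonneg: "Q v \<ge> 0" by (rule wsum_nonneg) simp
lemma S_nonneg: "S v \<ge> 0" by (rule wsum_nonneg) simp

lemma A_nonneg: "A \<ge> 0"
proof -
  have "0 \<le> d 1 powr (1 - j) / c 1" using c_pos[of 1] p by simp
  also have "\<dots> \<le> A" using A[of 1] p by simp
  finally show ?thesis .
qed

lemma Q_le: "Q v \<le> A * N v"
proof -
  have "Q v \<le> wsum p (\<lambda>i. A * w1 i) (fst v)"
    by (rule wsum_mono) (use wQ A w1 in \<open>simp only:, intro mult_right_mono, auto intro: less_imp_le\<close>)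
  then show ?thesis by (simp add: wsum_def sum_distrib_left mult.assoc)
qed

lemma h_bounds: "0 \<le> h v" "h v \<le> \<alpha> / K"
proof -
  have "0 \<le> N v / S v" using N_nonneg S_nonneg by (intro divide_nonneg_nonneg)
  then show "0 \<le> h v" "h v \<le> \<alpha> / K"
    using K \<alpha> by (auto intro!: divide_nonneg_nonneg divide_left_mono mult_pos_pos)
qed

lemma abs_times_le: "\<bar>a * b\<bar> \<le> a\<^sup>2 + b\<^sup>2" for a b :: real
  using sum_squares_bound[of "\<bar>a\<bar>" "\<bar>b\<bar>"] mult_nonneg_nonneg[OF abs_ge_zero[of a] abs_ge_zero[of b]]
  unfolding abs_mult power2_abs by linarith

lemma coord_sq_le: "i \<in> {1..p} \<Longrightarrow> (fst v i)\<^sup>2 \<le> (\<Sum>i=1..p. (fst v i)\<^sup>2)" for v :: "(nat \<Rightarrow> real) \<times> (nat \<Rightarrow> real)"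
  by (rule member_le_sum) auto

text \<open>This handles the cross term of the expanded loss. As h is bounded by \<alpha> / K, the
  integrand grows quadratically in x.\<close>

lemma stein_X:
  assumes i: "i \<in> {1..p}"
  defines "H \<equiv> \<lambda>v. h v - 2 * \<alpha> * (w1 i * (fst v i)\<^sup>2 / S v) / (K + N v / S v)\<^sup>2"
  shows "integrable (obs_space p n) (\<lambda>v. (fst v i - \<theta> i) * (fst v i * h v) * f0 (q v))"
    and "integrable (obs_space p n) (\<lambda>v. H v * F v)"
    and "(\<integral>v. (fst v i - \<theta> i) * (fst v i * h v) * f0 (q v) \<partial>obs_space p n) =
      d i * \<sigma>\<^sup>2 * (\<integral>v. H v * F v \<partial>obs_space p n)"
proof -
  note [measurable] = measurable_fst_coord[OF i]
  have D: "d i * \<sigma>\<^sup>2 > 0" using d_pos[OF i] \<sigma> by simp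
  have g: "(\<lambda>v. fst v i * h v) \<in> borel_measurable (obs_space p n)" by measurable
  have H: "H \<in> borel_measurable (obs_space p n)" unfolding H_def by measurable
  have deriv: "((\<lambda>y. fst (x(i := y), z) i * h (x(i := y), z)) has_real_derivative H (x(i := y), z)) (at y)" for x z y
  proof -
    have up: "wsum p w1 (x(i := y)) = wsum p w1 (x(i := 0)) + w1 i * y\<^sup>2" for y
      by (rule wsum_upd[OF i])
    have "wsum p w1 (x(i := 0)) \<ge> 0" "w1 i \<ge> 0" "wsum n (\<lambda>_. 1) z \<ge> 0"
      using N_nonneg[of "(x(i := 0), z)"] S_nonneg[of "(x, z)"] w1[OF i] by (simp_all add: less_imp_le)
    from has_real_derivative_shrink[OF K this, of \<alpha> y]
    show ?thesis unfolding H_def fst_conv snd_conv fun_upd_same up[symmetric] .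
  qed
  have bd: "\<bar>H v\<bar> \<le> 3 * \<alpha> / K" for v
    unfolding H_def
  proof (rule shrink_deriv_bound)
    show "w1 i * (fst v i)\<^sup>2 \<le> N v"
      by (rule wsum_member_le[OF _ i]) (use w1 less_imp_le in blast)
  qed (use K \<alpha> w1[OF i] S_nonneg in auto)
  show int: "integrable (obs_space p n) (\<lambda>v. (fst v i - \<theta> i) * (fst v i * h v) * f0 (q v))"
  proof (rule integrable_quadratic_bound[OF \<sigma>])
    fix v :: "(nat \<Rightarrow> real) \<times> (nat \<Rightarrow> real)"
    have "(a - t) * (a * b) = (a\<^sup>2 - t * a) * b" for a b t :: real
      by (simp add: power2_eq_square algebra_simps)
    then have "\<bar>(fst v i - \<theta> i) * (fst v i * h v)\<bar> = \<bar>(fst v i)\<^sup>2 - \<theta> i * fst v i\<bar> * h v"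
      using abs_of_nonneg[OF h_bounds(1)[of v]] by (simp only: abs_mult)
    also have "\<dots> \<le> (2 * (fst v i)\<^sup>2 + (\<theta> i)\<^sup>2) * (\<alpha> / K)"
    proof (rule mult_mono)
      show "\<bar>(fst v i)\<^sup>2 - \<theta> i * fst v i\<bar> \<le> 2 * (fst v i)\<^sup>2 + (\<theta> i)\<^sup>2"
        using abs_times_le[of "\<theta> i" "fst v i"] zero_le_power2[of "fst v i"] unfolding abs_le_iff by linarith
    qed (use h_bounds[of v] in auto)
    also have "\<dots> \<le> (2 * (\<Sum>i=1..p. (fst v i)\<^sup>2) + (\<theta> i)\<^sup>2) * (\<alpha> / K)"
      using coord_sq_le[OF i, of v] K \<alpha> by (intro mult_right_mono add_right_mono mult_left_mono) auto
    finally show "\<bar>(fst v i - \<theta> i) * (fst v i * h v)\<bar> \<le>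
        (\<theta> i)\<^sup>2 * (\<alpha> / K) + (2 * (\<alpha> / K)) * (\<Sum>i=1..p. (fst v i)\<^sup>2)" by (simp add: algebra_simps)
  qed measurable
  note st = stein_coord[OF _ i Z.sigma_finite_measure_axioms measurable_f0 measurable_sq_radius_pair[OF \<sigma>]
      g[unfolded obs_space_def] H[unfolded obs_space_def] D f0_nonneg sq_radius_upd_fst[OF \<sigma> i] deriv bd
      half_tail_finite[OF \<sigma>, unfolded obs_space_def] int[unfolded obs_space_def]]
  show "integrable (obs_space p n) (\<lambda>v. H v * F v)"
    unfolding obs_space_def by (rule st(1)) simp
  show "(\<integral>v. (fst v i - \<theta> i) * (fst v i * h v) * f0 (q v) \<partial>obs_space p n) =
      d i * \<sigma>\<^sup>2 * (\<integral>v. H v * F v \<partial>obs_space p n)"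
    unfolding obs_space_def by (rule st(2)) simp
qed

lemma integrable_Q: "integrable (obs_space p n) (\<lambda>v. Q v * (h v)\<^sup>2 * f0 (q v))"
proof (rule integrable_quadratic_bound[OF \<sigma>])
  fix v :: "(nat \<Rightarrow> real) \<times> (nat \<Rightarrow> real)"
  have "\<bar>Q v * (h v)\<^sup>2\<bar> = Q v * (h v)\<^sup>2" using Q_nonneg[of v] by simp
  also have "\<dots> \<le> ((\<Sum>i=1..p. wQ i) * (\<Sum>i=1..p. (fst v i)\<^sup>2)) * (\<alpha> / K)\<^sup>2"
    using h_bounds[of v] by (intro mult_mono wsum_le power_mono) (auto intro!: sum_nonneg mult_nonneg_nonneg)
  finally show "\<bar>Q v * (h v)\<^sup>2\<bar> \<le> 0 + ((\<alpha> / K)\<^sup>2 * (\<Sum>i=1..p. wQ i)) * (\<Sum>i=1..p. (fst v i)\<^sup>2)"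
    by (simp add: mult_ac)
qed measurable

text \<open>For S > 0 the denominator \<open>K + N / S\<close> of h equals Y / S. At S = 0 the left
  side vanishes while h takes the value \<alpha> / K by division by 0, so the two expressions can be
  exchanged only almost everywhere.\<close>

lemma residual_form:
  "S v * (Q v * \<alpha>\<^sup>2 * (S v / (Y v)\<^sup>2)) = (if S v = 0 then 0 else Q v * (h v)\<^sup>2)"
proof (cases "S v = 0")
  case False
  then have "K + N v / S v = Y v / S v" by (simp add: field_simps)
  then show ?thesis using False by (simp add: power2_eq_square)
qed simp

text \<open>Multiplying and dividing by S splits the quadratic term \<open>Q h(W)^2\<close> into
  summands \<open>z_k * g\<close>, each of the form to which integration by parts in z_k
  applies.\<close>

lemma stein_Z:
  assumes k: "k \<in> {1..n}"
  defines "g \<equiv> \<lambda>v. snd v k * (Q v * \<alpha>\<^sup>2 * (S v / (Y v)\<^sup>2))"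
    and "H \<equiv> \<lambda>v. Q v * \<alpha>\<^sup>2 * (S v / (Y v)\<^sup>2 + 2 * (snd v k)\<^sup>2 * (N v - K * S v) / (Y v) ^ 3)"
  shows "integrable (obs_space p n) (\<lambda>v. snd v k * g v * f0 (q v))"
    and "integrable (obs_space p n) (\<lambda>v. H v * F v)"
    and "(\<integral>v. snd v k * g v * f0 (q v) \<partial>obs_space p n) = \<sigma>\<^sup>2 * (\<integral>v. H v * F v \<partial>obs_space p n)"
proof -
  note [measurable] = measurable_snd_coord[OF k]
  have D: "\<sigma>\<^sup>2 > 0" using \<sigma> by simp
  have g: "g \<in> borel_measurable (obs_space p n)" unfolding g_def by measurable
  have H: "H \<in> borel_measurable (obs_space p n)" unfolding H_def by measurable
  have deriv: "((\<lambda>y. g (x, z(k := y))) has_real_derivative H (x, z(k := y))) (at y)" for x z y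
  \<comment> \<open>The derivative formula needs N > 0. At N = 0 the bound Q \<le> A N makes Q
    vanish, hence \<open>g\<close> and \<open>H\<close> vanish along the whole line in direction
    k.\<close>
  proof (cases "N (x, z) = 0")
    case True
    then have "Q (x, z) = 0" using Q_le[of "(x, z)"] Q_nonneg[of "(x, z)"] by simp
    then show ?thesis by (simp add: g_def H_def)
  next
    case False
    then have N: "N (x, z) > 0" using N_nonneg[of "(x, z)"] by linarith
    have up: "wsum n (\<lambda>_. 1) (z(k := y)) = wsum n (\<lambda>_. 1) (z(k := 0)) + y\<^sup>2" for y
      using wsum_upd[OF k, of "\<lambda>_. 1" z y] by (simp only: mult_1)
    have "wsum n (\<lambda>_. 1) (z(k := 0)) \<ge> 0" using S_nonneg[of "(x, z(k := 0))"] by simp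
    note has_real_derivative_residual[OF K this N, of y]
    from DERIV_cmult[OF this[folded up], of "Q (x, z) * \<alpha>\<^sup>2"]
    show ?thesis by (simp add: g_def H_def mult_ac)
  qed
  have zk: "(snd v k)\<^sup>2 \<le> S v" for v :: "(nat \<Rightarrow> real) \<times> (nat \<Rightarrow> real)"
    using wsum_member_le[of n "\<lambda>_. 1" k "snd v"] k by simp
  have bd: "\<bar>H v\<bar> \<le> 3 * \<alpha>\<^sup>2 * A / K" for v
    unfolding H_def by (intro residual_deriv_bound K A_nonneg Q_nonneg Q_le zk N_nonneg) simp
  show int: "integrable (obs_space p n) (\<lambda>v. snd v k * g v * f0 (q v))"
  \<comment> \<open>Since z_k^2 is at most S, the whole quadratic term dominates each of its
    summands.\<close>
  proof (rule Bochner_Integration.integrable_bound[OF integrable_Q])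
    show "AE v in obs_space p n. norm (snd v k * g v * f0 (q v)) \<le> norm (Q v * (h v)\<^sup>2 * f0 (q v))"
    proof (intro AE_I2)
      fix v
      have "\<bar>snd v k * g v\<bar> = (snd v k)\<^sup>2 * (Q v * \<alpha>\<^sup>2 * (S v / (Y v)\<^sup>2))"
        using Q_nonneg[of v] S_nonneg[of v] by (simp add: g_def abs_mult power2_eq_square)
      also have "\<dots> \<le> S v * (Q v * \<alpha>\<^sup>2 * (S v / (Y v)\<^sup>2))"
        using Q_nonneg[of v] S_nonneg[of v] by (intro mult_right_mono zk) simp
      also have "\<dots> \<le> Q v * (h v)\<^sup>2"
        unfolding residual_form using Q_nonneg[of v] by simp
      finally show "norm (snd v k * g v * f0 (q v)) \<le> norm (Q v * (h v)\<^sup>2 * f0 (q v))"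
        using Q_nonneg[of v] by (simp add: abs_mult[of _ "f0 (q v)"] f0_nonneg mult_right_mono)
    qed
  qed (use g in measurable)
  note st = stein_coord_snd[OF _ k X.sigma_finite_measure_axioms measurable_f0 measurable_sq_radius_pair[OF \<sigma>]
      g[unfolded obs_space_def] H[unfolded obs_space_def] D f0_nonneg sq_radius_upd_snd[OF \<sigma> k] deriv bd
      half_tail_finite[OF \<sigma>, unfolded obs_space_def]]
  have 0: "(\<lambda>v. (snd v k - 0) * g v * f0 (q v)) = (\<lambda>v. snd v k * g v * f0 (q v))" by simp
  show "integrable (obs_space p n) (\<lambda>v. H v * F v)"
    unfolding obs_space_def by (rule st(1)) (use int in \<open>simp_all add: obs_space_def\<close>)
  show "(\<integral>v. snd v k * g v * f0 (q v) \<partial>obs_space p n) = \<sigma>\<^sup>2 * (\<integral>v. H v * F v \<partial>obs_space p n)"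
    unfolding obs_space_def 0[symmetric] by (rule st(2)) (use int in \<open>simp_all add: obs_space_def\<close>)
qed

lemma nn_integral_obs_dist:
  assumes [measurable]: "g \<in> borel_measurable (obs_space p n)" and g: "\<And>v. g v \<ge> 0"
    and int: "integrable (obs_space p n) (\<lambda>v. g v * f0 (q v))"
  shows "(\<integral>\<^sup>+v. ennreal (g v) \<partial>obs_dist p n d f \<theta> \<sigma>) =
    ennreal (norm_const \<sigma> * (\<integral>v. g v * f0 (q v) \<partial>obs_space p n))"
proof -
  have "(\<integral>\<^sup>+v. ennreal (g v) \<partial>obs_dist p n d f \<theta> \<sigma>) =
      (\<integral>\<^sup>+v. ennreal (norm_const \<sigma> * (g v * f0 (q v))) \<partial>obs_space p n)"
    unfolding obs_dist_def obs_density_eq using norm_const_pos[OF \<sigma>] g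
    by (subst nn_integral_density) (auto intro!: nn_integral_cong simp: f0_nonneg mult_ac simp flip: ennreal_mult)
  also have "\<dots> = ennreal (\<integral>v. norm_const \<sigma> * (g v * f0 (q v)) \<partial>obs_space p n)"
    using int norm_const_pos[OF \<sigma>] g
    by (intro nn_integral_eq_integral) (auto simp: f0_nonneg)
  finally show ?thesis by simp
qed

lemma risk_theta_SB_le:
  "risk p n d f j (theta_SB p n d c \<alpha> \<gamma>) \<theta> \<sigma> \<le> risk p n d f j fst \<theta> \<sigma>"
proof -
  let ?M = "obs_space p n"
  define G1 where "G1 = (\<lambda>i v. (fst v i - \<theta> i) * (fst v i * h v))"
  define H1 where "H1 = (\<lambda>i v. h v - 2 * \<alpha> * (w1 i * (fst v i)\<^sup>2 / S v) / (K + N v / S v)\<^sup>2)"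
  define G2 where "G2 = (\<lambda>k v. snd v k * (snd v k * (Q v * \<alpha>\<^sup>2 * (S v / (Y v)\<^sup>2))))"
  define H2 where "H2 = (\<lambda>k v. Q v * \<alpha>\<^sup>2 *
    (S v / (Y v)\<^sup>2 + 2 * (snd v k)\<^sup>2 * (N v - K * S v) / (Y v) ^ 3))"
  define a where "a = (\<lambda>i. d i powr (1 - j) / c i)"
  define b where "b = (\<lambda>i. d i powr (- j) / c i)"
  \<comment> \<open>\<open>E\<close> is \<sigma>^2 times the loss difference, to be integrated
    against f; \<open>T\<close> is what integration by parts makes of it, to be integrated against
    F. The factor d_i of the coordinate identity turns the weights \<open>b\<close> into
    \<open>a\<close>.\<close>
  define E where "E = (\<lambda>v. (\<Sum>i=1..p. - 2 * b i * G1 i v) + Q v * (h v)\<^sup>2)"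
  define T where "T = (\<lambda>v. (\<Sum>i=1..p. - 2 * a i * H1 i v) + (\<Sum>k=1..n. H2 k v))"
  have G1: "integrable ?M (\<lambda>v. G1 i v * f0 (q v))" "integrable ?M (\<lambda>v. H1 i v * F v)"
    "(\<integral>v. G1 i v * f0 (q v) \<partial>?M) = d i * \<sigma>\<^sup>2 * (\<integral>v. H1 i v * F v \<partial>?M)" if "i \<in> {1..p}" for i
    using stein_X[OF that] unfolding G1_def H1_def by simp_all
  have G2: "integrable ?M (\<lambda>v. G2 k v * f0 (q v))" "integrable ?M (\<lambda>v. H2 k v * F v)"
    "(\<integral>v. G2 k v * f0 (q v) \<partial>?M) = \<sigma>\<^sup>2 * (\<integral>v. H2 k v * F v \<partial>?M)" if "k \<in> {1..n}" for k
    using stein_Z[OF that] unfolding G2_def H2_def by simp_all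
  have E_split: "E v * f0 (q v) = (\<Sum>i=1..p. - 2 * b i * (G1 i v * f0 (q v))) + Q v * (h v)\<^sup>2 * f0 (q v)" for v
    by (simp only: E_def distrib_right sum_distrib_right mult.assoc)
  have T_split: "T v * F v = (\<Sum>i=1..p. - 2 * a i * (H1 i v * F v)) + (\<Sum>k=1..n. H2 k v * F v)" for v
    by (simp only: T_def distrib_right sum_distrib_right mult.assoc)
  have Eint: "integrable ?M (\<lambda>v. E v * f0 (q v))"
    unfolding E_split
    by (intro Bochner_Integration.integrable_add Bochner_Integration.integrable_sum integrable_mult_right G1(1) integrable_Q)
  have Q_eq: "(\<integral>v. Q v * (h v)\<^sup>2 * f0 (q v) \<partial>?M) = (\<Sum>k=1..n. \<sigma>\<^sup>2 * (\<integral>v. H2 k v * F v \<partial>?M))"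
  proof -
    have G2_sum: "(\<Sum>k=1..n. G2 k v) = S v * (Q v * \<alpha>\<^sup>2 * (S v / (Y v)\<^sup>2))" for v
    proof -
      have "G2 k v = (snd v k)\<^sup>2 * (Q v * \<alpha>\<^sup>2 * (S v / (Y v)\<^sup>2))" for k
        by (simp add: G2_def power2_eq_square)
      moreover have "(\<Sum>k=1..n. (snd v k)\<^sup>2) = S v" by (simp add: wsum_def)
      ultimately show ?thesis by (simp only: sum_distrib_right[symmetric])
    qed
    have "(\<integral>v. Q v * (h v)\<^sup>2 * f0 (q v) \<partial>?M) = (\<integral>v. (\<Sum>k=1..n. G2 k v * f0 (q v)) \<partial>?M)"
    proof (rule integral_cong_AE)
      show "AE v in ?M. Q v * (h v)\<^sup>2 * f0 (q v) = (\<Sum>k=1..n. G2 k v * f0 (q v))"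
        using AE_residual_pos
      proof eventually_elim
        case (elim v)
        then show ?case
          unfolding sum_distrib_right[symmetric] G2_sum residual_form by simp
      qed
    qed (use integrable_Q G2(1) in \<open>auto intro: borel_measurable_sum borel_measurable_integrable\<close>)
    also have "\<dots> = (\<Sum>k=1..n. \<integral>v. G2 k v * f0 (q v) \<partial>?M)"
      using G2(1) by (intro Bochner_Integration.integral_sum) auto
    also have "\<dots> = (\<Sum>k=1..n. \<sigma>\<^sup>2 * (\<integral>v. H2 k v * F v \<partial>?M))"
      using G2(3) by (intro sum.cong) auto
    finally show ?thesis .
  qed
  have bd: "b i * d i = a i" if "i \<in> {1..p}" for i
    using d_pos[OF that] by (simp add: a_def b_def powr_diff powr_minus field_simps)
  have "(\<integral>v. E v * f0 (q v) \<partial>?M) =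
      (\<Sum>i=1..p. - 2 * b i * (\<integral>v. G1 i v * f0 (q v) \<partial>?M)) + (\<integral>v. Q v * (h v)\<^sup>2 * f0 (q v) \<partial>?M)"
    unfolding E_split using G1(1) integrable_Q
    by (subst Bochner_Integration.integral_add) (auto intro!: sum.cong)
  also have "(\<Sum>i=1..p. - 2 * b i * (\<integral>v. G1 i v * f0 (q v) \<partial>?M)) =
      (\<Sum>i=1..p. \<sigma>\<^sup>2 * (- 2 * a i * (\<integral>v. H1 i v * F v \<partial>?M)))"
    by (intro sum.cong refl) (simp only: G1(3) bd[symmetric] mult_ac)
  also have "\<dots> + (\<integral>v. Q v * (h v)\<^sup>2 * f0 (q v) \<partial>?M) =
      \<sigma>\<^sup>2 * ((\<Sum>i=1..p. - 2 * a i * (\<integral>v. H1 i v * F v \<partial>?M)) + (\<Sum>k=1..n. \<integral>v. H2 k v * F v \<partial>?M))"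
    unfolding Q_eq by (simp only: sum_distrib_left distrib_left)
  also have "(\<Sum>i=1..p. - 2 * a i * (\<integral>v. H1 i v * F v \<partial>?M)) + (\<Sum>k=1..n. \<integral>v. H2 k v * F v \<partial>?M) =
      (\<integral>v. T v * F v \<partial>?M)"
    unfolding T_split using G1(2) G2(2)
    by (subst Bochner_Integration.integral_add) (auto intro!: sum.cong)
  finally have E_eq: "(\<integral>v. E v * f0 (q v) \<partial>?M) = \<sigma>\<^sup>2 * (\<integral>v. T v * F v \<partial>?M)" .
  \<comment> \<open>Summing the derivatives over i and k gives exactly the expression in
    \<open>risk_integrand_nonpos\<close>, and multiplication by F \<ge> 0 preserves its
    sign.\<close>
  have "AE v in ?M. T v * F v \<le> 0"
    using AE_residual_pos
  proof eventually_elim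
    case (elim v)
    have "(\<Sum>i=1..p. a i * (w1 i * (fst v i)\<^sup>2)) = Q v"
      unfolding wsum_def a_def by (intro sum.cong refl) (simp only: wQ mult.assoc)
    from arg_cong[OF this, of "\<lambda>t. t / S v"]
    have 1: "(\<Sum>i=1..p. a i * (w1 i * (fst v i)\<^sup>2 / S v)) = Q v / S v"
      by (simp only: sum_divide_distrib times_divide_eq_right)
    have "(\<Sum>i=1..p. - 2 * a i * H1 i v) =
        - 2 * ((\<Sum>i=1..p. a i) * h v - 2 * \<alpha> * (\<Sum>i=1..p. a i * (w1 i * (fst v i)\<^sup>2 / S v)) / (K + N v / S v)\<^sup>2)"
    proof -
      have "(\<Sum>i=1..p. - 2 * a i * (H - 2 * \<alpha> * t i / r)) = - 2 * ((\<Sum>i=1..p. a i) * H - 2 * \<alpha> * (\<Sum>i=1..p. a i * t i) / r)"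
        for H r t
        unfolding sum_distrib_left sum_distrib_right sum_divide_distrib sum_subtractf[symmetric]
        by (intro sum.cong refl) (simp add: algebra_simps)
      then show ?thesis by (simp only: H1_def)
    qed
    moreover have "(\<Sum>k=1..n. H2 k v) =
        Q v * \<alpha>\<^sup>2 * (real n * S v / (Y v)\<^sup>2 + 2 * S v * (N v - K * S v) / (Y v) ^ 3)"
    proof -
      have "S v = (\<Sum>k=1..n. (snd v k)\<^sup>2)" by (simp add: wsum_def)
      then have "(\<Sum>k=1..n. 2 * (snd v k)\<^sup>2 * (N v - K * S v) / (Y v) ^ 3) =
          2 * S v * (N v - K * S v) / (Y v) ^ 3"
        by (simp only: sum_distrib_left sum_distrib_right sum_divide_distrib)
      then show ?thesis
        unfolding H2_def by (simp only: sum_distrib_left[symmetric] sum.distrib) simp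
    qed
    ultimately have "T v \<le> 0"
      unfolding T_def 1
      using risk_integrand_nonpos[OF K \<alpha> elim N_nonneg Q_nonneg Q_le A_nonneg, of "real n" "\<Sum>i=1..p. a i"] A_le
      by (simp add: a_def)
    then show ?case by (simp add: mult_nonpos_nonneg)
  qed
  then have "(\<integral>v. T v * F v \<partial>?M) \<le> 0"
    using integral_nonneg_AE[of "\<lambda>v. - (T v * F v)" ?M] by simp
  then have E_le: "(\<integral>v. E v * f0 (q v) \<partial>?M) \<le> 0"
    unfolding E_eq by (simp add: mult_nonneg_nonpos)
  have loss_eq: "loss p d j (theta_SB p n d c \<alpha> \<gamma> v) \<theta> \<sigma> = loss p d j (fst v) \<theta> \<sigma> + E v / \<sigma>\<^sup>2" for v
  proof -
    have hW: "h_SB \<alpha> \<gamma> (W_stat p n d c v) = h v"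
      by (simp add: h_SB_def W_stat_def wsum_def K_def case_prod_unfold)
    have "d i powr (- j) * (theta_SB p n d c \<alpha> \<gamma> v i - \<theta> i)\<^sup>2 =
        d i powr (- j) * (fst v i - \<theta> i)\<^sup>2 + (- 2 * b i * G1 i v + wQ i * (fst v i)\<^sup>2 * (h v)\<^sup>2)"
      if "i \<in> {1..p}" for i
    proof -
      have "theta_SB p n d c \<alpha> \<gamma> v i = (1 - h v / c i) * fst v i"
        using that by (simp add: theta_SB_def shrinkage_est_def hW)
      moreover have "D * ((1 - H / C) * x - t)\<^sup>2 = D * (x - t)\<^sup>2 + (- 2 * (D / C) * ((x - t) * (x * H)) + D / C\<^sup>2 * x\<^sup>2 * H\<^sup>2)"
        if "C > 0" for D H C x t :: real
        using that by (simp add: power2_eq_square field_simps)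
      ultimately show ?thesis using c_pos[OF that] by (simp only: b_def G1_def)
    qed
    then have "(\<Sum>i=1..p. d i powr (- j) * (theta_SB p n d c \<alpha> \<gamma> v i - \<theta> i)\<^sup>2) =
        (\<Sum>i=1..p. d i powr (- j) * (fst v i - \<theta> i)\<^sup>2 + (- 2 * b i * G1 i v + wQ i * (fst v i)\<^sup>2 * (h v)\<^sup>2))"
      by (intro sum.cong refl)
    also have "\<dots> = (\<Sum>i=1..p. d i powr (- j) * (fst v i - \<theta> i)\<^sup>2) + E v"
      by (simp only: E_def wsum_def[of p wQ] sum.distrib sum_distrib_right)
    finally show ?thesis by (simp add: loss_def add_divide_distrib)
  qed
  have loss_nonneg: "loss p d j y \<theta> \<sigma> \<ge> 0" for y
    unfolding loss_def by (intro divide_nonneg_nonneg sum_nonneg) auto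
  have L: "(\<lambda>v. loss p d j (fst v) \<theta> \<sigma>) \<in> borel_measurable ?M"
    unfolding loss_def
    by (intro borel_measurable_divide borel_measurable_sum borel_measurable_times borel_measurable_power
        borel_measurable_diff borel_measurable_const) (auto intro: measurable_fst_coord)
  have E: "E \<in> borel_measurable ?M"
    unfolding E_def G1_def
    by (intro borel_measurable_divide borel_measurable_sum borel_measurable_times borel_measurable_power borel_measurable_add
        borel_measurable_diff borel_measurable_const) (auto intro: measurable_fst_coord measurable_wsum_fst measurable_wsum_snd)
  have Lint: "integrable ?M (\<lambda>v. loss p d j (fst v) \<theta> \<sigma> * f0 (q v))"
  proof -
    have "integrable ?M (\<lambda>v. (\<Sum>i=1..p. d i powr (- j) / \<sigma>\<^sup>2 * ((fst v i - \<theta> i)\<^sup>2 * f0 (q v))))"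
      using integrable_centered_square[OF \<sigma>] by auto
    moreover have "loss p d j (fst v) \<theta> \<sigma> * f0 (q v) =
        (\<Sum>i=1..p. d i powr (- j) / \<sigma>\<^sup>2 * ((fst v i - \<theta> i)\<^sup>2 * f0 (q v)))" for v
      unfolding loss_def sum_distrib_right sum_divide_distrib by (intro sum.cong refl) simp
    ultimately show ?thesis by simp
  qed
  have "risk p n d f j (theta_SB p n d c \<alpha> \<gamma>) \<theta> \<sigma> =
      ennreal (norm_const \<sigma> * (\<integral>v. (loss p d j (fst v) \<theta> \<sigma> + E v / \<sigma>\<^sup>2) * f0 (q v) \<partial>?M))"
    unfolding risk_def loss_eq
  proof (rule nn_integral_obs_dist)
    show "loss p d j (fst v) \<theta> \<sigma> + E v / \<sigma>\<^sup>2 \<ge> 0" for v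
      using loss_nonneg[of "theta_SB p n d c \<alpha> \<gamma> v"] by (simp only: loss_eq)
    show "integrable ?M (\<lambda>v. (loss p d j (fst v) \<theta> \<sigma> + E v / \<sigma>\<^sup>2) * f0 (q v))"
      using Lint Eint by (simp add: distrib_right)
  qed (use L E in measurable)
  also have "(\<integral>v. (loss p d j (fst v) \<theta> \<sigma> + E v / \<sigma>\<^sup>2) * f0 (q v) \<partial>?M) =
      (\<integral>v. loss p d j (fst v) \<theta> \<sigma> * f0 (q v) \<partial>?M) + (\<integral>v. E v * f0 (q v) \<partial>?M) / \<sigma>\<^sup>2"
    using Lint Eint by (simp add: distrib_right)
  also have "ennreal (norm_const \<sigma> * \<dots>) \<le> ennreal (norm_const \<sigma> * (\<integral>v. loss p d j (fst v) \<theta> \<sigma> * f0 (q v) \<partial>?M))"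
    using E_le norm_const_pos[OF \<sigma>] by (intro ennreal_leI mult_left_mono) (auto simp: divide_nonpos_nonneg)
  also have "\<dots> = risk p n d f j fst \<theta> \<sigma>"
    unfolding risk_def by (rule nn_integral_obs_dist[symmetric]) (use L Lint loss_nonneg in auto)
  finally show ?thesis .
qed

end

section \<open>A lower bound for the maximal risk\<close>

lemma emeasure_lborel_reflect:
  fixes a :: real
  assumes [measurable]: "B \<in> sets borel"
  shows "emeasure lborel ((\<lambda>t. a - t) -` B) = emeasure lborel B"
proof -
  have "emeasure lborel B = (\<integral>\<^sup>+t. indicator B t \<partial>lborel)" by simp
  also have "\<dots> = (\<integral>\<^sup>+t. indicator B (a - t) \<partial>lborel)"
    by (subst nn_integral_real_affine[where c = "-1" and t = a]) auto
  also have "\<dots> = (\<integral>\<^sup>+t. indicator ((\<lambda>t. a - t) -` B) t \<partial>lborel)"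
    by (intro nn_integral_cong) (auto split: split_indicator)
  also have "\<dots> = emeasure lborel ((\<lambda>t. a - t) -` B)"
    by (rule nn_integral_indicator) (use measurable_sets_borel[of "\<lambda>t. a - t" borel B] in auto)
  finally show ?thesis by simp
qed

lemma distr_PiM_lborel_reflect:
  fixes x :: "'i \<Rightarrow> real"
  assumes I: "finite I"
  shows "distr (lborel_PiM I) (lborel_PiM I) (\<lambda>u. \<lambda>i\<in>I. x i - u i) = lborel_PiM I"
proof (rule lebesgue_product.PiM_eqI[OF I])
  let ?P = "lborel_PiM I :: ('i \<Rightarrow> real) measure"
  have r: "(\<lambda>u. \<lambda>i\<in>I. x i - u i) \<in> ?P \<rightarrow>\<^sub>M ?P"
    by (intro measurable_restrict) simp
  fix A :: "'i \<Rightarrow> real set" assume A: "\<And>i. i \<in> I \<Longrightarrow> A i \<in> sets lborel"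
  have "emeasure (distr ?P ?P (\<lambda>u. \<lambda>i\<in>I. x i - u i)) (Pi\<^sub>E I A) =
      emeasure ?P ((\<lambda>u. \<lambda>i\<in>I. x i - u i) -` Pi\<^sub>E I A \<inter> space ?P)"
    using A I by (intro emeasure_distr r) auto
  also have "(\<lambda>u. \<lambda>i\<in>I. x i - u i) -` Pi\<^sub>E I A \<inter> space ?P = Pi\<^sub>E I (\<lambda>i. (\<lambda>t. x i - t) -` A i)"
    by (auto simp: space_PiM PiE_iff restrict_def)
  also have "emeasure ?P \<dots> = (\<Prod>i\<in>I. emeasure lborel ((\<lambda>t. x i - t) -` A i))"
  proof (rule lebesgue_product.emeasure_PiM[OF I])
    fix i assume "i \<in> I"
    then show "(\<lambda>t. x i - t) -` A i \<in> sets lborel"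
      using A measurable_sets_borel[of "\<lambda>t. x i - t" borel "A i"] by auto
  qed
  also have "\<dots> = (\<Prod>i\<in>I. emeasure lborel (A i))"
    using A by (intro prod.cong refl emeasure_lborel_reflect) auto
  finally show "emeasure (distr ?P ?P (\<lambda>u. \<lambda>i\<in>I. x i - u i)) (Pi\<^sub>E I A) = (\<Prod>i\<in>I. emeasure lborel (A i))" .
qed simp

text \<open>The same map exchanges \<theta> with the error u = x - \<theta> when x is the
  observation, exchanges observation and error when it reflects in \<theta>, and is the sign change
  of u when x = 0.\<close>

lemma nn_integral_PiM_lborel_reflect:
  fixes x :: "'i \<Rightarrow> real"
  assumes I: "finite I" and h: "h \<in> borel_measurable (lborel_PiM I)"
  shows "(\<integral>\<^sup>+u. h (\<lambda>i\<in>I. x i - u i) \<partial>lborel_PiM I) = (\<integral>\<^sup>+u. h u \<partial>lborel_PiM I)"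
proof -
  have r: "(\<lambda>u. \<lambda>i\<in>I. x i - u i) \<in> lborel_PiM I \<rightarrow>\<^sub>M lborel_PiM I"
    by (intro measurable_restrict) simp
  show ?thesis
    using nn_integral_distr[OF r, of h] h by (simp add: distr_PiM_lborel_reflect[OF I])
qed

section \<open>Averages over uniform priors on boxes\<close>

context elliptical_model
begin

context
  fixes \<sigma> j :: real
  assumes \<sigma>: "\<sigma> > 0"
begin

declare One_nat_def [simp del]

definition dens :: "(nat \<Rightarrow> real) \<Rightarrow> (nat \<Rightarrow> real) \<times> (nat \<Rightarrow> real) \<Rightarrow> ennreal" where
  "dens \<theta> v = ennreal (norm_const \<sigma> * f0 (sq_radius p n d \<theta> \<sigma> v))"

abbreviation "dens0 \<equiv> dens (\<lambda>_. 0)"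

definition box :: "real \<Rightarrow> (nat \<Rightarrow> real) set" where
  "box r = (\<Pi>\<^sub>E i\<in>{1..p}. {- r..r})"

definition sq_loss :: "(nat \<Rightarrow> real) \<Rightarrow> ennreal" where
  "sq_loss y = ennreal (loss p d j y (\<lambda>_. 0) \<sigma>)"

lemma loss_nonneg: "loss p d j y \<theta> \<sigma> \<ge> 0"
  unfolding loss_def by (intro divide_nonneg_nonneg sum_nonneg) auto

text \<open>Comparing squares lets one rule cover both shifts and sign changes of the error;
  \<open>dens_cong\<close> follows the same pattern.\<close>

lemma loss_cong:
  assumes "\<And>i. i \<in> {1..p} \<Longrightarrow> (y i - \<theta> i)\<^sup>2 = (y' i - \<theta>' i)\<^sup>2"
  shows "loss p d j y \<theta> \<sigma> = loss p d j y' \<theta>' \<sigma>"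
  unfolding loss_def using assms by (intro arg_cong2[of _ _ _ _ "(/)"] sum.cong refl) simp

lemma dens_cong:
  assumes "\<And>i. i \<in> {1..p} \<Longrightarrow> (x i - \<theta> i)\<^sup>2 = (x' i - \<theta>' i)\<^sup>2"
  shows "dens \<theta> (x, z) = dens \<theta>' (x', z)"
proof -
  have "(\<Sum>i=1..p. (x i - \<theta> i)\<^sup>2 / d i) = (\<Sum>i=1..p. (x' i - \<theta>' i)\<^sup>2 / d i)"
    using assms by (intro sum.cong refl) simp
  then show ?thesis by (simp add: dens_def sq_radius_def)
qed

lemma measurable_dens:
  assumes "\<And>i. i \<in> {1..p} \<Longrightarrow> (\<lambda>w. t w i) \<in> borel_measurable N"
    and "\<And>i. i \<in> {1..p} \<Longrightarrow> (\<lambda>w. fst (v w) i) \<in> borel_measurable N"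
    and "\<And>i. i \<in> {1..n} \<Longrightarrow> (\<lambda>w. snd (v w) i) \<in> borel_measurable N"
  shows "(\<lambda>w. dens (t w) (v w)) \<in> borel_measurable N"
proof -
  have "(\<lambda>w. sq_radius p n d (t w) \<sigma> (v w)) \<in> borel_measurable N"
    unfolding sq_radius_def using assms
    by (intro borel_measurable_divide borel_measurable_add borel_measurable_sum borel_measurable_power
        borel_measurable_diff borel_measurable_const) auto
  then show ?thesis unfolding dens_def by simp
qed

lemma measurable_loss:
  assumes "\<And>i. i \<in> {1..p} \<Longrightarrow> (\<lambda>w. t w i) \<in> borel_measurable N"
    and "\<And>i. i \<in> {1..p} \<Longrightarrow> (\<lambda>w. y w i) \<in> borel_measurable N"
  shows "(\<lambda>w. loss p d j (y w) (t w) \<sigma>) \<in> borel_measurable N"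
  unfolding loss_def using assms
  by (intro borel_measurable_divide borel_measurable_sum borel_measurable_times borel_measurable_power
      borel_measurable_diff borel_measurable_const) auto

lemma measurable_X: "i \<in> {1..p} \<Longrightarrow> (\<lambda>x. x i) \<in> borel_measurable X_space"
  using measurable_component_singleton[of i "{1..p}" "\<lambda>_. lborel :: real measure"] by simp

lemma measurable_dens_X: "(\<lambda>x. dens \<theta> (x, z)) \<in> borel_measurable X_space"
  by (rule measurable_dens) (auto intro: measurable_X)

lemma measurable_dens_obs: "dens \<theta> \<in> borel_measurable (obs_space p n)"
  by (rule measurable_dens) (auto intro: measurable_fst_coord measurable_snd_coord)

lemma measurable_sq_loss: "sq_loss \<in> borel_measurable X_space"
  unfolding sq_loss_def by (intro measurable_compose[OF _ measurable_ennreal] measurable_loss measurable_X) auto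

lemma box_sets: "box r \<in> sets X_space"
  unfolding box_def by (rule sets_PiM_I_finite) auto

lemma emeasure_box: "r \<ge> 0 \<Longrightarrow> emeasure X_space (box r) = ennreal ((2 * r) ^ p)"
  unfolding box_def by (subst lebesgue_product.emeasure_PiM) (auto simp: ennreal_power)

lemma risk_eq:
  assumes "(\<lambda>v. loss p d j (\<delta> v) \<theta> \<sigma>) \<in> borel_measurable (obs_space p n)"
  shows "risk p n d f j \<delta> \<theta> \<sigma> = (\<integral>\<^sup>+v. ennreal (loss p d j (\<delta> v) \<theta> \<sigma>) * dens \<theta> v \<partial>obs_space p n)"
  unfolding risk_def obs_dist_def obs_density_eq dens_def[symmetric]
  using measurable_dens_obs assms by (subst nn_integral_density) (auto simp: mult.commute)

text \<open>Reflection in \<theta> removes \<theta> from the integral: X has constant risk for fixed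
  \<sigma>. The integral over errors u is the form that truncation to boxes approximates.\<close>

lemma risk_fst_eq:
  "risk p n d f j fst \<theta> \<sigma> = (\<integral>\<^sup>+z. (\<integral>\<^sup>+u. sq_loss u * dens0 (u, z) \<partial>X_space) \<partial>Z_space)"
proof -
  have L: "(\<lambda>v. loss p d j (fst v) \<theta> \<sigma>) \<in> borel_measurable (obs_space p n)"
    by (rule measurable_loss) (auto intro: measurable_fst_coord)
  have "(\<lambda>v. ennreal (loss p d j (fst v) \<theta> \<sigma>) * dens \<theta> v) \<in> borel_measurable (obs_space p n)"
    by (intro borel_measurable_times_ennreal measurable_compose[OF L measurable_ennreal] measurable_dens_obs)
  note [measurable] = this[unfolded obs_space_def]
  have "risk p n d f j fst \<theta> \<sigma> =
      (\<integral>\<^sup>+z. (\<integral>\<^sup>+x. ennreal (loss p d j x \<theta> \<sigma>) * dens \<theta> (x, z) \<partial>X_space) \<partial>Z_space)"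
    unfolding risk_eq[OF L] obs_space_def by (subst XZ.nn_integral_snd[symmetric]) auto
  also have "\<dots> = (\<integral>\<^sup>+z. (\<integral>\<^sup>+u. sq_loss u * dens0 (u, z) \<partial>X_space) \<partial>Z_space)"
  proof (rule nn_integral_cong)
    fix z
    let ?h = "\<lambda>x. ennreal (loss p d j x \<theta> \<sigma>) * dens \<theta> (x, z)"
    have h: "?h \<in> borel_measurable X_space"
      by (intro borel_measurable_times_ennreal measurable_compose[OF _ measurable_ennreal] measurable_loss
          measurable_dens_X measurable_X) auto
    have "(\<integral>\<^sup>+x. ?h x \<partial>X_space) = (\<integral>\<^sup>+u. ?h (\<lambda>i\<in>{1..p}. \<theta> i - u i) \<partial>X_space)"
      by (rule nn_integral_PiM_lborel_reflect[symmetric, OF _ h]) simp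
    also have "\<dots> = (\<integral>\<^sup>+u. sq_loss u * dens0 (u, z) \<partial>X_space)"
      unfolding sq_loss_def
      by (intro nn_integral_cong arg_cong2[of _ _ _ _ "(*)"] arg_cong[of _ _ ennreal] loss_cong dens_cong) auto
    finally show "(\<integral>\<^sup>+x. ?h x \<partial>X_space) = (\<integral>\<^sup>+u. sq_loss u * dens0 (u, z) \<partial>X_space)" .
  qed
  finally show ?thesis .
qed

text \<open>Averaging over \<open>u\<close> and \<open>- u\<close> removes the cross term \<open>2 t\<^sub>i u\<^sub>i\<close>.\<close>

lemma symmetric_loss_bound:
  "(\<integral>\<^sup>+u. indicator (box k) u * sq_loss u * dens0 (u, z) \<partial>X_space) \<le>
    (\<integral>\<^sup>+u. indicator (box k) u * sq_loss (\<lambda>i. t i + u i) * dens0 (u, z) \<partial>X_space)"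
    (is "?L \<le> ?R")
proof -
  note [measurable] = measurable_dens_X measurable_sq_loss box_sets
  have [measurable]: "(\<lambda>u. sq_loss (\<lambda>i. t i + u i)) \<in> borel_measurable X_space"
    "(\<lambda>u. sq_loss (\<lambda>i. t i - u i)) \<in> borel_measurable X_space"
    unfolding sq_loss_def
    by (intro measurable_compose[OF _ measurable_ennreal] measurable_loss borel_measurable_add borel_measurable_diff
        measurable_X borel_measurable_const; assumption)+
  let ?h = "\<lambda>u. indicator (box k) u * sq_loss (\<lambda>i. t i + u i) * dens0 (u, z)"
  have "?R = (\<integral>\<^sup>+u. ?h (\<lambda>i\<in>{1..p}. 0 - u i) \<partial>X_space)"
    by (rule nn_integral_PiM_lborel_reflect[symmetric]) (simp, measurable)
  also have "\<dots> = (\<integral>\<^sup>+u. indicator (box k) u * sq_loss (\<lambda>i. t i - u i) * dens0 (u, z) \<partial>X_space)"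
  proof (rule nn_integral_cong)
    fix u assume "u \<in> space X_space"
    then have "(\<lambda>i\<in>{1..p}. 0 - u i) \<in> box k \<longleftrightarrow> u \<in> box k"
      by (auto simp: box_def space_PiM PiE_iff)
    moreover have "sq_loss (\<lambda>i. t i + (\<lambda>i\<in>{1..p}. 0 - u i) i) = sq_loss (\<lambda>i. t i - u i)"
      unfolding sq_loss_def by (intro arg_cong[of _ _ ennreal] loss_cong) simp
    moreover have "dens0 (\<lambda>i\<in>{1..p}. 0 - u i, z) = dens0 (u, z)"
      by (rule dens_cong) simp
    ultimately show "?h (\<lambda>i\<in>{1..p}. 0 - u i) =
        indicator (box k) u * sq_loss (\<lambda>i. t i - u i) * dens0 (u, z)"
      by (simp add: indicator_def)
  qed
  finally have R: "?R = \<dots>" .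
  have "2 * ?L = (\<integral>\<^sup>+u. 2 * (indicator (box k) u * sq_loss u * dens0 (u, z)) \<partial>X_space)"
    by (rule nn_integral_cmult[symmetric]) measurable
  also have "\<dots> \<le> (\<integral>\<^sup>+u. indicator (box k) u * sq_loss (\<lambda>i. t i + u i) * dens0 (u, z) +
      indicator (box k) u * sq_loss (\<lambda>i. t i - u i) * dens0 (u, z) \<partial>X_space)"
  proof (rule nn_integral_mono)
    fix u
    have "2 * loss p d j u (\<lambda>_. 0) \<sigma> \<le> loss p d j (\<lambda>i. t i + u i) (\<lambda>_. 0) \<sigma> + loss p d j (\<lambda>i. t i - u i) (\<lambda>_. 0) \<sigma>"
    proof -
      have "(\<Sum>i=1..p. 2 * (d i powr (- j) * (u i)\<^sup>2)) \<le>
          (\<Sum>i=1..p. d i powr (- j) * (t i + u i)\<^sup>2 + d i powr (- j) * (t i - u i)\<^sup>2)"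
      proof (rule sum_mono)
        fix i
        have "2 * (u i)\<^sup>2 \<le> (t i + u i)\<^sup>2 + (t i - u i)\<^sup>2"
          by (simp add: power2_eq_square algebra_simps)
        from mult_left_mono[OF this, of "d i powr (- j)"]
        show "2 * (d i powr (- j) * (u i)\<^sup>2) \<le> d i powr (- j) * (t i + u i)\<^sup>2 + d i powr (- j) * (t i - u i)\<^sup>2"
          by (simp add: distrib_left mult.left_commute)
      qed
      then have "(\<Sum>i=1..p. 2 * (d i powr (- j) * (u i)\<^sup>2)) / \<sigma>\<^sup>2 \<le>
          (\<Sum>i=1..p. d i powr (- j) * (t i + u i)\<^sup>2 + d i powr (- j) * (t i - u i)\<^sup>2) / \<sigma>\<^sup>2"
        by (intro divide_right_mono) auto
      then show ?thesis
        by (simp add: loss_def sum.distrib add_divide_distrib flip: sum_distrib_left)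
    qed
    then have "ennreal (2 * loss p d j u (\<lambda>_. 0) \<sigma>) \<le>
        ennreal (loss p d j (\<lambda>i. t i + u i) (\<lambda>_. 0) \<sigma> + loss p d j (\<lambda>i. t i - u i) (\<lambda>_. 0) \<sigma>)"
      by (rule ennreal_leI)
    then have "2 * sq_loss u \<le> sq_loss (\<lambda>i. t i + u i) + sq_loss (\<lambda>i. t i - u i)"
      by (simp add: sq_loss_def ennreal_mult loss_nonneg)
    then have "(2 * sq_loss u) * (indicator (box k) u * dens0 (u, z)) \<le>
        (sq_loss (\<lambda>i. t i + u i) + sq_loss (\<lambda>i. t i - u i)) * (indicator (box k) u * dens0 (u, z))"
      by (rule mult_right_mono) simp
    then show "2 * (indicator (box k) u * sq_loss u * dens0 (u, z)) \<le>
        indicator (box k) u * sq_loss (\<lambda>i. t i + u i) * dens0 (u, z) +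
        indicator (box k) u * sq_loss (\<lambda>i. t i - u i) * dens0 (u, z)"
      by (simp add: distrib_left distrib_right mult_ac)
  qed
  also have "\<dots> = ?R + ?R"
    by (subst nn_integral_add) (measurable, simp only: R)
  finally have "2 * ?L \<le> 2 * ?R" by (simp add: mult_2)
  then show ?thesis by (simp add: ennreal_mult_le_mult_iff)
qed

lemma measurable_indicator_box:
  "(\<lambda>v. indicator (box r) (fst v) :: ennreal) \<in> borel_measurable (X_space \<Otimes>\<^sub>M Z_space)"
  by (rule measurable_compose[OF measurable_fst borel_measurable_indicator[OF box_sets]])

lemma measurable_truncated_risk:
  "(\<lambda>z. \<integral>\<^sup>+u. indicator (box k) u * sq_loss u * dens0 (u, z) \<partial>X_space) \<in> borel_measurable Z_space"
proof -
  have "(\<lambda>v. indicator (box k) (fst v) * sq_loss (fst v) * dens0 v) \<in> borel_measurable (X_space \<Otimes>\<^sub>M Z_space)"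
    by (intro borel_measurable_times_ennreal measurable_indicator_box measurable_compose[OF measurable_fst measurable_sq_loss]
        measurable_dens_obs[unfolded obs_space_def])
  from measurable_compose[OF measurable_Pair[OF measurable_snd measurable_fst] this]
  show ?thesis
    by (intro X.borel_measurable_nn_integral) (simp add: case_prod_unfold)
qed

text \<open>The average over \<theta> in \<open>box m\<close> is bounded below by keeping only x in
  \<open>box (m - k)\<close> and errors u = x - \<theta> in \<open>box k\<close>, for which \<theta>
  lies in \<open>box m\<close> automatically. For fixed data the estimate is a fixed shift of x, so
  \<open>symmetric_loss_bound\<close> applies and no Bayes estimator has to be computed. The volumes
  of \<open>box (m - k)\<close> and \<open>box m\<close> give the two constants.\<close>

lemma uniform_prior_bound:
  assumes \<delta>: "\<delta> \<in> estimators p n" and m: "0 < k" "k < m"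
  shows "ennreal ((2 * (m - k)) ^ p) *
      (\<integral>\<^sup>+z. (\<integral>\<^sup>+u. indicator (box k) u * sq_loss u * dens0 (u, z) \<partial>X_space) \<partial>Z_space)
    \<le> ennreal ((2 * m) ^ p) * max_risk p n d f j \<delta>"
proof -
  let ?r = "\<lambda>z. \<integral>\<^sup>+u. indicator (box k) u * sq_loss u * dens0 (u, z) \<partial>X_space"
  let ?M = "obs_space p n"
  let ?G = "\<lambda>\<theta> v. indicator (box m) \<theta> * (ennreal (loss p d j (\<delta> v) \<theta> \<sigma>) * dens \<theta> v)"
  have \<delta>i: "(\<lambda>v. \<delta> v i) \<in> borel_measurable ?M" if "i \<in> {1..p}" for i
    using measurable_compose[OF \<delta>[unfolded estimators_def] measurable_component_singleton[OF that]] .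
  have L: "(\<lambda>v. loss p d j (\<delta> v) \<theta> \<sigma>) \<in> borel_measurable ?M" for \<theta>
    by (rule measurable_loss) (auto intro: \<delta>i)
  interpret M: sigma_finite_measure ?M
    unfolding obs_space_def by (rule XZ.sigma_finite_measure_axioms)
  interpret XM: pair_sigma_finite X_space ?M ..
  have G: "(\<lambda>(\<theta>, v). ?G \<theta> v) \<in> borel_measurable (X_space \<Otimes>\<^sub>M ?M)"
  proof -
    have "(\<lambda>w. ?G (fst w) (snd w)) \<in> borel_measurable (X_space \<Otimes>\<^sub>M ?M)"
    proof (intro borel_measurable_times_ennreal measurable_compose[OF _ measurable_ennreal])
      show "(\<lambda>w. indicator (box m) (fst w)) \<in> borel_measurable (X_space \<Otimes>\<^sub>M ?M)"
        using box_sets by measurable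
      show "(\<lambda>w. loss p d j (\<delta> (snd w)) (fst w) \<sigma>) \<in> borel_measurable (X_space \<Otimes>\<^sub>M ?M)"
        by (rule measurable_loss)
          (auto intro: measurable_compose[OF measurable_fst measurable_X] measurable_compose[OF measurable_snd \<delta>i])
      show "(\<lambda>w. dens (fst w) (snd w)) \<in> borel_measurable (X_space \<Otimes>\<^sub>M ?M)"
        by (rule measurable_dens)
          (auto intro: measurable_compose[OF measurable_fst measurable_X]
            measurable_compose[OF measurable_snd measurable_fst_coord] measurable_compose[OF measurable_snd measurable_snd_coord])
    qed
    then show ?thesis by (simp add: case_prod_unfold)
  qed
  \<comment> \<open>For fixed data the substitution \<theta> = x - u is made, and the shift t in the
    symmetric bound is \<delta>(v) - x.\<close>
  have "(\<integral>\<^sup>+v. indicator (box (m - k)) (fst v) * ?r (snd v) \<partial>?M) \<le> (\<integral>\<^sup>+v. (\<integral>\<^sup>+\<theta>. ?G \<theta> v \<partial>X_space) \<partial>?M)"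
  proof (rule nn_integral_mono)
    fix v assume v: "v \<in> space ?M"
    obtain x z where xz: "v = (x, z)" by (cases v)
    show "indicator (box (m - k)) (fst v) * ?r (snd v) \<le> (\<integral>\<^sup>+\<theta>. ?G \<theta> v \<partial>X_space)"
    proof (cases "x \<in> box (m - k)")
      case True
      have "?r z \<le> (\<integral>\<^sup>+u. indicator (box k) u * sq_loss (\<lambda>i. (\<delta> v i - x i) + u i) * dens0 (u, z) \<partial>X_space)"
        by (rule symmetric_loss_bound)
      also have "\<dots> \<le> (\<integral>\<^sup>+u. ?G (\<lambda>i\<in>{1..p}. x i - u i) v \<partial>X_space)"
      proof (rule nn_integral_mono)
        fix u
        have "indicator (box k) u \<le> (indicator (box m) (\<lambda>i\<in>{1..p}. x i - u i) :: ennreal)"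
        proof (cases "u \<in> box k")
          case u: True
          have "x i - u i \<in> {- m..m}" if "i \<in> {1..p}" for i
          proof -
            have "x i \<in> {- (m - k)..m - k}" "u i \<in> {- k..k}"
              using True u that unfolding box_def by (auto dest!: PiE_mem)
            then show ?thesis by auto
          qed
          then have "(\<lambda>i\<in>{1..p}. x i - u i) \<in> box m" by (simp add: box_def)
          then show ?thesis by (simp add: indicator_def)
        qed simp
        moreover have "sq_loss (\<lambda>i. (\<delta> v i - x i) + u i) = ennreal (loss p d j (\<delta> v) (\<lambda>i\<in>{1..p}. x i - u i) \<sigma>)"
          unfolding sq_loss_def by (intro arg_cong[of _ _ ennreal] loss_cong) (simp add: algebra_simps)
        moreover have "dens (\<lambda>i\<in>{1..p}. x i - u i) (x, z) = dens0 (u, z)"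
          by (rule dens_cong) simp
        ultimately show "indicator (box k) u * sq_loss (\<lambda>i. (\<delta> v i - x i) + u i) * dens0 (u, z) \<le>
            ?G (\<lambda>i\<in>{1..p}. x i - u i) v"
          by (simp only: xz mult.assoc) (rule mult_right_mono, simp_all)
      qed
      also have "\<dots> = (\<integral>\<^sup>+\<theta>. ?G \<theta> v \<partial>X_space)"
      proof (rule nn_integral_PiM_lborel_reflect)
        show "(\<lambda>\<theta>. ?G \<theta> v) \<in> borel_measurable X_space"
          using measurable_Pair1[OF G v] by simp
      qed simp
      finally show ?thesis using True by (simp add: xz)
    qed (simp add: xz)
  qed
  \<comment> \<open>Exchanging the order of integration returns to an average of risks over
    \<theta>, each of which is at most \<open>max_risk\<close>.\<close>
  also have "\<dots> = (\<integral>\<^sup>+\<theta>. (\<integral>\<^sup>+v. ?G \<theta> v \<partial>?M) \<partial>X_space)"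
    by (rule XM.Fubini'[OF G])
  also have "\<dots> \<le> (\<integral>\<^sup>+\<theta>. max_risk p n d f j \<delta> * indicator (box m) \<theta> \<partial>X_space)"
  proof (rule nn_integral_mono)
    fix \<theta> assume "\<theta> \<in> space X_space"
    have "(\<integral>\<^sup>+v. ?G \<theta> v \<partial>?M) = indicator (box m) \<theta> * risk p n d f j \<delta> \<theta> \<sigma>"
      unfolding risk_eq[OF L]
      by (intro nn_integral_cmult borel_measurable_times_ennreal measurable_compose[OF L measurable_ennreal] measurable_dens_obs)
    also have "\<dots> \<le> indicator (box m) \<theta> * max_risk p n d f j \<delta>"
      unfolding max_risk_def using \<sigma> by (intro mult_left_mono SUP_upper2[of "(\<theta>, \<sigma>)"]) auto
    finally show "(\<integral>\<^sup>+v. ?G \<theta> v \<partial>?M) \<le> max_risk p n d f j \<delta> * indicator (box m) \<theta>"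
      by (simp only: mult.commute[of "max_risk p n d f j \<delta>"])
  qed
  also have "\<dots> = max_risk p n d f j \<delta> * ennreal ((2 * m) ^ p)"
    using m nn_integral_cmult_indicator[OF box_sets, of "max_risk p n d f j \<delta>" m] by (simp only: emeasure_box less_imp_le)
  also have "(\<integral>\<^sup>+v. indicator (box (m - k)) (fst v) * ?r (snd v) \<partial>?M) = ennreal ((2 * (m - k)) ^ p) * (\<integral>\<^sup>+z. ?r z \<partial>Z_space)"
  proof -
    note r [measurable] = measurable_truncated_risk
    have [measurable]: "(\<lambda>v. indicator (box (m - k)) (fst v) * ?r (snd v)) \<in> borel_measurable (X_space \<Otimes>\<^sub>M Z_space)"
      by (intro borel_measurable_times_ennreal measurable_indicator_box measurable_compose[OF measurable_snd r])
    have "(\<integral>\<^sup>+v. indicator (box (m - k)) (fst v) * ?r (snd v) \<partial>?M) =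
        (\<integral>\<^sup>+z. (\<integral>\<^sup>+x. indicator (box (m - k)) x * ?r z \<partial>X_space) \<partial>Z_space)"
      unfolding obs_space_def by (subst XZ.nn_integral_snd[symmetric]) auto
    also have "\<dots> = (\<integral>\<^sup>+z. ennreal ((2 * (m - k)) ^ p) * ?r z \<partial>Z_space)"
      by (intro nn_integral_cong, subst nn_integral_multc)
        (use box_sets[of "m - k"] emeasure_box[of "m - k"] m in \<open>simp_all del: right_diff_distrib_numeral\<close>)
    also have "\<dots> = ennreal ((2 * (m - k)) ^ p) * (\<integral>\<^sup>+z. ?r z \<partial>Z_space)"
      by (rule nn_integral_cmult) measurable
    finally show ?thesis .
  qed
  finally show ?thesis by (simp add: mult.commute)
qed

lemma truncated_risk_le:
  assumes \<delta>: "\<delta> \<in> estimators p n" and k: "0 < k"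
  shows "(\<integral>\<^sup>+z. (\<integral>\<^sup>+u. indicator (box k) u * sq_loss u * dens0 (u, z) \<partial>X_space) \<partial>Z_space)
    \<le> max_risk p n d f j \<delta>" (is "?R \<le> ?X")
proof (cases "?X = \<top>")
  case False
  have le: "?R \<le> ?X * ennreal (((real N + 2) / (real N + 1)) ^ p)" for N
  proof -
    \<comment> \<open>With this choice m / (m - k) = (N + 2) / (N + 1), so the ratio of the volumes
      tends to 1 for fixed k.\<close>
    define m where "m = k * (real N + 2)"
    define a where "a = (2 * (m - k)) ^ p"
    have m: "0 < k" "k < m" using k by (auto simp: m_def algebra_simps add_pos_nonneg)
    have a: "a > 0" using m by (simp add: a_def)
    have mk: "m - k = k * (real N + 1)" by (simp add: m_def algebra_simps)
    have "?R = ennreal (1 / a) * (ennreal a * ?R)"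
      using a by (simp add: mult.assoc[symmetric] ennreal_mult[symmetric])
    also have "\<dots> \<le> ennreal (1 / a) * (ennreal ((2 * m) ^ p) * ?X)"
      using uniform_prior_bound[OF \<delta> m] unfolding a_def by (rule mult_left_mono) simp
    also have "\<dots> = ?X * ennreal ((2 * m) ^ p / a)"
    proof -
      have "ennreal ((2 * m) ^ p / a) = ennreal (1 / a) * ennreal ((2 * m) ^ p)"
        using a m by (simp add: ennreal_mult[symmetric])
      then show ?thesis by (simp only: mult_ac)
    qed
    also have "(2 * m) ^ p / a = ((real N + 2) / (real N + 1)) ^ p"
      unfolding a_def power_divide[symmetric] mk using k by (simp add: m_def)
    finally show ?thesis .
  qed
  have "(\<lambda>N. ((real N + 2) / (real N + 1)) ^ p) \<longlonglongrightarrow> 1 ^ p"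
  proof (rule tendsto_power)
    have "(\<lambda>N. 1 + inverse (real (Suc N))) \<longlonglongrightarrow> 1 + 0"
      by (intro tendsto_add tendsto_const LIMSEQ_inverse_real_of_nat)
    moreover have "(real N + 2) / (real N + 1) = 1 + inverse (real (Suc N))" for N
      by (simp add: field_simps)
    ultimately show "(\<lambda>N. (real N + 2) / (real N + 1)) \<longlonglongrightarrow> 1" by simp
  qed
  then have "(\<lambda>N. ?X * ennreal (((real N + 2) / (real N + 1)) ^ p)) \<longlonglongrightarrow> ?X * ennreal (1 ^ p)"
    using False by (intro ennreal_tendsto_cmult tendsto_ennrealI) (auto simp: less_top)
  then show ?thesis
    using le by (intro LIMSEQ_le_const[of _ ?X ?R]) auto
qed simp

text \<open>\<sigma> is held fixed, the prior concerning \<theta> alone. The boxes exhaust the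
  space, so monotone convergence removes the truncation; the radius 1 + K keeps every box
  nondegenerate.\<close>

lemma risk_fst_le_max_risk:
  assumes \<delta>: "\<delta> \<in> estimators p n"
  shows "risk p n d f j fst \<theta> \<sigma> \<le> max_risk p n d f j \<delta>"
proof -
  let ?h = "\<lambda>K u z. indicator (box (1 + real K)) u * sq_loss u * dens0 (u, z)"
  have mono: "?h K u z \<le> ?h L u z" if "K \<le> L" for K L u z
  proof (intro mult_right_mono)
    have "box (1 + real K) \<subseteq> box (1 + real L)"
      unfolding box_def using that by (intro PiE_mono) auto
    then show "indicator (box (1 + real K)) u \<le> (indicator (box (1 + real L)) u :: ennreal)"
      by (auto simp: indicator_def)
  qed simp_all
  have sup: "(SUP K. ?h K u z) = sq_loss u * dens0 (u, z)" if u: "u \<in> space X_space" for u z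
  proof (rule antisym)
    show "(SUP K. ?h K u z) \<le> sq_loss u * dens0 (u, z)"
      by (intro SUP_least) (auto simp: indicator_def)
    obtain K :: nat where K: "(\<Sum>i=1..p. \<bar>u i\<bar>) \<le> real K" using real_arch_simple by blast
    have "\<bar>u i\<bar> \<le> 1 + real K" if "i \<in> {1..p}" for i
    proof -
      have "\<bar>u i\<bar> \<le> (\<Sum>i=1..p. \<bar>u i\<bar>)" using that by (intro member_le_sum) auto
      then show ?thesis using K by simp
    qed
    then have "u \<in> box (1 + real K)"
      using u unfolding box_def by (auto simp: space_PiM PiE_iff abs_le_iff) (smt (verit))+
    then have "sq_loss u * dens0 (u, z) \<le> ?h K u z" by simp
    then show "sq_loss u * dens0 (u, z) \<le> (SUP K. ?h K u z)"
      by (rule order_trans) (rule SUP_upper, simp)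
  qed
  have "risk p n d f j fst \<theta> \<sigma> = (\<integral>\<^sup>+z. (\<integral>\<^sup>+u. (SUP K. ?h K u z) \<partial>X_space) \<partial>Z_space)"
    unfolding risk_fst_eq by (intro nn_integral_cong) (simp add: sup)
  also have "\<dots> = (\<integral>\<^sup>+z. (SUP K. \<integral>\<^sup>+u. ?h K u z \<partial>X_space) \<partial>Z_space)"
  proof (intro nn_integral_cong nn_integral_monotone_convergence_SUP)
    show "(\<lambda>u. ?h K u z) \<in> borel_measurable X_space" for K z
      by (intro borel_measurable_times_ennreal borel_measurable_indicator box_sets measurable_sq_loss measurable_dens_X)
  qed (auto simp: incseq_def le_fun_def intro: mono)
  also have "\<dots> = (SUP K. \<integral>\<^sup>+z. (\<integral>\<^sup>+u. ?h K u z \<partial>X_space) \<partial>Z_space)"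
    by (intro nn_integral_monotone_convergence_SUP measurable_truncated_risk)
      (auto simp: incseq_def le_fun_def intro!: nn_integral_mono mono)
  also have "\<dots> \<le> max_risk p n d f j \<delta>"
    by (intro SUP_least truncated_risk_le \<delta>) simp
  finally show ?thesis .
qed

end

end

section \<open>Condition numbers\<close>

lemma (in elliptical_model) theta_SB_estimator: "theta_SB p n d c \<alpha> \<gamma> \<in> estimators p n"
proof -
  have "(\<lambda>v. h_SB \<alpha> \<gamma> (W_stat p n d c v)) \<in> borel_measurable (obs_space p n)"
  proof -
    have "W_stat p n d c v = wsum p (\<lambda>i. 1 / (c i * d i)) (fst v) / wsum n (\<lambda>_. 1) (snd v)" for v
      by (simp add: W_stat_def wsum_def case_prod_unfold)
    then show ?thesis unfolding h_SB_def by simp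
  qed
  then show ?thesis
    unfolding estimators_def theta_SB_def shrinkage_est_def
    by (intro measurable_restrict borel_measurable_times borel_measurable_diff borel_measurable_divide
        borel_measurable_const measurable_fst_coord)
qed

text \<open>The numbers r_i are the weights a_i normalized by their bound A, which gives the
  assumption on \<alpha> the shape of \<open>u_plus\<close> and \<open>u_minus\<close>. Domination
  of X at each \<theta> and \<sigma> combines with the lower bound for every competitor at the same
  \<sigma>.\<close>

lemma (in elliptical_model) minimax_theta_SB:
  assumes c: "\<And>i. i \<in> {1..p} \<Longrightarrow> c i > 0" and \<alpha>: "\<alpha> > 0" and \<gamma>: "\<gamma> > 0" and A: "A \<ge> 0"
    and r: "\<And>i. i \<in> {1..p} \<Longrightarrow> d i powr (1 - j) / c i = A * r i" "\<And>i. i \<in> {1..p} \<Longrightarrow> r i \<le> 1"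
    and \<alpha>_le: "\<alpha> \<le> 2 / (real n + 2) * ((\<Sum>i=1..p. r i) - 2)"
  shows "minimax p n d f j (theta_SB p n d c \<alpha> \<gamma>)"
proof -
  have "\<alpha> * (real n + 2) \<le> 2 * ((\<Sum>i=1..p. r i) - 2)"
    using \<alpha>_le by (simp add: pos_le_divide_eq add_pos_nonneg)
  then have "A * (4 + \<alpha> * (real n + 2)) \<le> A * (2 * (\<Sum>i=1..p. r i))"
    using A by (intro mult_left_mono) auto
  also have "\<dots> = 2 * (\<Sum>i=1..p. d i powr (1 - j) / c i)"
    using r(1) by (simp add: sum_distrib_left mult_ac)
  finally have A_le: "A * (4 + \<alpha> * (real n + 2)) \<le> 2 * (\<Sum>i=1..p. d i powr (1 - j) / c i)" .
  have "risk p n d f j (theta_SB p n d c \<alpha> \<gamma>) \<theta> \<sigma> \<le> max_risk p n d f j \<delta>"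
    if "\<sigma> > 0" "\<delta> \<in> estimators p n" for \<theta> \<sigma> \<delta>
  proof -
    interpret shrinkage_setting p n d f \<theta> \<sigma> c j \<alpha> \<gamma> "\<gamma> * (\<alpha> + 1)" A
      using that(1) c \<alpha> \<gamma> A_le r mult_left_mono[OF r(2) A] by unfold_locales auto
    show ?thesis
      using risk_theta_SB_le risk_fst_le_max_risk[OF that(1,2)] by (rule order_trans)
  qed
  then show ?thesis
    unfolding minimax_def using theta_SB_estimator
    by (auto simp: max_risk_def[of _ _ _ _ _ "theta_SB p n d c \<alpha> \<gamma>"] intro!: SUP_least)
qed

text \<open>
  The pairwise inequalities are only needed when the minimum is positive: otherwise the quotient is
  at most 1, or 0 by the convention on division by 0.
\<close>

lemma cond_number_decreasingI:
  assumes p: "p \<ge> 1" and d: "\<And>i. i \<in> {1..p} \<Longrightarrow> d i > 0" "d p \<le> d 1"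
    and pairs: "\<And>w i k. w > 0 \<Longrightarrow> (\<And>i. i \<in> {1..p} \<Longrightarrow> 1 - h w / c i > 0) \<Longrightarrow> i \<in> {1..p} \<Longrightarrow> k \<in> {1..p} \<Longrightarrow>
      d i * d p * (1 - h w / c i) \<le> d 1 * d k * (1 - h w / c k)"
  shows "cond_number_decreasing p d c h"
  unfolding cond_number_decreasing_def
proof (intro allI impI)
  fix w :: real assume w: "w > 0"
  let ?e = "\<lambda>i. d i * (1 - h w / c i)"
  let ?mx = "MAX i\<in>{1..p}. ?e i" and ?mn = "MIN i\<in>{1..p}. ?e i"
  have ne: "finite (?e ` {1..p})" "?e ` {1..p} \<noteq> {}" using p by auto
  obtain i where i: "i \<in> {1..p}" "?mx = ?e i" using Max_in[OF ne] by auto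
  obtain k where k: "k \<in> {1..p}" "?mn = ?e k" using Min_in[OF ne] by auto
  have dp: "d p > 0" "d 1 > 0" using d(1)[of p] d(1)[of 1] p by auto
  have le: "?mn \<le> ?mx" unfolding i(2) using ne i(1) by (intro Min_le) auto
  have one: "1 \<le> d 1 / d p" using dp d(2) by simp
  show "?mx / ?mn \<le> d 1 / d p"
  proof (cases "?mn > 0")
    case True
    have "1 - h w / c l > 0" if "l \<in> {1..p}" for l
    proof -
      have "?mn \<le> ?e l" using ne that by (intro Min_le) auto
      then have "?e l > 0" using True by linarith
      then show ?thesis using d(1)[OF that] by (simp add: zero_less_mult_iff)
    qed
    from pairs[OF w this i(1) k(1)] have "d p * ?mx \<le> d 1 * ?mn"
      unfolding i(2) k(2) by (simp add: mult_ac)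
    then show ?thesis using True dp by (simp add: divide_le_eq pos_le_divide_eq mult_ac)
  next
    case False
    show ?thesis
    proof (cases "?mx \<ge> 0")
      case True
      then have "?mx / ?mn \<le> 0" using False by (simp add: divide_nonneg_nonpos)
      then show ?thesis using one by linarith
    next
      case mx: False
      then have "?mx / ?mn \<le> 1" using le by (simp add: divide_le_eq_1)
      then show ?thesis using one by linarith
    qed
  qed
qed

lemma h_SB_nonneg: "\<alpha> > 0 \<Longrightarrow> \<gamma> > 0 \<Longrightarrow> w > 0 \<Longrightarrow> h_SB \<alpha> \<gamma> w \<ge> 0"
  by (simp add: h_SB_def)

text \<open>The supremum of h, approached as w tends to 0, is \<alpha> / (\<gamma> (\<alpha> + 1));
  the lower bound on \<gamma> says that it is at most v.\<close>

lemma h_SB_le: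
  assumes "\<alpha> > 0" "\<gamma> > 0" "w > 0" "v > 0" "\<gamma> \<ge> \<alpha> / ((\<alpha> + 1) * v)"
  shows "h_SB \<alpha> \<gamma> w \<le> v"
proof -
  have "\<alpha> \<le> \<gamma> * ((\<alpha> + 1) * v)" using assms by (simp add: pos_divide_le_eq)
  also have "\<dots> \<le> v * (\<gamma> * (\<alpha> + 1) + w)" using assms by (simp add: algebra_simps)
  finally show ?thesis
    using assms by (simp add: h_SB_def pos_divide_le_eq add_pos_pos)
qed

text \<open>Both sides are affine in t, and solving for t gives the quotient. With u = c_i, v = c_k,
  a = d_1 d_k and b = d_i d_p it is the expression inside \<open>v_plus\<close>; the two entries of
  \<open>v_minus\<close> have the same form.\<close>

lemma shrunk_pair_le:
  fixes a b t u v :: real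
  assumes "u > 0" "v > 0" "u * a - v * b > 0" "t \<le> u * v * (a - b) / (u * a - v * b)"
  shows "b * (1 - t / u) \<le> a * (1 - t / v)"
proof -
  have "t * (u * a - v * b) \<le> u * v * (a - b)" using assms by (simp add: pos_le_divide_eq)
  then show ?thesis using assms(1,2) by (simp add: field_simps)
qed

section \<open>Pairwise inequalities and weights under the two sets of conditions\<close>

locale ordered_scales =
  fixes p :: nat and d :: "nat \<Rightarrow> real"
  assumes p3: "p \<ge> 3" and d_mono: "\<And>i k. 1 \<le> i \<Longrightarrow> i \<le> k \<Longrightarrow> k \<le> p \<Longrightarrow> d k \<le> d i" and dp_pos: "d p > 0"
begin

lemma d_pos: "i \<in> {1..p} \<Longrightarrow> d i > 0"
  using d_mono[of i p] dp_pos by auto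

lemma d1_pos: "d 1 > 0" using d_pos[of 1] p3 by simp

lemma d_le_d1: "i \<in> {1..p} \<Longrightarrow> d i \<le> d 1" using d_mono[of 1 i] by simp
lemma dp_le_d: "i \<in> {1..p} \<Longrightarrow> d p \<le> d i" using d_mono[of i p] by simp

lemma ratio_powr_le_1: "i \<in> {1..p} \<Longrightarrow> e \<ge> 0 \<Longrightarrow> (d i / d 1) powr e \<le> 1"
  using d_pos d1_pos d_le_d1 by (intro powr_le1) (auto simp: less_imp_le)

text \<open>The exponent j - 1 + \<eta> is positive, so c_i grows as d_i falls, starting from c_1 =
  1. The bound c_i \<ge> 1 later makes the prior covariance positive definite when \<gamma> \<ge>
  1.\<close>

lemma condition_i_c:
  assumes "condition_i p n d j c \<alpha> \<gamma> \<eta>"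
  shows "c 1 = 1" "\<And>i k. 1 \<le> i \<Longrightarrow> i \<le> k \<Longrightarrow> k \<le> p \<Longrightarrow> c i \<le> c k" "\<And>i. i \<in> {1..p} \<Longrightarrow> c i \<ge> 1"
proof -
  have c: "c i = (d 1 / d i) powr (j - 1 + \<eta>)" if "i \<in> {1..p}" for i
    using assms that by (simp add: condition_i_def)
  have \<beta>: "j - 1 + \<eta> \<ge> 0" using assms by (simp add: condition_i_def)
  show c1: "c 1 = 1" using c[of 1] p3 d1_pos by simp
  show mono: "c i \<le> c k" if "1 \<le> i" "i \<le> k" "k \<le> p" for i k
  proof -
    have "d 1 / d i \<le> d 1 / d k"
      using d_mono[OF that] d_pos[of k] d_pos[of i] d1_pos that by (intro divide_left_mono) auto
    then show ?thesis
      using that c[of i] c[of k] \<beta> d_pos[of i] d1_pos by (auto intro!: powr_mono2)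
  qed
  show "c i \<ge> 1" if "i \<in> {1..p}" for i using mono[of 1 i] c1 that by simp
qed

text \<open>For i \<le> k both factors on the left are at most those on the right, as d_i d_p \<le>
  d_1 d_k and c_i \<le> c_k. For k < i the order of the c's works against the inequality, and
  \<open>shrunk_pair_le\<close> asks for t below one of the quotients whose minimum is
  \<open>v_plus\<close>.\<close>

lemma condition_i_pair:
  assumes ci: "condition_i p n d j c \<alpha> \<gamma> \<eta>" and \<alpha>: "\<alpha> > 0" and \<gamma>: "\<gamma> > 0" and w: "w > 0"
    and pos: "\<And>i. i \<in> {1..p} \<Longrightarrow> 1 - h_SB \<alpha> \<gamma> w / c i > 0" and i: "i \<in> {1..p}" and k: "k \<in> {1..p}"
  shows "d i * d p * (1 - h_SB \<alpha> \<gamma> w / c i) \<le> d 1 * d k * (1 - h_SB \<alpha> \<gamma> w / c k)"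
proof -
  let ?t = "h_SB \<alpha> \<gamma> w"
  note c = condition_i_c[OF ci]
  note t = h_SB_nonneg[OF \<alpha> \<gamma> w]
  have ab: "0 < d i * d p" "d i * d p \<le> d 1 * d k"
    using d_pos[OF i] dp_pos d1_pos d_le_d1[OF i] dp_le_d[OF k] by (auto intro!: mult_mono)
  show ?thesis
  proof (cases "i \<le> k")
    case True
    then have "c i \<le> c k" "c i > 0" using c(2)[of i k] c(3)[OF i] i k by auto
    then have "?t / c k \<le> ?t / c i" using t by (intro divide_left_mono) auto
    then show ?thesis using ab pos[OF i] by (auto intro: mult_mono[of "d i * d p"])
  next
    case False
    then have ki: "1 \<le> k" "k < i" "i \<le> p" using i k by auto
    show ?thesis
    proof (cases "d 1 = d p")
      \<comment> \<open>All quotients in \<open>v_plus\<close> are 0 / 0 = 0 here and give no bound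
        on t, but all d_i and all c_i coincide, so the two sides are equal.\<close>
      case True
      have d_eq: "d l = d p" if "l \<in> {1..p}" for l
        using d_le_d1[OF that] dp_le_d[OF that] True by linarith
      have c_eq: "c l = 1" if l: "l \<in> {1..p}" for l
      proof -
        have "c l = (d 1 / d l) powr (j - 1 + \<eta>)" using ci l by (simp add: condition_i_def)
        then show ?thesis unfolding d_eq[OF l] True using dp_pos by simp
      qed
      show ?thesis unfolding d_eq[OF i] d_eq[OF k] c_eq[OF i] c_eq[OF k] True by simp
    next
      case False
      then have d1p: "d p < d 1" using d_le_d1[of p] p3 by simp
      define X where "X = {(i, k). 1 \<le> k \<and> k < i \<and> i \<le> p}"
      define q where "q = (\<lambda>(i, k). c i * c k * (d 1 * d k - d i * d p) / (c i * d 1 * d k - c k * d i * d p))"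
      \<comment> \<open>Equality would force d_l = d_1 and d_m = d_p, hence d_1 = d_p because m < l.
        Strictness is needed for positive numerators and denominators in
        \<open>v_plus\<close>.\<close>
      have strict: "d l * d p < d 1 * d m" if "1 \<le> m" "m < l" "l \<le> p" for l m
      proof -
        have lm: "l \<in> {1..p}" "m \<in> {1..p}" using that by auto
        show ?thesis
        proof (cases "d l = d 1")
          case True
          then have "d m = d 1" using d_le_d1[OF lm(2)] d_mono[of m l] that by simp
          then show ?thesis using True d1p d1_pos by simp
        next
          case False
          then have "d l * d p < d 1 * d p" using d_le_d1[OF lm(1)] dp_pos by simp
          also have "\<dots> \<le> d 1 * d m" using dp_le_d[OF lm(2)] d1_pos by simp
          finally show ?thesis .
        qed
      qed
      have den: "c m * (d l * d p) < c l * (d 1 * d m)" if "1 \<le> m" "m < l" "l \<le> p" for l m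
      proof -
        have lm: "l \<in> {1..p}" "m \<in> {1..p}" using that by auto
        have "c m * (d l * d p) \<le> c l * (d l * d p)"
          using c(2)[of m l] that d_pos[OF lm(1)] dp_pos by (intro mult_right_mono) auto
        also have "\<dots> < c l * (d 1 * d m)"
          using strict[OF that] c(3)[OF lm(1)] by (intro mult_strict_left_mono) auto
        finally show ?thesis .
      qed
      have X: "finite X" "X \<noteq> {}"
      proof -
        show "finite X" by (rule finite_subset[of _ "{1..p} \<times> {1..p}"]) (auto simp: X_def)
        have "(2, 1) \<in> X" using p3 by (simp add: X_def)
        then show "X \<noteq> {}" by blast
      qed
      have v: "v_plus p d c = Min (q ` X)" by (simp add: v_plus_def q_def X_def)
      have "q x > 0" if "x \<in> X" for x
        using that strict den c(3) unfolding X_def q_def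
        by (auto intro!: divide_pos_pos mult_pos_pos simp: mult.assoc less_le_trans[OF zero_less_one])
      then have "v_plus p d c > 0" unfolding v using X by (subst Min_gr_iff) auto
      then have "?t \<le> v_plus p d c"
        using ci by (intro h_SB_le \<alpha> \<gamma> w) (auto simp: condition_i_def)
      also have "\<dots> \<le> q (i, k)" unfolding v using X ki by (intro Min_le) (auto simp: X_def)
      finally have "?t \<le> c i * c k * (d 1 * d k - d i * d p) / (c i * (d 1 * d k) - c k * (d i * d p))"
        by (simp add: q_def mult.assoc)
      then show ?thesis
        using den[OF ki] c(3)[OF i] c(3)[OF k] by (intro shrunk_pair_le) auto
    qed
  qed
qed

text \<open>The exponent in c_i is chosen so that the weight a_i becomes a_1 times (d_i /
  d_1)^\<eta>. The largest weight is then a_1, and the general bound on \<alpha> is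
  \<open>u_plus\<close>.\<close>

lemma condition_i_ratio:
  assumes ci: "condition_i p n d j c \<alpha> \<gamma> \<eta>" and i: "i \<in> {1..p}"
  shows "d i powr (1 - j) / c i = d 1 powr (1 - j) * (d i / d 1) powr \<eta>"
proof -
  have "c i = (d 1 / d i) powr (j - 1 + \<eta>)" using assms by (simp add: condition_i_def)
  then have c: "c i = exp ((j - 1 + \<eta>) * (ln (d 1) - ln (d i)))"
    using d_pos[OF i] d1_pos by (simp add: powr_def ln_div)
  have "d i powr (1 - j) / c i = exp ((1 - j) * ln (d i) - (j - 1 + \<eta>) * (ln (d 1) - ln (d i)))"
    unfolding c using d_pos[OF i] by (simp add: powr_def exp_diff)
  also have "\<dots> = exp ((1 - j) * ln (d 1) + \<eta> * (ln (d i) - ln (d 1)))"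
    by (simp add: algebra_simps)
  also have "\<dots> = d 1 powr (1 - j) * (d i / d 1) powr \<eta>"
    using d_pos[OF i] d1_pos by (simp add: powr_def exp_add ln_div)
  finally show ?thesis .
qed

text \<open>The order of the c_i is opposite to that under (i): they decrease to 1 on {1..p-1}, and
  only c_p stands above them all.\<close>

lemma condition_ii_facts:
  assumes cii: "condition_ii p n d j c \<alpha> \<gamma> \<nu>" and \<alpha>: "\<alpha> > 0"
  shows "j < 1" "0 \<le> \<nu>" "\<nu> < 1 - j" "c (p - 1) = 1"
    "\<And>i k. 1 \<le> i \<Longrightarrow> i \<le> k \<Longrightarrow> k \<le> p - 1 \<Longrightarrow> c k \<le> c i" "c 1 < c p" "\<And>i. i \<in> {1..p} \<Longrightarrow> c i \<ge> 1"
proof -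
  have p: "{1..p} = insert p {1..p-1}" using p3 by auto
  have split: "(\<Sum>i=1..p. g i) = (\<Sum>i=1..p-1. g i) + g p" for g :: "nat \<Rightarrow> real"
    unfolding p by (subst sum.insert) (use p3 in auto)
  have sum_le: "(\<Sum>i=1..p. (d i / d 1) powr (1 - j)) \<le> 2" using cii by (simp add: condition_ii_def)
  show j: "j < 1"
  proof (rule ccontr)
    \<comment> \<open>With a nonpositive exponent every term is at least 1, so the sum is at least p
      \<ge> 3 instead of at most 2.\<close>
    assume "\<not> j < 1"
    then have "(d i / d 1) powr (1 - j) \<ge> 1" if "i \<in> {1..p}" for i
      using powr_mono'[of "1 - j" 0 "d i / d 1"] d_pos[OF that] d1_pos d_le_d1[OF that] by simp
    then have "(\<Sum>i=1..p. (1 :: real)) \<le> (\<Sum>i=1..p. (d i / d 1) powr (1 - j))" by (rule sum_mono)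
    then show False using sum_le p3 by simp
  qed
  show \<nu>: "0 \<le> \<nu>" using cii by (auto simp: condition_ii_def split: if_splits)
  show c1p: "c 1 < c p" using cii by (simp add: condition_ii_def)
  have c: "c i = (d i / d (p - 1)) powr (1 - j - \<nu>)" if "i \<in> {1..p-1}" for i
    using cii that by (simp add: condition_ii_def)
  have dq: "d (p - 1) > 0" using d_pos[of "p - 1"] p3 by simp
  show cq: "c (p - 1) = 1" using c[of "p - 1"] p3 dq by simp
  have c1: "c 1 > 0" using c[of 1] p3 dq d1_pos by simp
  show \<nu>j: "\<nu> < 1 - j"
  proof (rule ccontr)
    \<comment> \<open>A larger exponent lowers powers of ratios in (0, 1], and c_1 < c_p, so the
      bracket in \<open>u_minus\<close> would be at most the sum in (ii) minus 2, hence not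
      positive, against \<alpha> > 0.\<close>
    assume *: "\<not> \<nu> < 1 - j"
    have "0 < u_minus p n d j c \<nu>" using cii \<alpha> by (simp add: condition_ii_def)
    then have "2 < (\<Sum>i=1..p-1. (d i / d 1) powr \<nu>) + c 1 / c p * (d p / d 1) powr (1 - j)"
      by (simp add: u_minus_def zero_less_mult_iff zero_less_divide_iff)
    also have "\<dots> \<le> (\<Sum>i=1..p-1. (d i / d 1) powr (1 - j)) + 1 * (d p / d 1) powr (1 - j)"
    proof (intro add_mono sum_mono mult_right_mono)
      show "(d i / d 1) powr \<nu> \<le> (d i / d 1) powr (1 - j)" if "i \<in> {1..p-1}" for i
      proof -
        have "i \<in> {1..p}" using that by auto
        then show ?thesis
          using * d_pos[of i] d1_pos d_le_d1[of i] by (intro powr_mono') (auto simp: less_imp_le)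
      qed
      show "c 1 / c p \<le> 1" using c1 c1p by simp
    qed simp
    also have "\<dots> \<le> 2" using sum_le unfolding split by simp
    finally show False by simp
  qed
  show mono: "c k \<le> c i" if "1 \<le> i" "i \<le> k" "k \<le> p - 1" for i k
  proof -
    have "d k / d (p - 1) \<le> d i / d (p - 1)" using d_mono[of i k] that dq by (intro divide_right_mono) auto
    moreover have "d k > 0" using d_pos[of k] that by simp
    ultimately show ?thesis using c[of i] c[of k] that \<nu>j dq by (auto intro!: powr_mono2)
  qed
  show "c i \<ge> 1" if "i \<in> {1..p}" for i
  proof (cases "i = p")
    case True
    have "1 \<le> p - 1" using p3 by simp
    then show ?thesis using mono[of 1 "p - 1"] cq c1p True by simp
  next
    case False
    then have "1 \<le> i" "i \<le> p - 1" using that by auto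
    then show ?thesis using mono[of i "p - 1"] cq by simp
  qed
qed

text \<open>Monotonicity leaves two critical pairs. For k = p the inequality is immediate, since c_i
  \<le> c_p and d_i \<le> d_1. For k < p the right side is smallest at k = p - 1, and the left side
  over i < p is largest at i = 1. There remain (i, k) = (1, p - 1) and (p, p - 1), the two entries
  of \<open>v_minus\<close>.\<close>

lemma condition_ii_pair:
  assumes cii: "condition_ii p n d j c \<alpha> \<gamma> \<nu>" and \<alpha>: "\<alpha> > 0" and \<gamma>: "\<gamma> > 0" and w: "w > 0"
    and pos: "\<And>i. i \<in> {1..p} \<Longrightarrow> 1 - h_SB \<alpha> \<gamma> w / c i > 0" and i: "i \<in> {1..p}" and k: "k \<in> {1..p}"
  shows "d i * d p * (1 - h_SB \<alpha> \<gamma> w / c i) \<le> d 1 * d k * (1 - h_SB \<alpha> \<gamma> w / c k)"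
proof -
  let ?t = "h_SB \<alpha> \<gamma> w"
  define r where "r = p - 1"
  have r: "1 \<in> {1..p}" "r \<in> {1..p}" "p \<in> {1..p}" "1 \<le> r" "r \<le> p" using p3 by (auto simp: r_def)
  note c = condition_ii_facts[OF cii \<alpha>, folded r_def]
  note t = h_SB_nonneg[OF \<alpha> \<gamma> w]
  have dr: "d p \<le> d r" "0 < d r" "d r \<le> d 1" using dp_le_d d_pos d_le_d1 r by auto
  have v: "v_minus p d c > 0" "?t \<le> v_minus p d c"
    using cii \<alpha> \<gamma> w by (auto simp: condition_ii_def intro!: h_SB_le)
  have v1: "0 < c 1 * c r * (d r - d p) / (c 1 * d r - c r * d p)" "?t \<le> c 1 * c r * (d r - d p) / (c 1 * d r - c r * d p)"
    and v2: "0 < c r * c p * (d 1 * d r - (d p)\<^sup>2) / (c p * d 1 * d r - c r * (d p)\<^sup>2)"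
      "?t \<le> c r * c p * (d 1 * d r - (d p)\<^sup>2) / (c p * d 1 * d r - c r * (d p)\<^sup>2)"
    using v by (simp_all add: v_minus_def r_def)
  have cr: "c r \<le> c 1" "c r \<le> c p" "0 < c r" using c(5)[of 1 r] c(4,6) r by auto
  have first: "d p * (1 - ?t / c 1) \<le> d r * (1 - ?t / c r)"
  proof (rule shrunk_pair_le)
    have "c r * d p \<le> c 1 * d r" using cr dr dp_pos by (intro mult_mono) auto
    \<comment> \<open>Division by 0 gives 0, so positivity of the quotient excludes a zero
      denominator.\<close>
    moreover have "c 1 * d r - c r * d p \<noteq> 0" using v1(1) by auto
    ultimately show "c 1 * d r - c r * d p > 0" by simp
  qed (use cr v1 in auto)
  have second: "(d p)\<^sup>2 * (1 - ?t / c p) \<le> d 1 * d r * (1 - ?t / c r)"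
  proof (rule shrunk_pair_le)
    have "c r * (d p)\<^sup>2 \<le> c p * (d 1 * d r)"
      unfolding power2_eq_square using cr dr dp_pos by (intro mult_mono) auto
    moreover have "c p * (d 1 * d r) - c r * (d p)\<^sup>2 \<noteq> 0" using v2(1) by (auto simp: mult.assoc)
    ultimately show "c p * (d 1 * d r) - c r * (d p)\<^sup>2 > 0" by simp
  qed (use cr v2 in \<open>auto simp: mult_ac\<close>)
  have anti: "1 - ?t / c l \<le> 1 - ?t / c m" if "c l \<le> c m" "l \<in> {1..p}" "m \<in> {1..p}" for l m
    using that c(7)[of l] c(7)[of m] t by (auto intro!: divide_left_mono)
  have lower: "d 1 * d r * (1 - ?t / c r) \<le> d 1 * d k * (1 - ?t / c k)" if "k \<noteq> p"
  proof -
    have "k \<le> r" using that k by (auto simp: r_def)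
    then show ?thesis
      using d_mono[of k r] k r c(5)[of k r] anti[of r k] pos[OF r(2)] d1_pos dr
      by (intro mult_mono) auto
  qed
  have upper: "d i * d p * (1 - ?t / c i) \<le> d 1 * d p * (1 - ?t / c 1)" if "i \<noteq> p"
  proof -
    have "i \<le> r" using that i by (auto simp: r_def)
    then show ?thesis
      using d_le_d1[OF i] i r c(5)[of 1 i] anti[of i 1] pos[OF i] d1_pos dp_pos d_pos[OF i]
      by (intro mult_mono) auto
  qed
  consider "k = p" | "k \<noteq> p" "i = p" | "k \<noteq> p" "i \<noteq> p" by blast
  then show ?thesis
  proof cases
    case 1
    have "c i \<le> c p"
    proof (cases "i = p")
      case False
      then have "1 \<le> i" "i \<le> r" using i by (auto simp: r_def)
      then have "c i \<le> c 1" using c(5)[of 1 i] by simp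
      then show ?thesis using c(6) by simp
    qed simp
    then show ?thesis
      using anti[of i p] i r d_le_d1[OF i] pos[OF i] d1_pos dp_pos unfolding 1 by (intro mult_mono) auto
  next
    case 2
    then show ?thesis using second lower by (simp add: power2_eq_square)
  next
    case 3
    have "d 1 * d p * (1 - ?t / c 1) \<le> d 1 * d r * (1 - ?t / c r)"
      using mult_left_mono[OF first, of "d 1"] d1_pos by (simp add: mult.assoc)
    then show ?thesis using upper[OF 3(2)] lower[OF 3(1)] by linarith
  qed
qed

text \<open>For i < p the weight a_i is d_i^\<nu> times a power of d_{p-1} that does not depend on
  i; comparison with i = 1 gives the ratio. The index p is left out because c_p follows no power
  law.\<close>

lemma condition_ii_ratio:
  assumes cii: "condition_ii p n d j c \<alpha> \<gamma> \<nu>" and \<alpha>: "\<alpha> > 0" and i: "i \<in> {1..p-1}"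
  shows "d i powr (1 - j) / c i = d 1 powr (1 - j) / c 1 * (d i / d 1) powr \<nu>"
proof -
  have i': "i \<in> {1..p}" using i by auto
  have dq: "d (p - 1) > 0" using d_pos[of "p - 1"] p3 by simp
  have eq: "d l powr (1 - j) / c l = exp (\<nu> * ln (d l) + (1 - j - \<nu>) * ln (d (p - 1)))" if "l \<in> {1..p-1}" for l
  proof -
    have dl: "d l > 0" using d_pos[of l] that by auto
    have "c l = (d l / d (p - 1)) powr (1 - j - \<nu>)" using cii that by (simp add: condition_ii_def)
    also have "\<dots> = exp ((1 - j - \<nu>) * (ln (d l) - ln (d (p - 1))))"
      using dl dq by (simp add: powr_def ln_div)
    finally have "d l powr (1 - j) / c l = exp ((1 - j) * ln (d l) - (1 - j - \<nu>) * (ln (d l) - ln (d (p - 1))))"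
      using dl by (simp add: powr_def exp_diff)
    then show ?thesis by (simp add: algebra_simps)
  qed
  have 1: "1 \<in> {1..p-1}" using p3 by auto
  have "(d i / d 1) powr \<nu> = exp (\<nu> * (ln (d i) - ln (d 1)))"
    using d_pos[OF i'] d1_pos by (simp add: powr_def ln_div)
  then show ?thesis
    unfolding eq[OF i] eq[OF 1] by (simp add: algebra_simps flip: exp_add)
qed

end

section \<open>Gaussian mixtures\<close>

text \<open>Completing the square in t splits the joint density of observation and mean into the
  marginal density of x and the posterior density of t; u and v are the variances.\<close>

lemma normal_density_conjugate:
  fixes u v x t :: real
  assumes u: "u > 0" and v: "v > 0"
  shows "normal_density t (sqrt u) x * normal_density 0 (sqrt v) t =
    normal_density 0 (sqrt (u + v)) x * normal_density (x * v / (u + v)) (sqrt (u * v / (u + v))) t"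
proof -
  have uv: "u + v > 0" "u * v / (u + v) > 0" using u v by (auto simp: add_pos_pos)
  have e: "- (x - t)\<^sup>2 / (2 * u) + - (t - 0)\<^sup>2 / (2 * v) =
      - (x - 0)\<^sup>2 / (2 * (u + v)) + - (t - x * v / (u + v))\<^sup>2 / (2 * (u * v / (u + v)))"
  proof -
    have "(t - x * v / w)\<^sup>2 / (2 * (u * v / w)) = (w * t - x * v)\<^sup>2 / (2 * u * v * w)" if "w > 0" for w
      using that u v by (simp add: power2_eq_square field_simps)
    note 1 = this[OF uv(1)]
    have "u * v * x\<^sup>2 + ((u + v) * t - x * v)\<^sup>2 = (u + v) * (v * (x - t)\<^sup>2 + u * t\<^sup>2)"
      by (simp add: power2_eq_square algebra_simps)
    then have "(u * v * x\<^sup>2 + ((u + v) * t - x * v)\<^sup>2) / (2 * u * v * (u + v)) = (v * (x - t)\<^sup>2 + u * t\<^sup>2) / (2 * u * v)"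
      using uv by simp
    moreover have "(u * v * x\<^sup>2 + y) / (2 * u * v * w) = x\<^sup>2 / (2 * w) + y / (2 * u * v * w)" if "w > 0" for y w
      using that u v by (simp add: field_simps)
    moreover have "(v * (x - t)\<^sup>2 + u * t\<^sup>2) / (2 * u * v) = (x - t)\<^sup>2 / (2 * u) + t\<^sup>2 / (2 * v)"
      using u v by (simp add: field_simps)
    ultimately show ?thesis using 1 uv(1) by simp
  qed
  have s: "sqrt (2 * pi * u) * sqrt (2 * pi * v) = sqrt (2 * pi * (u + v)) * sqrt (2 * pi * (u * v / (u + v)))"
    using uv by (simp add: real_sqrt_mult[symmetric])
  have "normal_density t (sqrt u) x * normal_density 0 (sqrt v) t =
      1 / (sqrt (2 * pi * u) * sqrt (2 * pi * v)) * exp (- (x - t)\<^sup>2 / (2 * u) + - (t - 0)\<^sup>2 / (2 * v))"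
    unfolding exp_add using u v by (simp add: normal_density_def)
  also have "\<dots> = normal_density 0 (sqrt (u + v)) x * normal_density (x * v / (u + v)) (sqrt (u * v / (u + v))) t"
    unfolding e s exp_add using uv u v by (simp add: normal_density_def)
  finally show ?thesis .
qed

text \<open>A crude quadratic majorant of |t| suffices for domination. It is applied to variances of
  order 1 / \<eta>, so multiplication by \<eta> keeps the variance term bounded.\<close>

lemma integral_abs_normal_le:
  assumes "\<sigma> > 0"
  shows "(\<integral>t. \<bar>t\<bar> * normal_density \<mu> \<sigma> t \<partial>lborel) \<le> 1 + 2 * \<mu>\<^sup>2 + 2 * \<sigma>\<^sup>2"
proof -
  have v: "has_bochner_integral lborel (\<lambda>t. normal_density \<mu> \<sigma> t * (t - \<mu>)\<^sup>2) (\<sigma>\<^sup>2)"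
    using normal_moment_even[OF assms, of \<mu> 1] by simp
  have o: "has_bochner_integral lborel (normal_density \<mu> \<sigma>) 1"
    using assms by (simp add: has_bochner_integral_iff integral_normal_density integrable_normal_density)
  have "has_bochner_integral lborel (\<lambda>t. (1 + 2 * \<mu>\<^sup>2) * normal_density \<mu> \<sigma> t + 2 * (normal_density \<mu> \<sigma> t * (t - \<mu>)\<^sup>2))
      ((1 + 2 * \<mu>\<^sup>2) * 1 + 2 * \<sigma>\<^sup>2)"
    by (intro has_bochner_integral_add has_bochner_integral_mult_right v o)
  then have i: "integrable lborel (\<lambda>t. (1 + 2 * \<mu>\<^sup>2) * normal_density \<mu> \<sigma> t + 2 * (normal_density \<mu> \<sigma> t * (t - \<mu>)\<^sup>2))"
    and val: "(\<integral>t. (1 + 2 * \<mu>\<^sup>2) * normal_density \<mu> \<sigma> t + 2 * (normal_density \<mu> \<sigma> t * (t - \<mu>)\<^sup>2) \<partial>lborel) = 1 + 2 * \<mu>\<^sup>2 + 2 * \<sigma>\<^sup>2"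
    by (simp_all add: has_bochner_integral_iff)
  have "(\<integral>t. \<bar>t\<bar> * normal_density \<mu> \<sigma> t \<partial>lborel) \<le>
      (\<integral>t. (1 + 2 * \<mu>\<^sup>2) * normal_density \<mu> \<sigma> t + 2 * (normal_density \<mu> \<sigma> t * (t - \<mu>)\<^sup>2) \<partial>lborel)"
  proof (rule integral_mono'[OF i])
    fix t
    have "\<bar>t\<bar> \<le> 1 + 2 * \<mu>\<^sup>2 + 2 * (t - \<mu>)\<^sup>2"
    proof -
      have "2 * \<bar>t\<bar> \<le> 1 + t\<^sup>2" using sum_squares_bound[of 1 "\<bar>t\<bar>"] by simp
      moreover have "t\<^sup>2 + (t - 2 * \<mu>)\<^sup>2 = 2 * \<mu>\<^sup>2 + 2 * (t - \<mu>)\<^sup>2" by (simp add: power2_eq_square algebra_simps)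
      moreover have "0 \<le> (t - 2 * \<mu>)\<^sup>2" "0 \<le> \<bar>t\<bar>" by simp_all
      ultimately show ?thesis by linarith
    qed
    then have "\<bar>t\<bar> * normal_density \<mu> \<sigma> t \<le> (1 + 2 * \<mu>\<^sup>2 + 2 * (t - \<mu>)\<^sup>2) * normal_density \<mu> \<sigma> t"
      by (rule mult_right_mono) simp
    then show "\<bar>t\<bar> * normal_density \<mu> \<sigma> t \<le> (1 + 2 * \<mu>\<^sup>2) * normal_density \<mu> \<sigma> t + 2 * (normal_density \<mu> \<sigma> t * (t - \<mu>)\<^sup>2)"
      by (simp add: algebra_simps)
  qed simp
  then show ?thesis unfolding val .
qed

text \<open>Given y the coordinates of \<theta> are independent normal, so integrating them out
  leaves the conditional expectation \<open>E\<close> of \<phi>(\<theta>_i). \<open>A\<close>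
  majorizes the conditional absolute expectation and carries the integrability over y. The
  conditions hold only where \<kappa> is nonzero because the formulas for the standard deviations
  need not be positive elsewhere.\<close>

lemma gaussian_mixture:
  fixes \<kappa> g A E :: "'b \<Rightarrow> real" and m \<tau> :: "'i \<Rightarrow> 'b \<Rightarrow> real" and \<phi> :: "real \<Rightarrow> real"
  assumes I: "finite I" "i \<in> I" and M: "sigma_finite_measure M"
    and [measurable]: "\<kappa> \<in> borel_measurable M" "g \<in> borel_measurable M" "\<phi> \<in> borel_measurable borel"
      "\<And>i. i \<in> I \<Longrightarrow> m i \<in> borel_measurable M" "\<And>i. i \<in> I \<Longrightarrow> \<tau> i \<in> borel_measurable M"
    and \<tau>: "\<And>i y. i \<in> I \<Longrightarrow> \<kappa> y \<noteq> 0 \<Longrightarrow> \<tau> i y > 0"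
    and \<phi>: "\<And>y. \<kappa> y \<noteq> 0 \<Longrightarrow> has_bochner_integral lborel (\<lambda>t. \<phi> t * normal_density (m i y) (\<tau> i y) t) (E y)"
      "\<And>y. \<kappa> y \<noteq> 0 \<Longrightarrow> (\<integral>t. \<bar>\<phi> t\<bar> * normal_density (m i y) (\<tau> i y) t \<partial>lborel) \<le> A y"
    and int: "integrable M (\<lambda>y. g y * \<kappa> y * A y)"
  defines "k \<equiv> \<lambda>(\<theta>, y). g y * \<phi> (\<theta> i) * (\<kappa> y * (\<Prod>l\<in>I. normal_density (m l y) (\<tau> l y) (\<theta> l)))"
  shows "integrable (lborel_PiM I \<Otimes>\<^sub>M M) k"
    and "(\<integral>v. k v \<partial>(lborel_PiM I \<Otimes>\<^sub>M M)) = (\<integral>y. g y * E y * \<kappa> y \<partial>M)"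
proof -
  let ?P = "lborel_PiM I :: ('i \<Rightarrow> real) measure"
  interpret P: sigma_finite_measure ?P by (rule lebesgue_product.sigma_finite) fact
  interpret M: sigma_finite_measure M by fact
  interpret pair_sigma_finite ?P M ..
  define h where "h = (\<lambda>y l t. (if l = i then \<phi> t else 1) * normal_density (m l y) (\<tau> l y) t)"
  have k_eq: "k (\<theta>, y) = g y * \<kappa> y * (\<Prod>l\<in>I. h y l (\<theta> l))" for \<theta> y
    using I by (simp add: k_def h_def prod.distrib prod.delta mult_ac)
  have coord: "(\<lambda>v. fst v l) \<in> borel_measurable (?P \<Otimes>\<^sub>M M)" if "l \<in> I" for l
    using measurable_compose[OF measurable_fst measurable_component_singleton[OF that, of "\<lambda>_. lborel"]] by simp
  have k [measurable]: "k \<in> borel_measurable (?P \<Otimes>\<^sub>M M)"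
  proof -
    have "(\<lambda>v. normal_density (m l (snd v)) (\<tau> l (snd v)) (fst v l)) \<in> borel_measurable (?P \<Otimes>\<^sub>M M)" if l: "l \<in> I" for l
    proof -
      note [measurable] = coord[OF l] assms(7)[OF l] assms(8)[OF l]
      show ?thesis unfolding normal_density_def by measurable
    qed
    moreover note [measurable] = coord[OF I(2)]
    ultimately show ?thesis unfolding k_def case_prod_unfold by measurable
  qed
  have h_abs: "(\<integral>\<^sup>+t. ennreal \<bar>h y l t\<bar> \<partial>lborel) \<le> (if l = i then ennreal (A y) else 1)"
    and h_int: "integrable lborel (h y l)" "(\<integral>t. h y l t \<partial>lborel) = (if l = i then E y else 1)"
    if y: "\<kappa> y \<noteq> 0" and l: "l \<in> I" for y l
  proof -
    show "integrable lborel (h y l)" "(\<integral>t. h y l t \<partial>lborel) = (if l = i then E y else 1)"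
      using \<phi>(1)[OF y] \<tau>[OF l y]
      by (cases "l = i"; simp add: h_def has_bochner_integral_iff integral_normal_density integrable_normal_density)+
    show "(\<integral>\<^sup>+t. ennreal \<bar>h y l t\<bar> \<partial>lborel) \<le> (if l = i then ennreal (A y) else 1)"
    proof (cases "l = i")
      case True
      have "(\<integral>\<^sup>+t. ennreal \<bar>h y i t\<bar> \<partial>lborel) = ennreal (\<integral>t. \<bar>h y i t\<bar> \<partial>lborel)"
        using \<phi>(1)[OF y] by (intro nn_integral_eq_integral) (auto simp: h_def has_bochner_integral_iff)
      also have "\<dots> \<le> ennreal (A y)"
        using \<phi>(2)[OF y] by (intro ennreal_leI) (simp add: h_def abs_mult)
      finally show ?thesis using True by simp
    next
      case False
      then show ?thesis
        using \<tau>[OF l y] by (simp add: h_def nn_integral_eq_integral integral_normal_density integrable_normal_density)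
    qed
  qed
  have h_meas: "h y l \<in> borel_measurable borel" for y l
    unfolding h_def by measurable
  show kint: "integrable (?P \<Otimes>\<^sub>M M) k"
  proof (rule integrableI_bounded)
    have "(\<integral>\<^sup>+v. ennreal (norm (k v)) \<partial>(?P \<Otimes>\<^sub>M M)) = (\<integral>\<^sup>+y. (\<integral>\<^sup>+\<theta>. ennreal (norm (k (\<theta>, y))) \<partial>?P) \<partial>M)"
      by (rule nn_integral_snd[symmetric]) measurable
    also have "\<dots> \<le> (\<integral>\<^sup>+y. ennreal (norm (g y * \<kappa> y * A y)) \<partial>M)"
    proof (rule nn_integral_mono)
      fix y
      show "(\<integral>\<^sup>+\<theta>. ennreal (norm (k (\<theta>, y))) \<partial>?P) \<le> ennreal (norm (g y * \<kappa> y * A y))"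
      proof (cases "\<kappa> y = 0")
        case True
        then show ?thesis by (simp add: k_eq)
      next
        case y: False
        have "(\<integral>\<^sup>+\<theta>. ennreal (norm (k (\<theta>, y))) \<partial>?P) =
            (\<integral>\<^sup>+\<theta>. ennreal \<bar>g y * \<kappa> y\<bar> * (\<Prod>l\<in>I. ennreal \<bar>h y l (\<theta> l)\<bar>) \<partial>?P)"
          by (intro nn_integral_cong) (simp add: k_eq abs_mult abs_prod prod_ennreal ennreal_mult prod_nonneg)
        also have "\<dots> = ennreal \<bar>g y * \<kappa> y\<bar> * (\<integral>\<^sup>+\<theta>. (\<Prod>l\<in>I. ennreal \<bar>h y l (\<theta> l)\<bar>) \<partial>?P)"
        proof (rule nn_integral_cmult)
          have "(\<lambda>\<theta>. ennreal \<bar>h y l (\<theta> l)\<bar>) \<in> borel_measurable ?P" if "l \<in> I" for l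
            using measurable_compose[OF measurable_component_singleton[OF that, of "\<lambda>_. lborel"], of "h y l" borel] h_meas by simp
          then show "(\<lambda>\<theta>. \<Prod>l\<in>I. ennreal \<bar>h y l (\<theta> l)\<bar>) \<in> borel_measurable ?P"
            by (rule borel_measurable_prod_ennreal)
        qed
        also have "(\<integral>\<^sup>+\<theta>. (\<Prod>l\<in>I. ennreal \<bar>h y l (\<theta> l)\<bar>) \<partial>?P) = (\<Prod>l\<in>I. \<integral>\<^sup>+t. ennreal \<bar>h y l t\<bar> \<partial>lborel)"
          by (rule lebesgue_product.product_nn_integral_prod[OF I(1)]) (use h_meas in auto)
        also have "\<dots> \<le> (\<Prod>l\<in>I. if l = i then ennreal (A y) else 1)"
          by (intro prod_mono_ennreal h_abs[OF y])
        also have "\<dots> = ennreal (A y)" using I by (simp add: prod.delta)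
        also have "ennreal \<bar>g y * \<kappa> y\<bar> * ennreal (A y) \<le> ennreal (norm (g y * \<kappa> y * A y))"
          by (subst ennreal_mult'[symmetric]) (auto intro!: ennreal_leI simp: abs_mult mult_left_mono)
        finally show ?thesis by (simp add: mult_left_mono)
      qed
    qed
    also have "\<dots> < \<infinity>" using int by (simp add: integrable_iff_bounded)
    finally show "(\<integral>\<^sup>+v. ennreal (norm (k v)) \<partial>(?P \<Otimes>\<^sub>M M)) < \<infinity>" .
  qed measurable
  have "(\<integral>v. k v \<partial>(?P \<Otimes>\<^sub>M M)) = (\<integral>y. (\<integral>\<theta>. k (\<theta>, y) \<partial>?P) \<partial>M)"
    using integral_snd[of "\<lambda>\<theta> y. k (\<theta>, y)"] kint by simp
  also have "\<dots> = (\<integral>y. g y * E y * \<kappa> y \<partial>M)"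
  proof (intro Bochner_Integration.integral_cong refl)
    fix y
    show "(\<integral>\<theta>. k (\<theta>, y) \<partial>?P) = g y * E y * \<kappa> y"
    proof (cases "\<kappa> y = 0")
      case y: False
      have "(\<integral>\<theta>. (\<Prod>l\<in>I. h y l (\<theta> l)) \<partial>?P) = (\<Prod>l\<in>I. \<integral>t. h y l t \<partial>lborel)"
        by (rule lebesgue_product.product_integral_prod[OF I(1)]) (use h_int(1)[OF y] in auto)
      also have "\<dots> = E y" using h_int(2)[OF y] I by (simp add: prod.delta cong: prod.cong)
      finally show ?thesis by (simp add: k_eq)
    qed (simp add: k_eq)
  qed
  finally show "(\<integral>v. k v \<partial>(?P \<Otimes>\<^sub>M M)) = (\<integral>y. g y * E y * \<kappa> y \<partial>M)" .
qed

section \<open>Elementary integrals over \<lambda> and \<eta>\<close>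

lemma nn_integral_gamma_scaled:
  assumes "a > 0" "\<beta> > 0"
  shows "(\<integral>\<^sup>+t. ennreal (indicator {0<..} t * t powr (a - 1) * exp (- \<beta> * t)) \<partial>lborel) =
    ennreal (Gamma a / \<beta> powr a)" (is "?I = _")
proof -
  have "ennreal (Gamma a) = (\<integral>\<^sup>+t. ennreal (indicator {0..} t * t powr (a - 1) / exp t) \<partial>lborel)"
    using Gamma_conv_nn_integral_real[OF assms(1)] .
  also have "\<dots> = ennreal \<bar>\<beta>\<bar> * (\<integral>\<^sup>+t. ennreal (indicator {0..} (0 + \<beta> * t) * (0 + \<beta> * t) powr (a - 1) / exp (0 + \<beta> * t)) \<partial>lborel)"
    using assms by (intro nn_integral_real_affine) auto
  also have "\<dots> = ennreal \<beta> * (\<integral>\<^sup>+t. ennreal (\<beta> powr (a - 1)) *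
      ennreal (indicator {0<..} t * t powr (a - 1) * exp (- \<beta> * t)) \<partial>lborel)"
    using assms
    by (intro arg_cong2[of _ _ _ _ "(*)"] nn_integral_cong)
       (auto simp: indicator_def zero_le_mult_iff powr_mult exp_minus field_simps simp flip: ennreal_mult)
  also have "\<dots> = ennreal (\<beta> powr a) * ?I"
    using assms by (subst nn_integral_cmult) (auto simp: powr_mult_base simp flip: ennreal_mult mult.assoc)
  finally have *: "ennreal (Gamma a) = ennreal (\<beta> powr a) * ?I" .
  have "?I = ennreal (1 / \<beta> powr a) * (ennreal (\<beta> powr a) * ?I)"
    using assms by (simp add: mult.assoc[symmetric] flip: ennreal_mult)
  also have "\<dots> = ennreal (Gamma a / \<beta> powr a)"
    unfolding *[symmetric] using assms Gamma_real_pos[of a] by (simp flip: ennreal_mult)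
  finally show ?thesis .
qed

text \<open>An antiderivative is a multiple of a power of l / (l N + s), since this quotient has
  derivative s / (l N + s)^2; this is why the denominator has exponent \<beta> + 1. For \<beta> < 1
  the integrand is unbounded at 0, so the improper form of the fundamental theorem with one-sided
  limits is used.\<close>

lemma has_integral_rational_powr:
  fixes N s L \<beta> :: real
  assumes N: "N \<ge> 0" and s: "s > 0" and L: "L > 0" and \<beta>: "\<beta> > 0"
  shows "has_bochner_integral lborel (\<lambda>l. indicator {0<..<L} l * (l powr (\<beta> - 1) / (l * N + s) powr (\<beta> + 1)))
    ((L / (L * N + s)) powr \<beta> / (\<beta> * s))"
proof -
  define F where "F = (\<lambda>l. (l / (l * N + s)) powr \<beta> / (\<beta> * s))"
  define f where "f = (\<lambda>l. l powr (\<beta> - 1) / (l * N + s) powr (\<beta> + 1))"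
  have pos: "l * N + s > 0" if "l \<ge> 0" for l using that N s by (simp add: add_nonneg_pos)
  have deriv: "(F has_real_derivative f l) (at l)" if "l > 0" for l
  proof -
    have p: "l * N + s > 0" using pos that by simp
    have 1: "((\<lambda>l. l / (l * N + s)) has_real_derivative s / (l * N + s)\<^sup>2) (at l)"
      using p by (auto intro!: derivative_eq_intros simp: power2_eq_square field_simps)
    have "((\<lambda>l. (l / (l * N + s)) powr \<beta>) has_real_derivative \<beta> * (l / (l * N + s)) powr (\<beta> - 1) * (s / (l * N + s)\<^sup>2)) (at l)"
      using DERIV_fun_powr[OF 1, of \<beta>] that p by simp
    from DERIV_cdivide[OF this, of "\<beta> * s"]
    have "(F has_real_derivative \<beta> * (l / (l * N + s)) powr (\<beta> - 1) * (s / (l * N + s)\<^sup>2) / (\<beta> * s)) (at l)"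
      unfolding F_def .
    moreover have "\<beta> * (l / (l * N + s)) powr (\<beta> - 1) * (s / (l * N + s)\<^sup>2) / (\<beta> * s) = f l"
    proof -
      have "(l * N + s) powr (\<beta> + 1) = (l * N + s) powr (\<beta> - 1) * (l * N + s) powr 2"
        by (simp add: powr_add[symmetric] add.commute)
      then show ?thesis using s \<beta> p that by (simp add: f_def powr_divide)
    qed
    ultimately show ?thesis by simp
  qed
  have cont: "isCont f l" if "l > 0" for l
    unfolding f_def using that pos[of l] by (intro continuous_intros) auto
  have lim0: "(F \<longlongrightarrow> 0) (at_right 0)"
  proof -
    have "((\<lambda>l. l / (l * N + s)) \<longlongrightarrow> 0 / (0 * N + s)) (at_right 0)"
      using s by (intro tendsto_intros) auto
    then have "((\<lambda>l. l / (l * N + s)) \<longlongrightarrow> 0) (at_right 0)" by simp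
    then have "((\<lambda>l. (l / (l * N + s)) powr \<beta>) \<longlongrightarrow> 0 powr \<beta>) (at_right 0)"
    proof (rule tendsto_powr')
      show "((\<lambda>_. \<beta>) \<longlongrightarrow> \<beta>) (at_right 0)" by simp
      have "\<forall>\<^sub>F l in at_right 0. 0 \<le> l / (l * N + s)"
        unfolding eventually_at_right_field using pos by (intro exI[of _ 1]) (auto intro!: divide_nonneg_pos)
      then show "0 \<noteq> 0 \<or> 0 < \<beta> \<and> (\<forall>\<^sub>F l in at_right 0. 0 \<le> l / (l * N + s))" using \<beta> by simp
    qed
    from tendsto_divide[OF this tendsto_const[of "\<beta> * s"]] show ?thesis
      using \<beta> s by (simp add: F_def)
  qed
  have limL: "(F \<longlongrightarrow> F L) (at_left L)"
    using DERIV_isCont[OF deriv[OF L]] by (auto simp: isCont_def intro: tendsto_mono[OF at_le])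
  have FTC: "set_integrable lborel (einterval (ereal 0) (ereal L)) f" "(LBINT x=ereal 0..ereal L. f x) = F L - 0"
  proof -
    have nn: "AE x in lborel. ereal 0 < ereal x \<longrightarrow> ereal x < ereal L \<longrightarrow> 0 \<le> f x"
      by (auto simp: f_def)
    show "set_integrable lborel (einterval (ereal 0) (ereal L)) f" "(LBINT x=ereal 0..ereal L. f x) = F L - 0"
      using interval_integral_FTC_nonneg[of "ereal 0" "ereal L" F f 0 "F L", OF _ _ _ nn] L deriv cont lim0 limL
      by (simp_all add: ereal_tendsto_simps)
  qed
  then show ?thesis
    using L by (simp add: has_bochner_integral_iff set_integrable_def set_lebesgue_integral_def
        interval_lebesgue_integral_def f_def F_def)
qed

section \<open>The posterior expectations\<close>

text \<open>The unnormalized posterior density of (\<lambda>, \<eta>). Two exponents are kept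
  because multiplication by \<lambda> raises only \<beta> and multiplication by \<eta> raises only
  q, so the moments needed stay in the family.\<close>

definition mixing_weight :: "real \<Rightarrow> real \<Rightarrow> real \<Rightarrow> real \<Rightarrow> real \<Rightarrow> real \<times> real \<Rightarrow> real" where
  "mixing_weight N s L \<beta> q = (\<lambda>(l, \<eta>). indicator {0<..<L} l * l powr (\<beta> - 1) *
     (indicator {0<..} \<eta> * \<eta> powr (q - 1) * exp (- ((l * N + s) / 2) * \<eta>)))"

lemma measurable_mixing_weight [measurable]:
  "mixing_weight N s L \<beta> q \<in> borel_measurable (lborel \<Otimes>\<^sub>M lborel)"
  unfolding mixing_weight_def by measurable

lemma mixing_weight_nonneg: "mixing_weight N s L \<beta> q y \<ge> 0"
  by (cases y) (simp add: mixing_weight_def)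

context
  fixes N s L :: real
  assumes N: "N \<ge> 0" and s: "s > 0" and L: "L > 0"
begin

text \<open>Integrating \<eta> first gives a gamma integral with rate (l N + s) / 2 and leaves the
  rational integral J in l.\<close>

lemma mixing_weight_integral:
  assumes q: "q > 0"
    and j: "has_bochner_integral lborel (\<lambda>l. indicator {0<..<L} l * (l powr (\<beta> - 1) / (l * N + s) powr q)) J"
  shows "has_bochner_integral (lborel \<Otimes>\<^sub>M lborel) (mixing_weight N s L \<beta> q) (Gamma q * 2 powr q * J)"
proof (rule has_bochner_integral_nn_integral)
  have J: "J \<ge> 0"
    using j by (auto simp: has_bochner_integral_iff intro!: integral_nonneg_AE)
  show "0 \<le> Gamma q * 2 powr q * J" using J Gamma_real_pos[OF q] by simp
  show "AE y in lborel \<Otimes>\<^sub>M lborel. 0 \<le> mixing_weight N s L \<beta> q y"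
    by (simp add: mixing_weight_nonneg)
  have "(\<integral>\<^sup>+y. ennreal (mixing_weight N s L \<beta> q y) \<partial>(lborel \<Otimes>\<^sub>M lborel)) =
      (\<integral>\<^sup>+l. (\<integral>\<^sup>+\<eta>. ennreal (mixing_weight N s L \<beta> q (l, \<eta>)) \<partial>lborel) \<partial>lborel)"
    by (rule lborel.nn_integral_fst[symmetric]) measurable
  also have "\<dots> = (\<integral>\<^sup>+l. ennreal (Gamma q * 2 powr q) * ennreal (indicator {0<..<L} l * (l powr (\<beta> - 1) / (l * N + s) powr q)) \<partial>lborel)"
  proof (rule nn_integral_cong)
    fix l
    show "(\<integral>\<^sup>+\<eta>. ennreal (mixing_weight N s L \<beta> q (l, \<eta>)) \<partial>lborel) =
        ennreal (Gamma q * 2 powr q) * ennreal (indicator {0<..<L} l * (l powr (\<beta> - 1) / (l * N + s) powr q))"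
    proof (cases "l \<in> {0<..<L}")
      case True
      then have B: "(l * N + s) / 2 > 0" using N s by (simp add: add_nonneg_pos)
      have "(\<integral>\<^sup>+\<eta>. ennreal (mixing_weight N s L \<beta> q (l, \<eta>)) \<partial>lborel) =
          (\<integral>\<^sup>+\<eta>. ennreal (l powr (\<beta> - 1)) *
            ennreal (indicator {0<..} \<eta> * \<eta> powr (q - 1) * exp (- ((l * N + s) / 2) * \<eta>)) \<partial>lborel)"
        using True by (intro nn_integral_cong) (simp add: mixing_weight_def flip: ennreal_mult)
      also have "\<dots> = ennreal (l powr (\<beta> - 1)) * ennreal (Gamma q / ((l * N + s) / 2) powr q)"
        by (subst nn_integral_cmult) (simp_all only: nn_integral_gamma_scaled[OF q B], measurable)
      also have "\<dots> = ennreal (Gamma q * 2 powr q) * ennreal (indicator {0<..<L} l * (l powr (\<beta> - 1) / (l * N + s) powr q))"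
        using True B Gamma_real_pos[OF q] by (simp add: powr_divide less_imp_le flip: ennreal_mult)
      finally show ?thesis .
    qed (simp add: mixing_weight_def)
  qed
  also have "\<dots> = ennreal (Gamma q * 2 powr q) * (\<integral>\<^sup>+l. ennreal (indicator {0<..<L} l * (l powr (\<beta> - 1) / (l * N + s) powr q)) \<partial>lborel)"
    by (rule nn_integral_cmult) measurable
  also have "(\<integral>\<^sup>+l. ennreal (indicator {0<..<L} l * (l powr (\<beta> - 1) / (l * N + s) powr q)) \<partial>lborel) = ennreal J"
    using j by (subst nn_integral_eq_integral) (auto simp: has_bochner_integral_iff)
  also have "ennreal (Gamma q * 2 powr q) * ennreal J = ennreal (Gamma q * 2 powr q * J)"
    using J Gamma_real_pos[OF q] by (simp flip: ennreal_mult)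
  finally show "(\<integral>\<^sup>+y. ennreal (mixing_weight N s L \<beta> q y) \<partial>(lborel \<Otimes>\<^sub>M lborel)) = ennreal (Gamma q * 2 powr q * J)" .
qed measurable

text \<open>I0, I2 and I1 are the total mass and the integrals of \<eta> and of \<lambda> \<eta>
  under the same weight. The last equation is the point: I1 / I2 is h at W = N / s with \<gamma> = 1
  / L. Both carry the same gamma factor, which cancels.\<close>

lemma mixing_weight_integrals:
  assumes \<alpha>: "\<alpha> > 0"
  obtains I0 I1 I2 where
    "has_bochner_integral (lborel \<Otimes>\<^sub>M lborel) (mixing_weight N s L \<alpha> (\<alpha> + 1)) I0" "I0 > 0"
    "has_bochner_integral (lborel \<Otimes>\<^sub>M lborel) (mixing_weight N s L \<alpha> (\<alpha> + 2)) I2" "I2 > 0"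
    "has_bochner_integral (lborel \<Otimes>\<^sub>M lborel) (mixing_weight N s L (\<alpha> + 1) (\<alpha> + 2)) I1"
    "I1 = \<alpha> / (1 / L * (\<alpha> + 1) + N / s) * I2"
proof -
  let ?f = "\<lambda>\<beta> q l. indicator {0<..<L} l * (l powr (\<beta> - 1) / (l * N + s) powr q)"
  define u where "u = L / (L * N + s)"
  have B: "L * N + s > 0" using N s L by (simp add: add_nonneg_pos)
  have u: "u > 0" using L B by (simp add: u_def)
  define J0 where "J0 = u powr \<alpha> / (\<alpha> * s)"
  define J1 where "J1 = u powr (\<alpha> + 1) / ((\<alpha> + 1) * s)"
  define J2 where "J2 = (J0 - N * J1) / s"
  have j0: "has_bochner_integral lborel (?f \<alpha> (\<alpha> + 1)) J0"
    unfolding J0_def u_def by (rule has_integral_rational_powr[OF N s L \<alpha>])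
  have j1: "has_bochner_integral lborel (?f (\<alpha> + 1) (\<alpha> + 2)) J1"
    using has_integral_rational_powr[OF N s L, of "\<alpha> + 1"] \<alpha> by (simp add: J1_def u_def add.assoc)
  have j2: "has_bochner_integral lborel (?f \<alpha> (\<alpha> + 2)) J2"
  proof -
    \<comment> \<open>The denominator exponent \<alpha> + 2 is one too large for the antiderivative.
      The partial fraction 1 / (l N + s) = (1 - l N / (l N + s)) / s reduces it to the two integrals
      already known.\<close>
    have eq: "?f \<alpha> (\<alpha> + 2) l = (?f \<alpha> (\<alpha> + 1) l - N * ?f (\<alpha> + 1) (\<alpha> + 2) l) / s" for l
    proof (cases "l \<in> {0<..<L}")
      case True
      then have l: "l > 0" "l * N + s > 0" using N s by (simp_all add: add_nonneg_pos)
      have e: "(l * N + s) powr (\<alpha> + 2) = (l * N + s) powr (\<alpha> + 1) * (l * N + s)" "l powr \<alpha> = l powr (\<alpha> - 1) * l"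
        using l powr_add[of l "\<alpha> - 1" 1] by (simp_all add: powr_add power2_eq_square)
      have "a / (b * (l * N + s)) = (a / b - N * (a * l / (b * (l * N + s)))) / s" if "b > 0" for a b
      proof -
        have "a / b - N * (a * l / (b * w)) = a * (w - l * N) / (b * w)" if "w > 0" for w
          using \<open>b > 0\<close> that by (simp add: field_simps)
        from this[OF l(2)] show ?thesis using s by simp
      qed
      from this[of "(l * N + s) powr (\<alpha> + 1)" "l powr (\<alpha> - 1)"]
      have "l powr (\<alpha> - 1) / (l * N + s) powr (\<alpha> + 2) =
          (l powr (\<alpha> - 1) / (l * N + s) powr (\<alpha> + 1) - N * (l powr \<alpha> / (l * N + s) powr (\<alpha> + 2))) / s"
        unfolding e using l by simp
      then show ?thesis using True by simp
    qed simp
    then show ?thesis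
      unfolding J2_def eq
      by (intro has_bochner_integral_divide_zero has_bochner_integral_diff has_bochner_integral_mult_right j0 j1)
  qed
  have uN: "u * N < 1" using B s L by (simp add: u_def)
  have J2: "J2 = u powr \<alpha> / (\<alpha> * (\<alpha> + 1) * s\<^sup>2) * (\<alpha> + 1 - \<alpha> * (u * N))"
  proof -
    have "(P / (\<alpha> * s) - N * (P * u / (b * s))) / s = P / (\<alpha> * b * s\<^sup>2) * (b - \<alpha> * (u * N))" if "b > 0" for P b
      using s \<alpha> that by (simp add: power2_eq_square field_simps)
    from this[of "\<alpha> + 1" "u powr \<alpha>"] show ?thesis
      using \<alpha> u by (simp add: J2_def J0_def J1_def powr_add)
  qed
  have "\<alpha> * (u * N) \<le> \<alpha> * 1" using uN \<alpha> by (intro mult_left_mono) auto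
  then have d: "\<alpha> + 1 - \<alpha> * (u * N) > 0" by simp
  have "J1 = \<alpha> / (1 / L * (\<alpha> + 1) + N / s) * J2"
  proof -
    have "1 / L * (\<alpha> + 1) + N / s = (\<alpha> + 1 - \<alpha> * (u * N)) / (u * s)"
    proof -
      have "1 / u = N + s / L" using L B by (simp add: u_def field_simps)
      moreover have "(\<alpha> + 1 - \<alpha> * (u * N)) / (u * s) = ((\<alpha> + 1) * (1 / u) - \<alpha> * N) / s"
        using u s by (simp add: field_simps)
      ultimately have "(\<alpha> + 1 - \<alpha> * (u * N)) / (u * s) = ((\<alpha> + 1) * (N + s / L) - \<alpha> * N) / s"
        by (simp only:)
      also have "\<dots> = 1 / L * (\<alpha> + 1) + N / s" using s L by (simp add: field_simps)
      finally show ?thesis by simp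
    qed
    moreover have "P * u / (b * s) = \<alpha> / (w / (u * s)) * (P / (\<alpha> * b * s\<^sup>2) * w)" if "w > 0" "b > 0" for P b w
      using u s \<alpha> that by (simp add: power2_eq_square field_simps)
    from this[OF d, of "\<alpha> + 1" "u powr \<alpha>"]
    have "u powr \<alpha> * u / ((\<alpha> + 1) * s) = \<alpha> / ((\<alpha> + 1 - \<alpha> * (u * N)) / (u * s)) * J2"
      using \<alpha> unfolding J2 by simp
    ultimately show ?thesis
      using u by (simp only: J1_def powr_add powr_one)
  qed
  moreover have "J2 > 0" unfolding J2 using u s \<alpha> d by simp
  moreover have "J0 > 0" unfolding J0_def using u s \<alpha> by simp
  ultimately show thesis
    using that[OF mixing_weight_integral[OF _ j0] _ mixing_weight_integral[OF _ j2] _ mixing_weight_integral[OF _ j1]]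
      \<alpha> Gamma_real_pos[of "\<alpha> + 1"] Gamma_real_pos[of "\<alpha> + 2"] by simp
qed

end

section \<open>Conjugate form of the posterior kernel\<close>

lemma normal_product_eq:
  assumes "finite I" and v: "\<And>i. i \<in> I \<Longrightarrow> v i > 0" and r: "r > 0"
  shows "(\<Prod>i\<in>I. normal_density 0 (sqrt (v i / r)) (x i)) =
    (\<Prod>i\<in>I. 1 / sqrt (2 * pi * v i)) * r powr (real (card I) / 2) * exp (- r * (\<Sum>i\<in>I. (x i)\<^sup>2 / v i) / 2)"
proof -
  have "normal_density 0 (sqrt (v i / r)) (x i) = 1 / sqrt (2 * pi * v i) * sqrt r * exp (- r * ((x i)\<^sup>2 / v i) / 2)"
    if "i \<in> I" for i
  proof -
    have 1: "(sqrt (v i / r))\<^sup>2 = v i / r" using v[OF that] r by simp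
    have 2: "sqrt (2 * pi * (v i / r)) = sqrt (2 * pi * v i) / sqrt r"
      unfolding real_sqrt_divide[symmetric] by simp
    have 3: "- (x i - 0)\<^sup>2 / (2 * (v i / r)) = - r * ((x i)\<^sup>2 / v i) / 2" by (simp add: mult_ac)
    show ?thesis unfolding normal_density_def 1 2 3 by simp
  qed
  then have "(\<Prod>i\<in>I. normal_density 0 (sqrt (v i / r)) (x i)) =
      (\<Prod>i\<in>I. 1 / sqrt (2 * pi * v i) * sqrt r * exp (- r * ((x i)\<^sup>2 / v i) / 2))"
    by (intro prod.cong refl)
  also have "\<dots> = (\<Prod>i\<in>I. 1 / sqrt (2 * pi * v i)) * sqrt r ^ card I * exp (\<Sum>i\<in>I. - r * ((x i)\<^sup>2 / v i) / 2)"
    by (simp only: prod.distrib prod_constant exp_sum[OF assms(1)])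
  also have "(\<Sum>i\<in>I. - r * ((x i)\<^sup>2 / v i) / 2) = - r * (\<Sum>i\<in>I. (x i)\<^sup>2 / v i) / 2"
    by (simp add: sum_distrib_left sum_divide_distrib sum_negf)
  also have "sqrt r ^ card I = r powr (real (card I) / 2)"
    using r by (simp add: powr_half_sqrt[symmetric] powr_power)
  finally show ?thesis .
qed

text \<open>Conjugacy acts coordinate by coordinate: the variances d_i / \<eta> and d_i (c_i / l -
  1) / \<eta> add up to c_i d_i / (l \<eta>), so the marginal density of x supplies (l
  \<eta>)^(p/2). The values of a and e make the resulting exponents of l and \<eta> equal to
  \<alpha> - 1 and \<alpha>.\<close>

lemma posterior_kernel_eq:
  fixes x :: "nat \<Rightarrow> real"
  assumes d: "\<And>i. i \<in> {1..p} \<Longrightarrow> d i > 0" and c: "\<And>i. i \<in> {1..p} \<Longrightarrow> c i \<ge> 1"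
    and \<alpha>: "\<alpha> > 0" and \<gamma>: "\<gamma> \<ge> 1" and s: "s > 0" and n: "n \<ge> 1"
  defines "a \<equiv> \<alpha> - real p / 2 - 1" and "e \<equiv> \<alpha> - real p / 2 - real n / 2"
    and "N \<equiv> \<Sum>i=1..p. (x i)\<^sup>2 / (c i * d i)"
  obtains C where "C > 0" "posterior_kernel p n d c \<gamma> a 0 e x s = (\<lambda>(\<theta>, y).
    C * mixing_weight N s (1 / \<gamma>) \<alpha> (\<alpha> + 1) y *
    (\<Prod>i=1..p. normal_density ((1 - fst y / c i) * x i) (sqrt (d i * (1 - fst y / c i) / snd y)) (\<theta> i)))"
proof -
  define C1 where "C1 = (\<Prod>i=1..p. 1 / sqrt (2 * pi * (c i * d i)))"
  define C2 where "C2 = (1 / 2) powr (real n / 2) * s powr (real n / 2 - 1) / Gamma (real n / 2)"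
  have cd: "c i * d i > 0" if "i \<in> {1..p}" for i using d[OF that] c[OF that] by (intro mult_pos_pos) auto
  have "C1 > 0" unfolding C1_def
  proof (intro prod_pos)
    fix i assume "i \<in> {1..p}"
    then show "1 / sqrt (2 * pi * (c i * d i)) > 0" using cd[of i] by simp
  qed
  moreover have "C2 > 0" unfolding C2_def using s n Gamma_real_pos[of "real n / 2"] by simp
  ultimately have C: "C1 * C2 > 0" by simp
  have "posterior_kernel p n d c \<gamma> a 0 e x s (\<theta>, l, \<eta>) = C1 * C2 * mixing_weight N s (1 / \<gamma>) \<alpha> (\<alpha> + 1) (l, \<eta>) *
      (\<Prod>i=1..p. normal_density ((1 - l / c i) * x i) (sqrt (d i * (1 - l / c i) / \<eta>)) (\<theta> i))" for \<theta> l \<eta>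
  proof (cases "0 < l \<and> l < 1 / \<gamma> \<and> 0 < \<eta>")
    case False
    have "posterior_kernel p n d c \<gamma> a 0 e x s (\<theta>, l, \<eta>) = 0"
    proof -
      consider "\<eta> \<le> 0" | "l < 0" | "l = 0" | "l = 1 / \<gamma>" | "l > 1 / \<gamma>" using False by linarith
      then show ?thesis
      proof cases
        \<comment> \<open>As \<open>0 powr 0 = 0\<close>, the prior vanishes at l = 1 / \<gamma>
          even with b = 0, in agreement with the open interval in
          \<open>mixing_weight\<close>.\<close>
        case 4
        then have "1 - \<gamma> * l = 0" using \<gamma> by simp
        then show ?thesis by (simp add: posterior_kernel_def prior_density_def)
      qed (auto simp: posterior_kernel_def prior_density_def)
    qed
    then show ?thesis using False by (auto simp: mixing_weight_def indicator_def)
  next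
    case True
    then have l: "0 < l" "l < 1 / \<gamma>" "0 < \<eta>" by auto
    have "1 / \<gamma> \<le> 1" using \<gamma> by simp
    then have lc: "l < c i" if "i \<in> {1..p}" for i using l c[OF that] by linarith
    have \<gamma>l: "1 - \<gamma> * l > 0" using l \<gamma> by (simp add: pos_less_divide_eq mult.commute)
    let ?n1 = "\<lambda>i. normal_density 0 (sqrt (c i * d i / (l * \<eta>))) (x i)"
    let ?n2 = "\<lambda>i. normal_density ((1 - l / c i) * x i) (sqrt (d i * (1 - l / c i) / \<eta>)) (\<theta> i)"
    have "normal_density (\<theta> i) (sqrt (d i / \<eta>)) (x i) * normal_density 0 (sqrt (d i * (c i / l - 1) / \<eta>)) (\<theta> i) = ?n1 i * ?n2 i"
      if i: "i \<in> {1..p}" for i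
    proof -
      let ?u = "d i / \<eta>" and ?v = "d i * (c i / l - 1) / \<eta>"
      have uv: "?u > 0" "?v > 0" using d[OF i] lc[OF i] l by simp_all
      have ci: "c i > 0" using c[OF i] by simp
      have 1: "?u + ?v = c i * d i / (l * \<eta>)" using l by (simp add: field_simps)
      have "x i * ?v / (?u + ?v) = (1 - l / c i) * x i" "?u * ?v / (?u + ?v) = d i * (1 - l / c i) / \<eta>"
        unfolding 1 using l ci d[OF i] by (simp_all add: field_simps)
      then show ?thesis using normal_density_conjugate[OF uv, of "\<theta> i" "x i"] by (simp only: 1)
    qed
    then have "(\<Prod>i=1..p. normal_density (\<theta> i) (sqrt (d i / \<eta>)) (x i)) *
        (\<Prod>i=1..p. normal_density 0 (sqrt (d i * (c i / l - 1) / \<eta>)) (\<theta> i)) = (\<Prod>i=1..p. ?n1 i) * (\<Prod>i=1..p. ?n2 i)"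
      unfolding prod.distrib[symmetric] by (intro prod.cong refl)
    moreover have "(\<Prod>i=1..p. ?n1 i) = C1 * (l * \<eta>) powr (real p / 2) * exp (- (l * \<eta>) * N / 2)"
      using normal_product_eq[of "{1..p}" "\<lambda>i. c i * d i" "l * \<eta>" x] cd l by (simp add: C1_def N_def)
    moreover have "scaled_chi2_density n \<eta> s = C2 * \<eta> powr (real n / 2) * exp (- \<eta> * s / 2)"
      using s l by (simp add: scaled_chi2_density_def C2_def powr_divide)
    moreover have "(l * \<eta>) powr (real p / 2) * exp (- (l * \<eta>) * N / 2) * (\<eta> powr (real n / 2) * exp (- \<eta> * s / 2)) *
        (l powr a * \<eta> powr e) = mixing_weight N s (1 / \<gamma>) \<alpha> (\<alpha> + 1) (l, \<eta>)"
    proof -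
      have "(l * \<eta>) powr (real p / 2) * l powr a * \<eta> powr (real n / 2) * \<eta> powr e = l powr (\<alpha> - 1) * \<eta> powr \<alpha>"
      proof -
        have "l powr (real p / 2) * l powr a = l powr (\<alpha> - 1)"
          "\<eta> powr (real p / 2) * (\<eta> powr (real n / 2) * \<eta> powr e) = \<eta> powr \<alpha>"
          by (simp_all add: a_def e_def powr_add[symmetric])
        moreover have "(l * \<eta>) powr (real p / 2) * l powr a * \<eta> powr (real n / 2) * \<eta> powr e =
            (l powr (real p / 2) * l powr a) * (\<eta> powr (real p / 2) * (\<eta> powr (real n / 2) * \<eta> powr e))"
          using l by (simp add: powr_mult mult_ac)
        ultimately show ?thesis by (simp only:)
      qed
      moreover have "exp (- (l * \<eta>) * N / 2) * exp (- \<eta> * s / 2) = exp (- ((l * N + s) / 2) * \<eta>)"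
        unfolding exp_add[symmetric] by (simp add: field_simps)
      ultimately show ?thesis using True by (simp add: mixing_weight_def mult_ac) 
    qed
    ultimately show ?thesis
      using True \<gamma>l by (simp add: posterior_kernel_def normal_likelihood_def prior_density_def) (simp add: mult_ac)
  qed
  then show thesis using that[OF C] by (simp add: fun_eq_iff)
qed

lemma mixing_weight_times_eta:
  "snd y * mixing_weight N s L \<beta> q y = mixing_weight N s L \<beta> (q + 1) y"
  by (cases y) (auto simp: mixing_weight_def indicator_def powr_mult_base[symmetric] powr_diff)

lemma mixing_weight_times_l:
  "fst y * mixing_weight N s L \<beta> q y = mixing_weight N s L (\<beta> + 1) q y"
  by (cases y) (auto simp: mixing_weight_def indicator_def powr_diff)

text \<open>Averaging the conditional mean (1 - \<lambda> / c_i) x_i with weight \<eta> gives x_i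
  (I2 - I1 / c_i) up to a constant, and division by I2 leaves (1 - h(W) / c_i) x_i.\<close>

lemma posterior_moments:
  fixes x :: "nat \<Rightarrow> real"
  assumes p: "p \<ge> 1" and d: "\<And>i. i \<in> {1..p} \<Longrightarrow> d i > 0" and c: "\<And>i. i \<in> {1..p} \<Longrightarrow> c i \<ge> 1"
    and \<alpha>: "\<alpha> > 0" and \<gamma>: "\<gamma> \<ge> 1" and s: "s > 0" and n: "n \<ge> 1"
  defines "a \<equiv> \<alpha> - real p / 2 - 1" and "e \<equiv> \<alpha> - real p / 2 - real n / 2"
    and "N \<equiv> \<Sum>i=1..p. (x i)\<^sup>2 / (c i * d i)"
  shows "posterior_ok p n d c \<gamma> a 0 e x s"
    and "\<And>i. i \<in> {1..p} \<Longrightarrow>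
      posterior_exp p n d c \<gamma> a 0 e (\<lambda>(\<theta>, l, \<eta>). \<eta> * \<theta> i) x s / posterior_exp p n d c \<gamma> a 0 e (\<lambda>(\<theta>, l, \<eta>). \<eta>) x s =
      (1 - h_SB \<alpha> \<gamma> (N / s) / c i) * x i"
proof -
  let ?M = "lborel \<Otimes>\<^sub>M lborel :: (real \<times> real) measure"
  let ?w = "mixing_weight N s (1 / \<gamma>)"
  have L: "1 / \<gamma> > 0" using \<gamma> by simp
  have N: "N \<ge> 0"
    unfolding N_def using d c by (intro sum_nonneg divide_nonneg_nonneg mult_nonneg_nonneg) (auto intro: less_imp_le order_trans[OF zero_le_one])
  obtain C where C: "C > 0" and ker: "posterior_kernel p n d c \<gamma> a 0 e x s = (\<lambda>(\<theta>, y). C * ?w \<alpha> (\<alpha> + 1) y *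
      (\<Prod>i=1..p. normal_density ((1 - fst y / c i) * x i) (sqrt (d i * (1 - fst y / c i) / snd y)) (\<theta> i)))"
    using posterior_kernel_eq[where p = p and d = d and c = c and x = x, OF d c \<alpha> \<gamma> s n, folded a_def e_def N_def]
    by blast
  define \<kappa> where "\<kappa> = (\<lambda>y. C * ?w \<alpha> (\<alpha> + 1) y)"
  define m where "m = (\<lambda>i (y :: real \<times> real). (1 - fst y / c i) * x i)"
  define \<tau> where "\<tau> = (\<lambda>i (y :: real \<times> real). sqrt (d i * (1 - fst y / c i) / snd y))"
  define k where "k = posterior_kernel p n d c \<gamma> a 0 e x s"
  have k_eq: "k = (\<lambda>(\<theta>, y). \<kappa> y * (\<Prod>i=1..p. normal_density (m i y) (\<tau> i y) (\<theta> i)))"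
    unfolding k_def ker \<kappa>_def m_def \<tau>_def ..
  obtain I0 I1 I2 where I: "has_bochner_integral ?M (?w \<alpha> (\<alpha> + 1)) I0" "I0 > 0"
    "has_bochner_integral ?M (?w \<alpha> (\<alpha> + 2)) I2" "I2 > 0" "has_bochner_integral ?M (?w (\<alpha> + 1) (\<alpha> + 2)) I1"
    "I1 = \<alpha> / (1 / (1 / \<gamma>) * (\<alpha> + 1) + N / s) * I2"
    using mixing_weight_integrals[OF N s L \<alpha>] by blast
  have I1: "I1 = h_SB \<alpha> \<gamma> (N / s) * I2" using I(6) by (simp add: h_SB_def)
  have \<kappa>0: "has_bochner_integral ?M \<kappa> (C * I0)"
    unfolding \<kappa>_def by (intro has_bochner_integral_mult_right I)
  have \<kappa>2: "has_bochner_integral ?M (\<lambda>y. snd y * \<kappa> y) (C * I2)"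
  proof -
    have "snd y * \<kappa> y = C * ?w \<alpha> (\<alpha> + 2) y" for y
      using mixing_weight_times_eta[of y N s "1 / \<gamma>" \<alpha> "\<alpha> + 1"] by (simp add: \<kappa>_def mult.left_commute add.assoc)
    then show ?thesis using has_bochner_integral_mult_right[OF I(3), of C] by simp
  qed
  have \<kappa>1: "has_bochner_integral ?M (\<lambda>y. snd y * fst y * \<kappa> y) (C * I1)"
  proof -
    have "snd y * fst y * \<kappa> y = C * ?w (\<alpha> + 1) (\<alpha> + 2) y" for y
    proof -
      have "snd y * fst y * \<kappa> y = C * (snd y * (fst y * ?w \<alpha> (\<alpha> + 1) y))" by (simp add: \<kappa>_def mult_ac)
      also have "\<dots> = C * ?w (\<alpha> + 1) (\<alpha> + 2) y"
        unfolding mixing_weight_times_l mixing_weight_times_eta by (simp add: add.assoc)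
      finally show ?thesis .
    qed
    then show ?thesis using has_bochner_integral_mult_right[OF I(5), of C] by simp
  qed
  \<comment> \<open>Here \<gamma> \<ge> 1 enters: \<lambda> < 1 / \<gamma> \<le> 1 \<le> c_i keeps
    all conditional variances positive.\<close>
  have supp: "0 < fst y \<and> fst y < 1 \<and> 0 < snd y" if "\<kappa> y \<noteq> 0" for y
  proof -
    have "1 / \<gamma> \<le> 1" using \<gamma> by simp
    then show ?thesis
      using that by (cases y) (auto simp: \<kappa>_def mixing_weight_def indicator_def split: if_splits)
  qed
  have frac: "0 < 1 - fst y / c i" "1 - fst y / c i \<le> 1" if "\<kappa> y \<noteq> 0" "i \<in> {1..p}" for i y
    using supp[OF that(1)] c[OF that(2)] by simp_all
  have \<tau>: "\<tau> i y > 0" if "i \<in> {1..p}" "\<kappa> y \<noteq> 0" for i y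
    unfolding \<tau>_def using frac(1)[OF that(2,1)] supp[OF that(2)] d[OF that(1)] by simp
  have \<tau>_sq: "snd y * (\<tau> i y)\<^sup>2 \<le> d i" if "i \<in> {1..p}" "\<kappa> y \<noteq> 0" for i y
  proof -
    have "snd y * (\<tau> i y)\<^sup>2 = d i * (1 - fst y / c i)"
      unfolding \<tau>_def using frac[OF that(2,1)] supp[OF that(2)] d[OF that(1)] by (simp add: less_imp_le)
    also have "\<dots> \<le> d i * 1" using frac[OF that(2,1)] d[OF that(1)] by (intro mult_left_mono) auto
    finally show ?thesis by simp
  qed
  have meas: "\<kappa> \<in> borel_measurable ?M" "\<And>i. m i \<in> borel_measurable ?M" "\<And>i. \<tau> i \<in> borel_measurable ?M"
    unfolding \<kappa>_def m_def \<tau>_def by measurable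
  have M: "sigma_finite_measure ?M" by (rule lborel_pair.sigma_finite_measure_axioms)
  have one: "1 \<in> {1..p}" using p by simp
  \<comment> \<open>For moments of (\<lambda>, \<eta>) alone the distinguished coordinate carries
    the constant function 1, and index 1 is as good as any.\<close>
  have mass: "integrable (param_space p) (\<lambda>v. g (snd v) * k v)" "(\<integral>v. g (snd v) * k v \<partial>param_space p) = J"
    if g: "g \<in> borel_measurable ?M" "has_bochner_integral ?M (\<lambda>y. g y * \<kappa> y) J" for g J
  proof -
    have \<phi>: "has_bochner_integral lborel (\<lambda>t. 1 * normal_density (m 1 y) (\<tau> 1 y) t) 1"
      "(\<integral>t. \<bar>1\<bar> * normal_density (m 1 y) (\<tau> 1 y) t \<partial>lborel) \<le> 1" if "\<kappa> y \<noteq> 0" for y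
      using \<tau>[OF one that] by (auto simp: has_bochner_integral_iff integral_normal_density integrable_normal_density)
    have int: "integrable ?M (\<lambda>y. g y * \<kappa> y * 1)" using g(2) by (simp add: has_bochner_integral_iff)
    note mix = gaussian_mixture[where \<phi> = "\<lambda>_. 1" and m = m and \<tau> = \<tau> and \<kappa> = \<kappa>,
        OF finite_atLeastAtMost one M meas(1) g(1) borel_measurable_const meas(2,3) \<tau> \<phi> int]
    have *: "(\<lambda>v. g (snd v) * k v) = (\<lambda>(\<theta>, y). g y * 1 * (\<kappa> y * (\<Prod>l=1..p. normal_density (m l y) (\<tau> l y) (\<theta> l))))"
      by (simp add: k_eq case_prod_unfold)
    show "integrable (param_space p) (\<lambda>v. g (snd v) * k v)"
      unfolding * param_space_def using mix(1) by simp
    show "(\<integral>v. g (snd v) * k v \<partial>param_space p) = J"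
      unfolding * param_space_def using mix(2) g(2) by (simp add: has_bochner_integral_iff)
  qed
  have mean: "integrable (param_space p) (\<lambda>v. snd (snd v) * fst v i * k v)"
    "(\<integral>v. snd (snd v) * fst v i * k v \<partial>param_space p) = x i * (C * I2 - C * I1 / c i)" if i: "i \<in> {1..p}" for i
  proof -
    define A where "A = (\<lambda>y. 1 + 2 * (m i y)\<^sup>2 + 2 * (\<tau> i y)\<^sup>2)"
    have \<phi>: "has_bochner_integral lborel (\<lambda>t. t * normal_density (m i y) (\<tau> i y) t) (m i y)"
      "(\<integral>t. \<bar>t\<bar> * normal_density (m i y) (\<tau> i y) t \<partial>lborel) \<le> A y" if "\<kappa> y \<noteq> 0" for y
    proof -
      show "has_bochner_integral lborel (\<lambda>t. t * normal_density (m i y) (\<tau> i y) t) (m i y)"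
        using integral_normal_moment_nz_1[OF \<tau>[OF i that], of "m i y"] integrable_normal_moment_nz_1[OF \<tau>[OF i that], of "m i y"]
        by (simp add: has_bochner_integral_iff mult.commute)
      show "(\<integral>t. \<bar>t\<bar> * normal_density (m i y) (\<tau> i y) t \<partial>lborel) \<le> A y"
        unfolding A_def by (rule integral_abs_normal_le[OF \<tau>[OF i that]])
    qed
    \<comment> \<open>The majorant contains the conditional variance, of order 1 / \<eta>.
      Multiplied by \<eta> it is at most d_i, so the integrals of the weight and of \<eta> times the
      weight dominate.\<close>
    have int: "integrable ?M (\<lambda>y. snd y * \<kappa> y * A y)"
    proof (rule Bochner_Integration.integrable_bound)
      show "integrable ?M (\<lambda>y. (1 + 2 * (x i)\<^sup>2) * (snd y * \<kappa> y) + 2 * d i * \<kappa> y)"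
        using \<kappa>0 \<kappa>2 by (simp add: has_bochner_integral_iff)
      show "(\<lambda>y. snd y * \<kappa> y * A y) \<in> borel_measurable ?M"
        unfolding A_def using meas by measurable
      show "AE y in ?M. norm (snd y * \<kappa> y * A y) \<le> norm ((1 + 2 * (x i)\<^sup>2) * (snd y * \<kappa> y) + 2 * d i * \<kappa> y)"
      proof (rule AE_I2)
        fix y
        show "norm (snd y * \<kappa> y * A y) \<le> norm ((1 + 2 * (x i)\<^sup>2) * (snd y * \<kappa> y) + 2 * d i * \<kappa> y)"
        proof (cases "\<kappa> y = 0")
          case False
          have \<kappa>p: "\<kappa> y \<ge> 0" using C by (simp add: \<kappa>_def mixing_weight_nonneg)
          have e0: "snd y > 0" using supp[OF False] by simp
          have "(m i y)\<^sup>2 \<le> (x i)\<^sup>2"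
          proof -
            have "(1 - fst y / c i)\<^sup>2 \<le> 1" using frac[OF False i] by (simp add: power_le_one)
            then show ?thesis using mult_right_mono[of "(1 - fst y / c i)\<^sup>2" 1 "(x i)\<^sup>2"] by (simp add: m_def power_mult_distrib)
          qed
          then have "snd y * (m i y)\<^sup>2 \<le> snd y * (x i)\<^sup>2" using e0 by (intro mult_left_mono) auto
          then have "snd y * A y \<le> (1 + 2 * (x i)\<^sup>2) * snd y + 2 * d i"
            using \<tau>_sq[OF i False] by (simp add: A_def algebra_simps)
          then have "(snd y * A y) * \<kappa> y \<le> ((1 + 2 * (x i)\<^sup>2) * snd y + 2 * d i) * \<kappa> y"
            using \<kappa>p by (rule mult_right_mono)
          moreover have "0 \<le> (snd y * A y) * \<kappa> y" using e0 \<kappa>p by (simp add: A_def)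
          ultimately show ?thesis by (simp add: algebra_simps)
        qed simp
      qed
    qed
    note mix = gaussian_mixture[where \<phi> = "\<lambda>t. t" and m = m and \<tau> = \<tau> and \<kappa> = \<kappa> and E = "m i" and g = snd,
        OF finite_atLeastAtMost i M meas(1) _ _ meas(2,3) \<tau> \<phi> int]
    have *: "(\<lambda>v. snd (snd v) * fst v i * k v) =
        (\<lambda>(\<theta>, y). snd y * \<theta> i * (\<kappa> y * (\<Prod>l=1..p. normal_density (m l y) (\<tau> l y) (\<theta> l))))"
      by (simp add: k_eq case_prod_unfold)
    show "integrable (param_space p) (\<lambda>v. snd (snd v) * fst v i * k v)"
      unfolding * param_space_def by (rule mix(1)) simp_all
    have "(\<integral>v. snd (snd v) * fst v i * k v \<partial>param_space p) = (\<integral>y. snd y * m i y * \<kappa> y \<partial>?M)"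
      unfolding * param_space_def by (rule mix(2)) simp_all
    also have "\<dots> = (\<integral>y. x i * (snd y * \<kappa> y - (snd y * fst y * \<kappa> y) / c i) \<partial>?M)"
      by (intro Bochner_Integration.integral_cong refl) (simp add: m_def algebra_simps)
    also have "\<dots> = x i * (C * I2 - C * I1 / c i)"
      using \<kappa>1 \<kappa>2 by (simp add: has_bochner_integral_iff)
    finally show "(\<integral>v. snd (snd v) * fst v i * k v \<partial>param_space p) = x i * (C * I2 - C * I1 / c i)" .
  qed
  have k0: "integrable (param_space p) k" "(\<integral>v. k v \<partial>param_space p) = C * I0"
    using mass[of "\<lambda>_. 1" "C * I0"] \<kappa>0 by simp_all
  have k2: "integrable (param_space p) (\<lambda>v. snd (snd v) * k v)" "(\<integral>v. snd (snd v) * k v \<partial>param_space p) = C * I2"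
    using mass[of snd "C * I2"] \<kappa>2 by simp_all
  show "posterior_ok p n d c \<gamma> a 0 e x s"
    unfolding posterior_ok_def Let_def k_def[symmetric]
    using k0 k2 mean(1) C I(2) by (auto simp: case_prod_unfold)
  fix i assume i: "i \<in> {1..p}"
  have E: "posterior_exp p n d c \<gamma> a 0 e (\<lambda>(\<theta>, l, \<eta>). \<eta> * \<theta> i) x s = x i * (C * I2 - C * I1 / c i) / (C * I0)"
    "posterior_exp p n d c \<gamma> a 0 e (\<lambda>(\<theta>, l, \<eta>). \<eta>) x s = C * I2 / (C * I0)"
    unfolding posterior_exp_def k_def[symmetric] k0(2)
    using mean(2)[OF i] k2(2) by (simp_all add: case_prod_unfold)
  show "posterior_exp p n d c \<gamma> a 0 e (\<lambda>(\<theta>, l, \<eta>). \<eta> * \<theta> i) x s / posterior_exp p n d c \<gamma> a 0 e (\<lambda>(\<theta>, l, \<eta>). \<eta>) x s =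
      (1 - h_SB \<alpha> \<gamma> (N / s) / c i) * x i"
    unfolding E I1 using C I(2,4) c[OF i] by (simp add: field_simps)
qed

lemma generalized_Bayes_theta_SB:
  assumes p: "p \<ge> 1" and d: "\<And>i. i \<in> {1..p} \<Longrightarrow> d i > 0" and c: "\<And>i. i \<in> {1..p} \<Longrightarrow> c i \<ge> 1"
    and \<alpha>: "\<alpha> > 0" and \<gamma>: "\<gamma> \<ge> 1" and n: "n \<ge> 1"
  shows "generalized_Bayes p n d c \<alpha> \<gamma> (theta_SB p n d c \<alpha> \<gamma>)"
proof -
  \<comment> \<open>With b = 0 the constraint on b reads n/2 + e - a = 1, so \<alpha> = p/2 + a + 1;
    solving these two equations gives a and e.\<close>
  let ?a = "\<alpha> - real p / 2 - 1" and ?e = "\<alpha> - real p / 2 - real n / 2"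
  show ?thesis unfolding generalized_Bayes_def
  proof (intro exI conjI ballI allI impI)
    show "\<alpha> - real p / 2 - 1 > - real p / 2 - 1" "(0 :: real) > - 1"
      "\<alpha> - real p / 2 - real n / 2 > - real p / 2 - real n / 2 - 2"
      "0 = real n / 2 - ?a + ?e - 1"
      "\<alpha> = (real p / 2 + ?a + 1) / (real n / 2 + ?e - ?a)"
      using \<alpha> by simp_all
    fix l i assume l: "l \<in> {0<..<1 / \<gamma>}" and i: "i \<in> {1..p}"
    have "1 / \<gamma> \<le> 1" using \<gamma> by simp
    then have "l < c i" using l c[OF i] by simp
    then show "c i / l - 1 > 0" using l by simp
  next
    fix x z :: "nat \<Rightarrow> real"
    assume s: "(\<Sum>i=1..n. (z i)\<^sup>2) > 0"
    note pm = posterior_moments[where p = p and d = d and c = c and x = x, OF p d c \<alpha> \<gamma> s n]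
    have W: "W_stat p n d c (x, z) = (\<Sum>i=1..p. (x i)\<^sup>2 / (c i * d i)) / (\<Sum>i=1..n. (z i)\<^sup>2)"
      by (simp add: W_stat_def)
    show "let s = \<Sum>i=1..n. (z i)\<^sup>2;
        E = posterior_exp p n d c \<gamma> ?a 0 ?e
      in posterior_ok p n d c \<gamma> ?a 0 ?e x s \<and>
        (\<forall>i\<in>{1..p}. theta_SB p n d c \<alpha> \<gamma> (x, z) i =
          E (\<lambda>(\<theta>, l, \<eta>). \<eta> * \<theta> i) x s / E (\<lambda>(\<theta>, l, \<eta>). \<eta>) x s)"
      unfolding Let_def
    proof (intro conjI ballI)
      fix i assume i: "i \<in> {1..p}"
      show "theta_SB p n d c \<alpha> \<gamma> (x, z) i =
          posterior_exp p n d c \<gamma> ?a 0 ?e (\<lambda>(\<theta>, l, \<eta>). \<eta> * \<theta> i) x (\<Sum>i=1..n. (z i)\<^sup>2) /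
          posterior_exp p n d c \<gamma> ?a 0 ?e (\<lambda>(\<theta>, l, \<eta>). \<eta>) x (\<Sum>i=1..n. (z i)\<^sup>2)"
      proof -
        have lhs: "theta_SB p n d c \<alpha> \<gamma> (x, z) i = (1 - h_SB \<alpha> \<gamma> ((\<Sum>i=1..p. (x i)\<^sup>2 / (c i * d i)) / (\<Sum>i=1..n. (z i)\<^sup>2)) / c i) * x i"
          using i by (simp add: theta_SB_def shrinkage_est_def W)
        show ?thesis unfolding lhs by (rule pm(2)[symmetric]) (rule i | assumption)+
      qed
    qed (rule pm(1); assumption)
  qed
qed

theorem corollary4p4:
  fixes p n :: nat and d c :: "nat \<Rightarrow> real" and f :: "real \<Rightarrow> real" and j \<alpha> \<gamma> :: real
  assumes "p \<ge> 3" and "n \<ge> 1"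
    and "\<forall>i k. 1 \<le> i \<and> i \<le> k \<and> k \<le> p \<longrightarrow> d k \<le> d i" and "d p > 0"
    and "admissible_f p n d f"
    and "\<alpha> > 0" and "\<gamma> > 0"
    and "(\<exists>\<eta>. condition_i p n d j c \<alpha> \<gamma> \<eta>) \<or> (\<exists>\<nu>. condition_ii p n d j c \<alpha> \<gamma> \<nu>)"
  shows "minimax p n d f j (theta_SB p n d c \<alpha> \<gamma>)
    \<and> cond_number_decreasing p d c (h_SB \<alpha> \<gamma>)
    \<and> (\<gamma> \<ge> 1 \<longrightarrow> generalized_Bayes p n d c \<alpha> \<gamma> (theta_SB p n d c \<alpha> \<gamma>))"
proof -
  note \<alpha> = \<open>\<alpha> > 0\<close> and \<gamma> = \<open>\<gamma> > 0\<close>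
  interpret ordered_scales p d
    using assms(1,3,4) by unfold_locales auto
  have p1: "p \<ge> 1" using assms(1) by simp
  interpret elliptical_model p n d f
    using p1 assms(2,5) d_pos by unfold_locales auto
  have dp1: "d p \<le> d 1" using d_le_d1[of p] p1 by simp
  from assms(8) show ?thesis
  proof
    assume "\<exists>\<eta>. condition_i p n d j c \<alpha> \<gamma> \<eta>"
    then obtain \<eta> where ci: "condition_i p n d j c \<alpha> \<gamma> \<eta>" by blast
    have c: "c i \<ge> 1" "c i > 0" if "i \<in> {1..p}" for i
      using condition_i_c(3)[OF ci that] by simp_all
    have "minimax p n d f j (theta_SB p n d c \<alpha> \<gamma>)"
    proof (rule minimax_theta_SB[where r = "\<lambda>i. (d i / d 1) powr \<eta>"])
      show "\<alpha> \<le> 2 / (real n + 2) * ((\<Sum>i=1..p. (d i / d 1) powr \<eta>) - 2)"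
        using ci by (simp add: condition_i_def u_plus_def)
      show "(d i / d 1) powr \<eta> \<le> 1" if "i \<in> {1..p}" for i
        using ratio_powr_le_1[OF that] ci by (simp add: condition_i_def)
      show "d i powr (1 - j) / c i = d 1 powr (1 - j) * (d i / d 1) powr \<eta>" if "i \<in> {1..p}" for i
        by (rule condition_i_ratio[OF ci that])
    qed (use c \<alpha> \<gamma> in auto)
    moreover have "cond_number_decreasing p d c (h_SB \<alpha> \<gamma>)"
      by (rule cond_number_decreasingI[OF p1 d_pos dp1 condition_i_pair[OF ci \<alpha> \<gamma>]])
    ultimately show ?thesis
      using generalized_Bayes_theta_SB[of p d c \<alpha> \<gamma> n] p1 d_pos c \<alpha> assms(2) by blast
  next
    assume "\<exists>\<nu>. condition_ii p n d j c \<alpha> \<gamma> \<nu>"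
    then obtain \<nu> where cii: "condition_ii p n d j c \<alpha> \<gamma> \<nu>" by blast
    note facts = condition_ii_facts[OF cii \<alpha>]
    have c: "c i \<ge> 1" "c i > 0" if "i \<in> {1..p}" for i
      using facts(7)[OF that] by simp_all
    \<comment> \<open>\<open>r\<close> is a_i / a_1. At i = p it is the last term of
      \<open>u_minus\<close>, and it is at most 1 there because c_1 < c_p and j < 1.\<close>
    define r where "r = (\<lambda>i. if i = p then c 1 / c p * (d p / d 1) powr (1 - j) else (d i / d 1) powr \<nu>)"
    have c1: "c 1 > 0" and cp: "c p > 0" using c(2)[of 1] c(2)[of p] p1 by simp_all
    have "minimax p n d f j (theta_SB p n d c \<alpha> \<gamma>)"
    proof (rule minimax_theta_SB[where r = r])
      have "{1..p} = insert p {1..p-1}" using p1 by auto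
      then have "(\<Sum>i=1..p. r i) = r p + (\<Sum>i=1..p-1. r i)"
        using p1 by (simp only:) (subst sum.insert, auto)
      also have "(\<Sum>i=1..p-1. r i) = (\<Sum>i=1..p-1. (d i / d 1) powr \<nu>)"
        using p1 by (intro sum.cong) (auto simp: r_def)
      finally show "\<alpha> \<le> 2 / (real n + 2) * ((\<Sum>i=1..p. r i) - 2)"
        using cii by (simp add: condition_ii_def u_minus_def r_def algebra_simps)
      show "r i \<le> 1" if i: "i \<in> {1..p}" for i
      proof (cases "i = p")
        case True
        have "c 1 / c p * (d p / d 1) powr (1 - j) \<le> 1 * 1"
          using facts(1,6) c1 cp ratio_powr_le_1[of p "1 - j"] p1 by (intro mult_mono) auto
        then show ?thesis using True by (simp add: r_def)
      next
        case False
        then show ?thesis using ratio_powr_le_1[OF i facts(2)] by (simp add: r_def)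
      qed
      show "d i powr (1 - j) / c i = d 1 powr (1 - j) / c 1 * r i" if i: "i \<in> {1..p}" for i
      proof (cases "i = p")
        case True
        then show ?thesis
          using c1 d_pos[OF i] d1_pos by (simp add: r_def powr_divide)
      next
        case False
        then have "i \<in> {1..p-1}" using i by auto
        then show ?thesis using condition_ii_ratio[OF cii \<alpha>, of i] False by (simp add: r_def)
      qed
    qed (use c c1 \<alpha> \<gamma> in auto)
    moreover have "cond_number_decreasing p d c (h_SB \<alpha> \<gamma>)"
      by (rule cond_number_decreasingI[OF p1 d_pos dp1 condition_ii_pair[OF cii \<alpha> \<gamma>]])
    ultimately show ?thesis
      using generalized_Bayes_theta_SB[of p d c \<alpha> \<gamma> n] p1 d_pos c \<alpha> assms(2) by blast
  qed
qed

end
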